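(* Let $X$ be a finite psyquandle, let $S \subset \mathrm{Hom}(X,X)$ be a set of psyquandle endomorphisms of $X$, and let $L$ be an oriented singular knot. Then the psyquandle coloring quiver $\mathcal{PQ}_X^S(L)$ is an invariant of $L$; that is, if $D$ and $D'$ are two oriented singular knot diagrams representing the same oriented singular knot (related by a finite sequence of oriented singular Reidemeister moves), then the quivers $\mathcal{PQ}_X^S(D)$ and $\mathcal{PQ}_X^S(D')$ are isomorphic as directed multigraphs.
   Context: **Psyquandles.** A psyquandle is a set $X$ with four binary operations $\underline{\triangleright},\overline{\triangleright},\underline{\bullet},\overline{\bullet}$ such that: (0) Each operation $*$ of the four is right-invertible: there is an operation $*^{-1}$ with $(x*y)*^{-1}y=x=(x*^{-1}y)*y$ for all $x,y\in X$. (i) $x\,\underline{\triangleright}\,x=x\,\overline{\triangleright}\,x$ for all $x\in X$. (ii) The maps $X\times X\to X\times X$, $(x,y)\mapsto(y\,\overline{\triangleright}\,x,\;x\,\underline{\triangleright}\,y)$ and $(x,y)\mapsto(y\,\overline{\bullet}\,x,\;x\,\underline{\bullet}\,y)$, are invertible. (iii) For all $x,y,z\in X$: $(x\underline{\triangleright}y)\underline{\triangleright}(z\underline{\triangleright}y)=(x\underline{\triangleright}z)\underline{\triangleright}(y\overline{\triangleright}z)$, $(x\underline{\triangleright}y)\overline{\triangleright}(z\underline{\triangleright}y)=(x\overline{\triangleright}z)\underline{\triangleright}(y\overline{\triangleright}z)$, $(x\overline{\triangleright}y)\overline{\triangleright}(z\overline{\triangleright}y)=(x\overline{\triangleright}z)\overline{\triangleright}(y\underline{\triangleright}z)$.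 (iv) For all $x,y\in X$: $x\,\underline{\bullet}\,((y\overline{\triangleright}x)\overline{\bullet}^{-1}x)=[(x\underline{\triangleright}y)\overline{\bullet}^{-1}y]\,\overline{\triangleright}\,[(y\overline{\triangleright}x)\overline{\bullet}^{-1}x]$, $y\,\underline{\bullet}\,((x\underline{\triangleright}y)\overline{\bullet}^{-1}y)=[(y\overline{\triangleright}x)\overline{\bullet}^{-1}x]\,\underline{\triangleright}\,[(x\underline{\triangleright}y)\overline{\bullet}^{-1}y]$. (v) For all $x,y,z\in X$: $(x\overline{\triangleright}y)\overline{\triangleright}(z\overline{\bullet}y)=(x\overline{\triangleright}z)\overline{\triangleright}(y\underline{\bullet}z)$, $(x\underline{\triangleright}y)\underline{\triangleright}(z\overline{\bullet}y)=(x\underline{\triangleright}z)\underline{\triangleright}(y\underline{\bullet}z)$, $(x\overline{\triangleright}y)\overline{\bullet}(z\overline{\triangleright}y)=(x\overline{\bullet}z)\overline{\triangleright}(y\underline{\triangleright}z)$, $(x\underline{\triangleright}y)\underline{\bullet}(z\underline{\triangleright}y)=(x\underline{\bullet}z)\underline{\triangleright}(y\overline{\triangleright}z)$, $(x\overline{\triangleright}y)\underline{\bullet}(z\overline{\triangleright}y)=(x\underline{\bullet}z)\overline{\triangleright}(y\underline{\triangleright}z)$, $(x\underline{\triangleright}y)\overline{\bullet}(z\underline{\triangleright}y)=(x\overline{\bullet}z)\underline{\triangleright}(y\overline{\triangleright}z)$. A psyquandle homomorphism is a map preserving all four operations; an endomorphism of $X$ is a homomorphism $X\to X$, and $\mathrm{Hom}(X,X)$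 is the set of these. **Singular knots.** An oriented singular knot (or link) diagram is an oriented knot (link) diagram in the plane with classical crossings and singular crossings (transverse double points of oriented strands, regarded as rigid 4-valent vertices). Oriented singular knots/links are equivalence classes of such diagrams under planar isotopy and the oriented singular Reidemeister moves: the classical moves I, II, III; the move sliding a strand entirely over, or entirely under, a singular crossing; and the move exchanging a singular crossing and an adjacent classical crossing of the same two strands ("singular crossing followed by classical crossing" $\leftrightarrow$ "classical crossing of the same sign followed by singular crossing"); all with all orientations. **Colorings.** A semiarc is a portion of the diagram between two consecutive crossing points (classical over, classical under, or singular); a component without crossings is one semiarc. Draw each crossing with both strands oriented upward; each strand meets one semiarc on the left (bottom-left or top-left) and one on the right. An $X$-coloring assigns an element of $X$ to each semiarc such that: * at each classical crossing (of either sign), if $x$ is the left label of the under-strand and $y$ the left label of the over-strand, then the right label of the under-strand is $x\,\underline{\triangleright}\,y$ and the right label of the over-strand is $y\,\overline{\triangleright}\,x$; * at each singular crossing, if $x$ is the left label of the strand running from bottom-left to top-right and $y$ is the left label of the strand running from bottom-right to top-left, then their right labels are $x\,\underline{\bullet}\,y$ and $y\,\overline{\bullet}\,x$ respectively. The fundamental psyquandle $\mathcal{P}(L)$ is the quotient of the free psyquandle on the semiarcs of the diagram by the relations these rules impose at the crossings; $\mathrm{Hom}(\mathcal{P}(L),X)$ is identified with the set of $X$-colorings of the diagram. **Quiver.** $\mathcal{PQ}_X^S(L)$ is the directed multigraph (loops and multiple edges allowed) with one vertex for each $f\in\mathrm{Hom}(\mathcal{P}(L),X)$ and, for each vertex $f$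 and each $\phi\in S$, one edge directed from $f$ to $\phi f=\phi\circ f$ (apply $\phi$ to every label). *)

theory Defs
  imports "HOL-Analysis.Analysis" "Graph_Theory.Digraph_Isomorphism"
begin

section \<open>Psyquandles\<close>

text \<open>
  The suffixes \<open>u\<close> and \<open>o\<close> stand for the underlined and the overlined
  operations.
\<close>

record 'a psyquandle =
  carrier :: "'a set"
  tri_u :: "'a \<Rightarrow> 'a \<Rightarrow> 'a" (infixl \<open>\<triangleright>\<^sub>u\<index>\<close> 70)
  tri_o :: "'a \<Rightarrow> 'a \<Rightarrow> 'a" (infixl \<open>\<triangleright>\<^sub>o\<index>\<close> 70)
  dot_u :: "'a \<Rightarrow> 'a \<Rightarrow> 'a" (infixl \<open>\<bullet>\<^sub>u\<index>\<close> 70)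
  dot_o :: "'a \<Rightarrow> 'a \<Rightarrow> 'a" (infixl \<open>\<bullet>\<^sub>o\<index>\<close> 70)

definition right_invertible :: "'a set \<Rightarrow> ('a \<Rightarrow> 'a \<Rightarrow> 'a) \<Rightarrow> bool" where
  "right_invertible A f \<longleftrightarrow>
     (\<exists>g. \<forall>x\<in>A. \<forall>y\<in>A. g x y \<in> A \<and> g (f x y) y = x \<and> f (g x y) y = x)"

definition right_inverse :: "'a set \<Rightarrow> ('a \<Rightarrow> 'a \<Rightarrow> 'a) \<Rightarrow> 'a \<Rightarrow> 'a \<Rightarrow> 'a" where
  "right_inverse A f x y = (THE w. w \<in> A \<and> f w y = x)"

abbreviation dot_o_inv :: "('a, 'b) psyquandle_scheme \<Rightarrow> 'a \<Rightarrow> 'a \<Rightarrow> 'a"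
    (infixl \<open>\<bullet>\<^sub>o\<inverse>\<index>\<close> 70) where
  "dot_o_inv X \<equiv> right_inverse (carrier X) (dot_o X)"

locale psyquandle =
  fixes X :: "('a, 'b) psyquandle_scheme" (structure)
  assumes closed:
      "\<lbrakk>x \<in> carrier X; y \<in> carrier X\<rbrakk> \<Longrightarrow> x \<triangleright>\<^sub>u y \<in> carrier X"
      "\<lbrakk>x \<in> carrier X; y \<in> carrier X\<rbrakk> \<Longrightarrow> x \<triangleright>\<^sub>o y \<in> carrier X"
      "\<lbrakk>x \<in> carrier X; y \<in> carrier X\<rbrakk> \<Longrightarrow> x \<bullet>\<^sub>u y \<in> carrier X"
      "\<lbrakk>x \<in> carrier X; y \<in> carrier X\<rbrakk> \<Longrightarrow> x \<bullet>\<^sub>o y \<in> carrier X"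
    and right_inv:
      "right_invertible (carrier X) (tri_u X)"
      "right_invertible (carrier X) (tri_o X)"
      "right_invertible (carrier X) (dot_u X)"
      "right_invertible (carrier X) (dot_o X)"
    and diagonal: "x \<in> carrier X \<Longrightarrow> x \<triangleright>\<^sub>u x = x \<triangleright>\<^sub>o x"
    and switch:
      "bij_betw (\<lambda>(x, y). (y \<triangleright>\<^sub>o x, x \<triangleright>\<^sub>u y))
         (carrier X \<times> carrier X) (carrier X \<times> carrier X)"
      "bij_betw (\<lambda>(x, y). (y \<bullet>\<^sub>o x, x \<bullet>\<^sub>u y))
         (carrier X \<times> carrier X) (carrier X \<times> carrier X)"
    and exchange_classical:
      "\<lbrakk>x \<in> carrier X; y \<in> carrier X; z \<in> carrier X\<rbrakk> \<Longrightarrow>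
         (x \<triangleright>\<^sub>u y) \<triangleright>\<^sub>u (z \<triangleright>\<^sub>u y) = (x \<triangleright>\<^sub>u z) \<triangleright>\<^sub>u (y \<triangleright>\<^sub>o z)"
      "\<lbrakk>x \<in> carrier X; y \<in> carrier X; z \<in> carrier X\<rbrakk> \<Longrightarrow>
         (x \<triangleright>\<^sub>u y) \<triangleright>\<^sub>o (z \<triangleright>\<^sub>u y) = (x \<triangleright>\<^sub>o z) \<triangleright>\<^sub>u (y \<triangleright>\<^sub>o z)"
      "\<lbrakk>x \<in> carrier X; y \<in> carrier X; z \<in> carrier X\<rbrakk> \<Longrightarrow>
         (x \<triangleright>\<^sub>o y) \<triangleright>\<^sub>o (z \<triangleright>\<^sub>o y) = (x \<triangleright>\<^sub>o z) \<triangleright>\<^sub>o (y \<triangleright>\<^sub>u z)"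
    and commute:
      "\<lbrakk>x \<in> carrier X; y \<in> carrier X\<rbrakk> \<Longrightarrow>
         x \<bullet>\<^sub>u ((y \<triangleright>\<^sub>o x) \<bullet>\<^sub>o\<inverse> x)
           = ((x \<triangleright>\<^sub>u y) \<bullet>\<^sub>o\<inverse> y) \<triangleright>\<^sub>o ((y \<triangleright>\<^sub>o x) \<bullet>\<^sub>o\<inverse> x)"
      "\<lbrakk>x \<in> carrier X; y \<in> carrier X\<rbrakk> \<Longrightarrow>
         y \<bullet>\<^sub>u ((x \<triangleright>\<^sub>u y) \<bullet>\<^sub>o\<inverse> y)
           = ((y \<triangleright>\<^sub>o x) \<bullet>\<^sub>o\<inverse> x) \<triangleright>\<^sub>u ((x \<triangleright>\<^sub>u y) \<bullet>\<^sub>o\<inverse> y)"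
    and exchange_mixed:
      "\<lbrakk>x \<in> carrier X; y \<in> carrier X; z \<in> carrier X\<rbrakk> \<Longrightarrow>
         (x \<triangleright>\<^sub>o y) \<triangleright>\<^sub>o (z \<bullet>\<^sub>o y) = (x \<triangleright>\<^sub>o z) \<triangleright>\<^sub>o (y \<bullet>\<^sub>u z)"
      "\<lbrakk>x \<in> carrier X; y \<in> carrier X; z \<in> carrier X\<rbrakk> \<Longrightarrow>
         (x \<triangleright>\<^sub>u y) \<triangleright>\<^sub>u (z \<bullet>\<^sub>o y) = (x \<triangleright>\<^sub>u z) \<triangleright>\<^sub>u (y \<bullet>\<^sub>u z)"
      "\<lbrakk>x \<in> carrier X; y \<in> carrier X; z \<in> carrier X\<rbrakk> \<Longrightarrow>
         (x \<triangleright>\<^sub>o y) \<bullet>\<^sub>o (z \<triangleright>\<^sub>o y) = (x \<bullet>\<^sub>o z) \<triangleright>\<^sub>o (y \<triangleright>\<^sub>u z)"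
      "\<lbrakk>x \<in> carrier X; y \<in> carrier X; z \<in> carrier X\<rbrakk> \<Longrightarrow>
         (x \<triangleright>\<^sub>u y) \<bullet>\<^sub>u (z \<triangleright>\<^sub>u y) = (x \<bullet>\<^sub>u z) \<triangleright>\<^sub>u (y \<triangleright>\<^sub>o z)"
      "\<lbrakk>x \<in> carrier X; y \<in> carrier X; z \<in> carrier X\<rbrakk> \<Longrightarrow>
         (x \<triangleright>\<^sub>o y) \<bullet>\<^sub>u (z \<triangleright>\<^sub>o y) = (x \<bullet>\<^sub>u z) \<triangleright>\<^sub>o (y \<triangleright>\<^sub>u z)"
      "\<lbrakk>x \<in> carrier X; y \<in> carrier X; z \<in> carrier X\<rbrakk> \<Longrightarrow>
         (x \<triangleright>\<^sub>u y) \<bullet>\<^sub>o (z \<triangleright>\<^sub>u y) = (x \<bullet>\<^sub>o z) \<triangleright>\<^sub>u (y \<triangleright>\<^sub>o z)"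

text \<open>
  Homomorphisms are taken extensional, so that distinct members of \<open>psyquandle_hom\<close>
  are distinct as maps between the carriers and each contributes its own edges to the quiver.
\<close>

definition psyquandle_hom ::
    "('a, 'm) psyquandle_scheme \<Rightarrow> ('b, 'n) psyquandle_scheme \<Rightarrow> ('a \<Rightarrow> 'b) set" where
  "psyquandle_hom X Y = {h \<in> carrier X \<rightarrow>\<^sub>E carrier Y. \<forall>x\<in>carrier X. \<forall>y\<in>carrier X.
      h (x \<triangleright>\<^sub>u\<^bsub>X\<^esub> y) = h x \<triangleright>\<^sub>u\<^bsub>Y\<^esub> h y \<and> h (x \<triangleright>\<^sub>o\<^bsub>X\<^esub> y) = h x \<triangleright>\<^sub>o\<^bsub>Y\<^esub> h y \<and>
      h (x \<bullet>\<^sub>u\<^bsub>X\<^esub> y) = h x \<bullet>\<^sub>u\<^bsub>Y\<^esub> h y \<and> h (x \<bullet>\<^sub>o\<^bsub>X\<^esub> y) = h x \<bullet>\<^sub>o\<^bsub>Y\<^esub> h y}"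


section \<open>Oriented singular link diagrams in the plane\<close>

text \<open>
  The plane is \<^typ>\<open>complex\<close>. Component \<open>i < ncomp D\<close> is a closed immersed curve of
  class C1, given as a 1-periodic function on the reals and oriented by increasing parameter; a knot
  diagram is one with \<open>ncomp D = 1\<close>. A \<^emph>\<open>parameter\<close> is a pair \<open>(i, t)\<close> of
  a component and a real number; two parameters on the same component that differ by an integer
  describe the same passage of the strand. The set \<open>over D\<close> collects the parameters
  of the over-passages at the classical crossings, \<open>sing D\<close> is the set of singular crossing
  points.
\<close>

record singular_diagram =
  ncomp :: nat
  curve :: "nat \<Rightarrow> real \<Rightarrow> complex"
  over :: "(nat \<times> real) set"
  sing :: "complex set"

definition params :: "singular_diagram \<Rightarrow> (nat \<times> real) set" where
  "params D = {..<ncomp D} \<times> UNIV"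

definition pt :: "singular_diagram \<Rightarrow> nat \<times> real \<Rightarrow> complex" where
  "pt D p = curve D (fst p) (snd p)"

definition tangent :: "singular_diagram \<Rightarrow> nat \<times> real \<Rightarrow> complex" where
  "tangent D p = vector_derivative (curve D (fst p)) (at (snd p))"

definition same_param :: "nat \<times> real \<Rightarrow> nat \<times> real \<Rightarrow> bool" where
  "same_param p q \<longleftrightarrow> fst p = fst q \<and> snd p - snd q \<in> \<int>"

definition crosses :: "singular_diagram \<Rightarrow> nat \<times> real \<Rightarrow> nat \<times> real \<Rightarrow> bool" where
  "crosses D p q \<longleftrightarrow>
     p \<in> params D \<and> q \<in> params D \<and> \<not> same_param p q \<and> pt D p = pt D q"

definition crossings :: "singular_diagram \<Rightarrow> complex set" where
  "crossings D = {pt D p | p. \<exists>q. crosses D p q}"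

text \<open>
  The sign of the determinant of the two tangent vectors. It is positive iff, when both strands are
  drawn upward, the strand of \<open>p\<close> runs from bottom-left to top-right and the strand of
  \<open>q\<close> from bottom-right to top-left.
\<close>

definition turn :: "singular_diagram \<Rightarrow> nat \<times> real \<Rightarrow> nat \<times> real \<Rightarrow> real" where
  "turn D p q = sgn (Im (cnj (tangent D p) * tangent D q))"

definition crosses_over :: "singular_diagram \<Rightarrow> nat \<times> real \<Rightarrow> nat \<times> real \<Rightarrow> bool" where
  "crosses_over D p q \<longleftrightarrow> crosses D p q \<and> pt D p \<notin> sing D \<and> p \<in> over D"

definition crosses_singularly :: "singular_diagram \<Rightarrow> nat \<times> real \<Rightarrow> nat \<times> real \<Rightarrow> bool" where
  "crosses_singularly D p q \<longleftrightarrow> crosses D p q \<and> pt D p \<in> sing D"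

definition is_singular_diagram :: "singular_diagram \<Rightarrow> bool" where
  "is_singular_diagram D \<longleftrightarrow>
     0 < ncomp D \<and>
     (\<forall>i<ncomp D. curve D i C1_differentiable_on UNIV \<and>
        (\<forall>t. curve D i (t + 1) = curve D i t \<and> tangent D (i, t) \<noteq> 0)) \<and>
     finite (crossings D) \<and>
     (\<forall>p q r. crosses D p q \<and> crosses D p r \<longrightarrow> same_param q r) \<and>
     (\<forall>p q. crosses D p q \<longrightarrow> turn D p q \<noteq> 0) \<and>
     sing D \<subseteq> crossings D \<and>
     (\<forall>p\<in>over D. \<exists>q. crosses D p q \<and> pt D p \<notin> sing D) \<and>
     (\<forall>p q. crosses D p q \<and> pt D p \<notin> sing D \<longrightarrow> (p \<in> over D \<longleftrightarrow> q \<notin> over D))"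


section \<open>Planar isotopy and the oriented singular Reidemeister moves\<close>

definition diffeotopy :: "(real \<Rightarrow> complex \<Rightarrow> complex) \<Rightarrow> bool" where
  "diffeotopy H \<longleftrightarrow>
     (\<forall>z. H 0 z = z) \<and>
     (\<forall>s\<in>{0..1}. bij (H s)) \<and>
     continuous_on ({0..1} \<times> UNIV) (\<lambda>(s, z). H s z) \<and>
     (\<exists>H' :: real \<Rightarrow> complex \<Rightarrow> complex \<Rightarrow>\<^sub>L complex.
        (\<forall>s\<in>{0..1}. \<forall>z. (H s has_derivative blinfun_apply (H' s z)) (at z) \<and>
           bij (blinfun_apply (H' s z))) \<and>
        continuous_on ({0..1} \<times> UNIV) (\<lambda>(s, z). H' s z))"

definition planar_isotopic :: "singular_diagram \<Rightarrow> singular_diagram \<Rightarrow> bool" where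
  "planar_isotopic D D' \<longleftrightarrow>
     (\<exists>H. diffeotopy H \<and> ncomp D' = ncomp D \<and>
        (\<forall>p\<in>params D. pt D' p = H 1 (pt D p) \<and> (p \<in> over D' \<longleftrightarrow> p \<in> over D)) \<and>
        sing D' = H 1 ` sing D)"

text \<open>
  Diagrams related by \<open>reparametrized\<close> are the same oriented diagram: only the numbering of
  the components and the (orientation-preserving) parametrizations differ.
\<close>

definition reparametrized :: "singular_diagram \<Rightarrow> singular_diagram \<Rightarrow> bool" where
  "reparametrized D D' \<longleftrightarrow>
     ncomp D' = ncomp D \<and> sing D' = sing D \<and>
     (\<exists>\<pi> \<theta>. bij_betw \<pi> {..<ncomp D} {..<ncomp D} \<and>
        (\<forall>i<ncomp D. \<forall>t.
           (\<exists>d>0. (\<theta> i has_real_derivative d) (at t)) \<and> \<theta> i (t + 1) = \<theta> i t + 1 \<and>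
           curve D' i t = curve D (\<pi> i) (\<theta> i t) \<and>
           ((i, t) \<in> over D' \<longleftrightarrow> (\<pi> i, \<theta> i t) \<in> over D)))"

text \<open>
  A move takes place inside a closed round disc (up to planar isotopy this is no restriction), which
  the diagram meets in \<open>k\<close> arcs. The \<open>j\<close>-th arc lies on the component
  \<open>c j\<close> and is traversed during the parameter interval from \<open>a j\<close> to \<open>b j\<close>.
\<close>

definition meets_disc_in_arcs :: "singular_diagram \<Rightarrow> complex \<Rightarrow> real \<Rightarrow>
    nat \<Rightarrow> (nat \<Rightarrow> nat) \<Rightarrow> (nat \<Rightarrow> real) \<Rightarrow> (nat \<Rightarrow> real) \<Rightarrow> bool" where
  "meets_disc_in_arcs D z r k c a b \<longleftrightarrow>
     0 < r \<and> (\<forall>j<k. c j < ncomp D \<and> a j < b j) \<and>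
     (\<forall>j<k. \<forall>j'<k. \<forall>m::int. c j = c j' \<and> {a j..b j} \<inter> {a j' + of_int m..b j' + of_int m} \<noteq> {}
        \<longrightarrow> j = j' \<and> m = 0) \<and>
     (\<forall>p\<in>params D. pt D p \<in> ball z r \<longleftrightarrow>
        (\<exists>j<k. \<exists>m::int. fst p = c j \<and> snd p + of_int m \<in> {a j<..<b j})) \<and>
     (\<forall>p\<in>params D. pt D p \<in> cball z r \<longleftrightarrow>
        (\<exists>j<k. \<exists>m::int. fst p = c j \<and> snd p + of_int m \<in> {a j..b j})) \<and>
     crossings D \<inter> sphere z r = {}"

definition differ_in_disc :: "singular_diagram \<Rightarrow> singular_diagram \<Rightarrow> complex \<Rightarrow> real \<Rightarrow>
    nat \<Rightarrow> (nat \<Rightarrow> nat) \<Rightarrow> (nat \<Rightarrow> real) \<Rightarrow> (nat \<Rightarrow> real) \<Rightarrow> bool" where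
  "differ_in_disc D D' z r k c a b \<longleftrightarrow>
     meets_disc_in_arcs D z r k c a b \<and> meets_disc_in_arcs D' z r k c a b \<and>
     ncomp D' = ncomp D \<and> sing D' - ball z r = sing D - ball z r \<and>
     (\<forall>p\<in>params D. pt D p \<notin> ball z r \<longrightarrow>
        pt D' p = pt D p \<and> (p \<in> over D' \<longleftrightarrow> p \<in> over D))"

text \<open>
  The contents of the disc are described by the crossings that lie in it, with their types, their
  directions (\<open>turn\<close>) and their order along the arcs. In a disc this determines the picture
  up to isotopy relative to the boundary, and no choice of sign or direction is fixed, so that every
  oriented version of each move is included.
\<close>

definition move_I :: "singular_diagram \<Rightarrow> singular_diagram \<Rightarrow> bool" where
  "move_I D D' \<longleftrightarrow>
     (\<exists>z r c a b w. differ_in_disc D D' z r 1 c a b \<and>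
        crossings D \<inter> ball z r = {} \<and>
        crossings D' \<inter> ball z r = {w} \<and> w \<notin> sing D')"

definition move_II :: "singular_diagram \<Rightarrow> singular_diagram \<Rightarrow> bool" where
  "move_II D D' \<longleftrightarrow>
     (\<exists>z r c a b s\<^sub>1 s\<^sub>2 t\<^sub>1 t\<^sub>2. differ_in_disc D D' z r 2 c a b \<and>
        crossings D \<inter> ball z r = {} \<and>
        {s\<^sub>1, s\<^sub>2} \<subseteq> {a 0<..<b 0} \<and> {t\<^sub>1, t\<^sub>2} \<subseteq> {a 1<..<b 1} \<and> s\<^sub>1 < s\<^sub>2 \<and> t\<^sub>1 \<noteq> t\<^sub>2 \<and>
        crossings D' \<inter> ball z r = {pt D' (c 0, s\<^sub>1), pt D' (c 0, s\<^sub>2)} \<and>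
        crosses_over D' (c 0, s\<^sub>1) (c 1, t\<^sub>1) \<and> crosses_over D' (c 0, s\<^sub>2) (c 1, t\<^sub>2) \<and>
        turn D' (c 0, s\<^sub>1) (c 1, t\<^sub>1) = - turn D' (c 0, s\<^sub>2) (c 1, t\<^sub>2))"

text \<open>
  Three arcs forming a triangle: arcs \<open>i\<close> and \<open>j\<close> cross exactly once, and
  \<open>S i j\<close> is the parameter of that crossing on arc \<open>i\<close>. The last condition says that
  the orders in which the arcs meet each other are those of three straight lines with directions
  \<open>u\<^sub>0\<close>, \<open>u\<^sub>1\<close>, \<open>u\<^sub>2\<close>: the side vectors of the triangle are multiples
  \<open>\<lambda>\<^sub>i u\<^sub>i\<close> with \<open>\<lambda>\<^sub>0 u\<^sub>0 + \<lambda>\<^sub>1 u\<^sub>1 + \<lambda>\<^sub>2 u\<^sub>2 = 0\<close>, whence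
  \<open>(\<lambda>\<^sub>0, \<lambda>\<^sub>1, \<lambda>\<^sub>2)\<close> is proportional to
  \<open>(det u\<^sub>1 u\<^sub>2, det u\<^sub>2 u\<^sub>0, det u\<^sub>0 u\<^sub>1)\<close>, where \<open>\<lambda>\<^sub>i > 0\<close> iff arc \<open>i\<close>
  meets arc \<open>i + 1\<close> (mod 3) before arc \<open>i + 2\<close>. The sign of the
  proportionality factor is \<open>\<tau>\<close>; pushing one line across the crossing of the other two
  reverses it.
\<close>

definition triangle :: "singular_diagram \<Rightarrow> complex \<Rightarrow> real \<Rightarrow> (nat \<Rightarrow> nat) \<Rightarrow>
    (nat \<Rightarrow> real) \<Rightarrow> (nat \<Rightarrow> real) \<Rightarrow> (nat \<Rightarrow> nat \<Rightarrow> real) \<Rightarrow> bool \<Rightarrow> bool" where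
  "triangle D z r c a b S \<tau> \<longleftrightarrow>
     (\<forall>i<3. \<forall>j<3. i \<noteq> j \<longrightarrow>
        S i j \<in> {a i<..<b i} \<and> crosses D (c i, S i j) (c j, S j i)) \<and>
     crossings D \<inter> ball z r = {pt D (c i, S i j) | i j. i < 3 \<and> j < 3 \<and> i \<noteq> j} \<and>
     (\<forall>(i, j, k) \<in> {(0, 1, 2), (1, 2, 0), (2, 0, 1)}.
        ((S i j < S i k) = (0 < turn D (c j, S j k) (c k, S k j))) = \<tau>)"

definition triangle_move :: "singular_diagram \<Rightarrow> singular_diagram \<Rightarrow> (nat \<Rightarrow> nat) \<Rightarrow>
    (nat \<Rightarrow> nat \<Rightarrow> real) \<Rightarrow> (nat \<Rightarrow> nat \<Rightarrow> real) \<Rightarrow> bool" where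
  "triangle_move D D' c S S' \<longleftrightarrow>
     (\<exists>z r a b \<tau>. differ_in_disc D D' z r 3 c a b \<and>
        triangle D z r c a b S \<tau> \<and> triangle D' z r c a b S' (\<not> \<tau>) \<and>
        (\<forall>i<3. \<forall>j<3. i \<noteq> j \<longrightarrow>
           turn D' (c i, S' i j) (c j, S' j i) = turn D (c i, S i j) (c j, S j i)))"

definition arc_over :: "singular_diagram \<Rightarrow> (nat \<Rightarrow> nat) \<Rightarrow> (nat \<Rightarrow> nat \<Rightarrow> real) \<Rightarrow>
    nat \<Rightarrow> nat \<Rightarrow> bool" where
  "arc_over D c S i j \<longleftrightarrow> crosses_over D (c i, S i j) (c j, S j i)"

definition move_III :: "singular_diagram \<Rightarrow> singular_diagram \<Rightarrow> bool" where
  "move_III D D' \<longleftrightarrow>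
     (\<exists>c S S'. triangle_move D D' c S S' \<and>
        arc_over D c S 0 1 \<and> arc_over D c S 0 2 \<and> arc_over D c S 1 2 \<and>
        arc_over D' c S' 0 1 \<and> arc_over D' c S' 0 2 \<and> arc_over D' c S' 1 2)"

definition move_slide :: "singular_diagram \<Rightarrow> singular_diagram \<Rightarrow> bool" where
  "move_slide D D' \<longleftrightarrow>
     (\<exists>c S S'. triangle_move D D' c S S' \<and>
        crosses_singularly D (c 0, S 0 1) (c 1, S 1 0) \<and>
        crosses_singularly D' (c 0, S' 0 1) (c 1, S' 1 0) \<and>
        (arc_over D c S 2 0 \<and> arc_over D c S 2 1 \<and> arc_over D' c S' 2 0 \<and> arc_over D' c S' 2 1 \<or>
         arc_over D c S 0 2 \<and> arc_over D c S 1 2 \<and> arc_over D' c S' 0 2 \<and> arc_over D' c S' 1 2))"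

definition crossing_sign ::
    "singular_diagram \<Rightarrow> nat \<times> real \<Rightarrow> nat \<times> real \<Rightarrow> real \<Rightarrow> bool" where
  "crossing_sign D p q e \<longleftrightarrow>
     crosses_over D p q \<and> e = turn D p q \<or> crosses_over D q p \<and> e = turn D q p"

text \<open>
  In \<open>D\<close> arc 0 first meets arc 1 in a singular crossing, then in a classical one; in
  \<open>D'\<close> it is the other way round. The two arcs may run parallel or antiparallel; the condition
  on \<open>t\<close> says that this is the same in both diagrams. The arcs cross in
  opposite directions at the two crossings, so that keeping the sign \<open>e\<close> of the classical
  crossing interchanges the over- and the under-arc.
\<close>

definition move_exchange :: "singular_diagram \<Rightarrow> singular_diagram \<Rightarrow> bool" where
  "move_exchange D D' \<longleftrightarrow>
     (\<exists>z r c a b s\<^sub>1 s\<^sub>2 t\<^sub>1 t\<^sub>2 s\<^sub>1' s\<^sub>2' t\<^sub>1' t\<^sub>2' d e. differ_in_disc D D' z r 2 c a b \<and>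
        {s\<^sub>1, s\<^sub>2, s\<^sub>1', s\<^sub>2'} \<subseteq> {a 0<..<b 0} \<and> {t\<^sub>1, t\<^sub>2, t\<^sub>1', t\<^sub>2'} \<subseteq> {a 1<..<b 1} \<and>
        s\<^sub>1 < s\<^sub>2 \<and> s\<^sub>1' < s\<^sub>2' \<and> t\<^sub>1 \<noteq> t\<^sub>2 \<and> t\<^sub>1' \<noteq> t\<^sub>2' \<and> (t\<^sub>1 < t\<^sub>2 \<longleftrightarrow> t\<^sub>1' < t\<^sub>2') \<and>
        crossings D \<inter> ball z r = {pt D (c 0, s\<^sub>1), pt D (c 0, s\<^sub>2)} \<and>
        crossings D' \<inter> ball z r = {pt D' (c 0, s\<^sub>1'), pt D' (c 0, s\<^sub>2')} \<and>
        crosses_singularly D (c 0, s\<^sub>1) (c 1, t\<^sub>1) \<and> crossing_sign D (c 0, s\<^sub>2) (c 1, t\<^sub>2) e \<and>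
        crossing_sign D' (c 0, s\<^sub>1') (c 1, t\<^sub>1') e \<and> crosses_singularly D' (c 0, s\<^sub>2') (c 1, t\<^sub>2') \<and>
        turn D (c 0, s\<^sub>1) (c 1, t\<^sub>1) = d \<and> turn D (c 0, s\<^sub>2) (c 1, t\<^sub>2) = - d \<and>
        turn D' (c 0, s\<^sub>1') (c 1, t\<^sub>1') = d \<and> turn D' (c 0, s\<^sub>2') (c 1, t\<^sub>2') = - d)"

definition diagram_step :: "singular_diagram \<Rightarrow> singular_diagram \<Rightarrow> bool" where
  "diagram_step D D' \<longleftrightarrow>
     is_singular_diagram D \<and> is_singular_diagram D' \<and>
     (reparametrized D D' \<or> planar_isotopic D D' \<or>
      move_I D D' \<or> move_II D D' \<or> move_III D D' \<or> move_slide D D' \<or> move_exchange D D')"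

definition represent_same_link :: "singular_diagram \<Rightarrow> singular_diagram \<Rightarrow> bool" where
  "represent_same_link = equivclp diagram_step"


section \<open>Colorings and the psyquandle coloring quiver\<close>

definition semiarcs :: "singular_diagram \<Rightarrow> complex set set" where
  "semiarcs D = components (pt D ` params D - crossings D)"

definition semiarc_before :: "singular_diagram \<Rightarrow> nat \<times> real \<Rightarrow> complex set" where
  "semiarc_before D p =
     (THE A. A \<in> semiarcs D \<and> (\<forall>\<^sub>F t in at_left (snd p). pt D (fst p, t) \<in> A))"

definition semiarc_after :: "singular_diagram \<Rightarrow> nat \<times> real \<Rightarrow> complex set" where
  "semiarc_after D p =
     (THE A. A \<in> semiarcs D \<and> (\<forall>\<^sub>F t in at_right (snd p). pt D (fst p, t) \<in> A))"

text \<open>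
  The semiarcs of the strand of \<open>p\<close> to the left and to the right of its crossing with the
  strand of \<open>q\<close>, both strands being drawn upward.
\<close>

definition left_semiarc :: "singular_diagram \<Rightarrow> nat \<times> real \<Rightarrow> nat \<times> real \<Rightarrow> complex set" where
  "left_semiarc D p q = (if 0 < turn D p q then semiarc_before D p else semiarc_after D p)"

definition right_semiarc :: "singular_diagram \<Rightarrow> nat \<times> real \<Rightarrow> nat \<times> real \<Rightarrow> complex set" where
  "right_semiarc D p q = (if 0 < turn D p q then semiarc_after D p else semiarc_before D p)"

text \<open>
  The set of colorings, identified with the set of homomorphisms from the fundamental psyquandle
  of the diagram to \<open>X\<close>.
\<close>

definition colorings ::
    "('a, 'm) psyquandle_scheme \<Rightarrow> singular_diagram \<Rightarrow> (complex set \<Rightarrow> 'a) set" where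
  "colorings X D = {f \<in> semiarcs D \<rightarrow>\<^sub>E carrier X.
     (\<forall>p q. crosses_over D q p \<longrightarrow>
        f (right_semiarc D p q) = f (left_semiarc D p q) \<triangleright>\<^sub>u\<^bsub>X\<^esub> f (left_semiarc D q p) \<and>
        f (right_semiarc D q p) = f (left_semiarc D q p) \<triangleright>\<^sub>o\<^bsub>X\<^esub> f (left_semiarc D p q)) \<and>
     (\<forall>p q. crosses_singularly D p q \<and> 0 < turn D p q \<longrightarrow>
        f (right_semiarc D p q) = f (left_semiarc D p q) \<bullet>\<^sub>u\<^bsub>X\<^esub> f (left_semiarc D q p) \<and>
        f (right_semiarc D q p) = f (left_semiarc D q p) \<bullet>\<^sub>o\<^bsub>X\<^esub> f (left_semiarc D p q))}"

definition coloring_quiver ::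
    "('a, 'm) psyquandle_scheme \<Rightarrow> ('a \<Rightarrow> 'a) set \<Rightarrow> singular_diagram \<Rightarrow>
     (complex set \<Rightarrow> 'a, (complex set \<Rightarrow> 'a) \<times> ('a \<Rightarrow> 'a)) pre_digraph" where
  "coloring_quiver X S D =
     \<lparr>verts = colorings X D,
      arcs = colorings X D \<times> S,
      tail = fst,
      head = (\<lambda>(f, \<phi>). compose (semiarcs D) \<phi> f)\<rparr>"

end

theory Submission
  imports Defs
begin

text \<open>
  A coloring of the semiarcs is pulled back along the parametrization of the diagram: it becomes a
  periodic, locally constant function on the parameters that are not crossing parameters, subject
  to one rule per crossing. This description does not mention the plane any more. Isotopies and
  reparametrizations then act by substitution. A Reidemeister move changes the function only on
  the finitely many arcs inside a disc, so it suffices to see that the colorings of the two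
  contents of the disc are determined by the labels at the ends of the arcs and realize the same
  labels there; this is algebra in the psyquandle. The resulting bijection is characterized by
  agreement outside the disc and therefore commutes with endomorphisms.
\<close>

section \<open>Crossing rules in a psyquandle\<close>

text \<open>Two difficulties shape the proof. Algebraically, axiom (iv) speaks of parallel strands
  and of one choice of the over-strand, while the exchange move comes with all orientations; the
  antiparallel laws are derived from (iv) with the help of (i) and (v). The derivation uses that an
  element can be written as \<open>x \<triangleright>\<^sub>u x\<close>, which finiteness of the
  carrier supplies, and kinks use the same. Geometrically, a semiarc is a connected component in the
  plane and not an interval of parameters, so a locally constant function has to be shown to descend
  to it; finiteness enters here again.

  What keeps the number of cases small is a determinacy principle, a consequence of axioms (0) and
  (ii): at a crossing, one known label on each strand determines the two others. Hence a labelled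
  disc is fixed by suitable end labels, the labels inside are unique, and a passage of labels in one
  direction of a move can be reversed. For triangles, sides of strands replace orientations, and all
  orientations and crossing types become one statement about a cube.\<close>

text \<open>
  \<open>l\<close>, \<open>r\<close> are the left and right labels of one strand, \<open>l'\<close>, \<open>r'\<close> those of the
  other. In \<open>oriented_rule\<close> they are replaced by the labels before and after the crossing,
  where \<open>e\<close> says that the first strand runs from bottom-left to top-right.
\<close>

definition crossing_rule :: "('a \<Rightarrow> 'a \<Rightarrow> 'a) \<Rightarrow> ('a \<Rightarrow> 'a \<Rightarrow> 'a) \<Rightarrow> 'a \<Rightarrow> 'a \<Rightarrow> 'a \<Rightarrow> 'a \<Rightarrow> bool" where
  "crossing_rule f h l r l' r' \<longleftrightarrow> r = f l l' \<and> r' = h l' l"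

definition oriented_rule ::
    "bool \<Rightarrow> ('a \<Rightarrow> 'a \<Rightarrow> 'a) \<Rightarrow> ('a \<Rightarrow> 'a \<Rightarrow> 'a) \<Rightarrow> 'a \<Rightarrow> 'a \<Rightarrow> 'a \<Rightarrow> 'a \<Rightarrow> bool" where
  "oriented_rule e f h b a b' a' \<longleftrightarrow>
     (if e then crossing_rule f h b a a' b' else crossing_rule f h a b b' a')"

lemma crossing_rule_commute: "crossing_rule f h l r l' r' \<longleftrightarrow> crossing_rule h f l' r' l r"
  by (auto simp: crossing_rule_def)

lemma oriented_rule_commute:
  "oriented_rule e f h b a b' a' \<longleftrightarrow> oriented_rule (\<not> e) h f b' a' b a"
  by (auto simp: oriented_rule_def crossing_rule_def)

text \<open>Exchanging before and after on both strands exchanges left and right on both, which is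
  the effect of negating \<open>e\<close>. Statements about outgoing labels are read off in this way
  from those about incoming ones.\<close>

lemma oriented_rule_reverse:
  "oriented_rule (\<not> e) f h b a b' a' \<longleftrightarrow> oriented_rule e f h a b a' b'"
  by (auto simp: oriented_rule_def)

text \<open>Axioms (0) and (ii) for one pair of operations, the first acting on the first strand.
  The classical and the singular pair and their flips are instances, so determinacy of labels is
  proved once for all kinds of crossings.\<close>

locale crossing_ops =
  fixes A :: "'a set" and f h :: "'a \<Rightarrow> 'a \<Rightarrow> 'a"
  assumes closed: "\<lbrakk>x \<in> A; y \<in> A\<rbrakk> \<Longrightarrow> f x y \<in> A" "\<lbrakk>x \<in> A; y \<in> A\<rbrakk> \<Longrightarrow> h x y \<in> A"
    and right_invertible: "right_invertible A f" "right_invertible A h"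
    and switch: "bij_betw (\<lambda>(x, y). (h y x, f x y)) (A \<times> A) (A \<times> A)"
begin

lemma right_cancel:
  "\<lbrakk>f x y = f x' y; x \<in> A; x' \<in> A; y \<in> A\<rbrakk> \<Longrightarrow> x = x'"
  "\<lbrakk>h x y = h x' y; x \<in> A; x' \<in> A; y \<in> A\<rbrakk> \<Longrightarrow> x = x'"
  using right_invertible unfolding right_invertible_def by metis+

lemma right_solve:
  "\<lbrakk>x \<in> A; y \<in> A\<rbrakk> \<Longrightarrow> \<exists>w\<in>A. f w y = x"
  "\<lbrakk>x \<in> A; y \<in> A\<rbrakk> \<Longrightarrow> \<exists>w\<in>A. h w y = x"
  using right_invertible unfolding right_invertible_def by metis+

lemma switch_cancel:
  assumes "f x y = f x' y'" "h y x = h y' x'" "x \<in> A" "y \<in> A" "x' \<in> A" "y' \<in> A"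
  shows "x = x' \<and> y = y'"
  using inj_onD[OF bij_betw_imp_inj_on[OF switch], of "(x, y)" "(x', y')"] assms by simp

lemma switch_solve:
  assumes "u \<in> A" "v \<in> A"
  obtains x y where "x \<in> A" "y \<in> A" "f x y = u" "h y x = v"
proof -
  have "(v, u) \<in> (\<lambda>(x, y). (h y x, f x y)) ` (A \<times> A)"
    using bij_betw_imp_surj_on[OF switch] assms by auto
  then show thesis using that by auto
qed

text \<open>Renumbering the two strands conjugates the switch map by the swap of
  coordinates.\<close>

lemma flipped: "crossing_ops A h f"
proof unfold_locales
  have "bij_betw (\<lambda>(x, y). (y, x)) (A \<times> A) (A \<times> A)"
    by (rule bij_betwI[where g="\<lambda>(x, y). (y, x)"]) auto
  from bij_betw_trans[OF bij_betw_trans[OF this switch] this]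
  show "bij_betw (\<lambda>(x, y). (f y x, h x y)) (A \<times> A) (A \<times> A)"
    by (simp add: o_def case_prod_unfold)
qed (simp_all add: closed right_invertible)

text \<open>The two incoming labels are a left label of one strand and a right label of the other.
  Right inversion of \<open>h\<close> (if \<open>e\<close>) or of \<open>f\<close> finds one
  outgoing label, and the other is then computed.\<close>

lemma rule_forward:
  assumes "b \<in> A" "b' \<in> A"
  obtains a a' where "a \<in> A" "a' \<in> A" "oriented_rule e f h b a b' a'"
proof (cases e)
  case True
  obtain a' where "a' \<in> A" "h a' b = b'" using right_solve(2) assms by blast
  then show thesis using that[of "f b a'" a'] True assms closed
    by (auto simp: oriented_rule_def crossing_rule_def)
next
  case False
  obtain a where "a \<in> A" "f a b' = b" using right_solve(1) assms by blast
  then show thesis using that[of a "h b' a"] False assms closed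
    by (auto simp: oriented_rule_def crossing_rule_def)
qed

lemma rule_forward_unique:
  assumes "oriented_rule e f h b a b' a'" "oriented_rule e f h b c b' c'"
    "{b, b', a, a', c, c'} \<subseteq> A"
  shows "a = c \<and> a' = c'"
proof (cases e)
  case True
  then have "h a' b = h c' b" and eqs: "a = f b a'" "c = f b c'"
    using assms(1,2) unfolding oriented_rule_def crossing_rule_def by auto
  then have "a' = c'" using right_cancel(2) assms(3) by blast
  then show ?thesis using eqs by simp
next
  case False
  then have "f a b' = f c b'" and eqs: "a' = h b' a" "c' = h b' c"
    using assms(1,2) unfolding oriented_rule_def crossing_rule_def by auto
  then have "a = c" using right_cancel(1) assms(3) by blast
  then show ?thesis using eqs by simp
qed

text \<open>\<open>b\<close> and \<open>a'\<close> are both left labels if \<open>e\<close> holds,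
  and the rule computes the rest. Otherwise they are both right labels and the switch has to be
  inverted.\<close>

lemma rule_across:
  assumes "b \<in> A" "a' \<in> A"
  obtains a b' where "a \<in> A" "b' \<in> A" "oriented_rule e f h b a b' a'"
proof (cases e)
  case True
  then show thesis using that[of "f b a'" "h a' b"] assms closed
    by (auto simp: oriented_rule_def crossing_rule_def)
next
  case False
  obtain a b' where "a \<in> A" "b' \<in> A" "f a b' = b" "h b' a = a'" using switch_solve[OF assms] by blast
  then show thesis using that[of a b'] False
    by (auto simp: oriented_rule_def crossing_rule_def)
qed

lemma rule_across_unique:
  assumes "oriented_rule e f h b a b' a'" "oriented_rule e f h b c c' a'"
    "{b, b', a, a', c, c'} \<subseteq> A"
  shows "a = c \<and> b' = c'"
  using assms switch_cancel[of a b' c c'] unfolding oriented_rule_def crossing_rule_def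
  by (cases e) simp_all

end

context crossing_ops begin

lemma rule_backward_unique:
  assumes "oriented_rule e f h a b a' b'" "oriented_rule e f h c b c' b'"
    "{b, b', a, a', c, c'} \<subseteq> A"
  shows "a = c \<and> a' = c'"
  using rule_forward_unique[of "\<not> e" b a b' a' c c'] assms by (simp add: oriented_rule_reverse)

lemma rule_across_back_unique:
  assumes "oriented_rule e f h a b b' a'" "oriented_rule e f h c b b' c'"
    "{b, b', a, a', c, c'} \<subseteq> A"
  shows "a = c \<and> a' = c'"
  using rule_across_unique[of "\<not> e" b a a' b' c c'] assms by (simp add: oriented_rule_reverse)

end

context psyquandle begin

lemma classical_ops: "crossing_ops (carrier X) (tri_u X) (tri_o X)"
  by unfold_locales (rule closed right_inv switch; assumption?)+

lemma singular_ops: "crossing_ops (carrier X) (dot_u X) (dot_o X)"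
  by unfold_locales (rule closed right_inv switch; assumption?)+

sublocale cl: crossing_ops "carrier X" "tri_u X" "tri_o X" by (rule classical_ops)
sublocale si: crossing_ops "carrier X" "dot_u X" "dot_o X" by (rule singular_ops)

text \<open>Axiom (iv) with its two quotients named \<open>p\<close> and \<open>q\<close> and
  characterized by multiplication, so that the \<open>THE\<close> term \<open>right_inverse\<close>
  is dealt with once and for all.\<close>

lemma commute_rule:
  assumes "{x, y, p, q} \<subseteq> carrier X" "p \<bullet>\<^sub>o x = y \<triangleright>\<^sub>o x" "q \<bullet>\<^sub>o y = x \<triangleright>\<^sub>u y"
  shows "x \<bullet>\<^sub>u p = q \<triangleright>\<^sub>o p" "y \<bullet>\<^sub>u q = p \<triangleright>\<^sub>u q"
proof -
  have inv: "(w \<bullet>\<^sub>o v) \<bullet>\<^sub>o\<inverse> v = w" if "w \<in> carrier X" "v \<in> carrier X" for w v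
    unfolding right_inverse_def
  proof (rule the_equality)
    fix w' assume "w' \<in> carrier X \<and> w' \<bullet>\<^sub>o v = w \<bullet>\<^sub>o v"
    then show "w' = w" using si.right_cancel(2)[of w' v w] that by blast
  qed (use that in simp)
  have "(y \<triangleright>\<^sub>o x) \<bullet>\<^sub>o\<inverse> x = p" "(x \<triangleright>\<^sub>u y) \<bullet>\<^sub>o\<inverse> y = q"
    using inv[of p x] inv[of q y] assms by simp_all
  then show "x \<bullet>\<^sub>u p = q \<triangleright>\<^sub>o p" "y \<bullet>\<^sub>u q = p \<triangleright>\<^sub>u q"
    using commute assms by auto
qed

text \<open>By axiom (i), equal values on the diagonal mean equal values of both operations, so
  injectivity of the switch applies to the pairs \<open>(x, x)\<close> and \<open>(y, y)\<close>.
  Finiteness turns injectivity into surjectivity.\<close>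

lemma diagonal_bij:
  assumes "finite (carrier X)"
  shows "bij_betw (\<lambda>x. x \<triangleright>\<^sub>u x) (carrier X) (carrier X)"
proof -
  have "inj_on (\<lambda>x. x \<triangleright>\<^sub>u x) (carrier X)"
  proof (rule inj_onI)
    fix x y assume *: "x \<in> carrier X" "y \<in> carrier X" "x \<triangleright>\<^sub>u x = y \<triangleright>\<^sub>u y"
    then have "x \<triangleright>\<^sub>o x = y \<triangleright>\<^sub>o y" using diagonal[of x] diagonal[of y] by argo
    then show "x = y" using * cl.switch_cancel[of x x y y] by blast
  qed
  moreover have "(\<lambda>x. x \<triangleright>\<^sub>u x) ` carrier X \<subseteq> carrier X" using closed(1) by blast
  ultimately show ?thesis using endo_inj_surj[OF assms] by (simp add: bij_betw_def)
qed

lemma diagonal_solve: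
  assumes "finite (carrier X)" "y \<in> carrier X"
  obtains x where "x \<in> carrier X" "x \<triangleright>\<^sub>u x = y" "x \<triangleright>\<^sub>o x = y"
proof -
  have "y \<in> (\<lambda>x. x \<triangleright>\<^sub>u x) ` carrier X"
    using bij_betw_imp_surj_on[OF diagonal_bij[OF assms(1)]] assms(2) by simp
  then obtain x where "x \<in> carrier X" "y = x \<triangleright>\<^sub>u x" by blast
  then show thesis using that[OF \<open>x \<in> carrier X\<close>] diagonal[of x] by metis
qed

text \<open>
  Axiom (iv) is the exchange move for parallel strands. For antiparallel strands it is applied to
  the diagonal elements \<open>x \<triangleright>\<^sub>u x\<close> and \<open>d \<triangleright>\<^sub>u d\<close>: a kink
  on one strand turns the antiparallel picture into a parallel one, and the mixed exchange laws
  slide the kink away again.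
\<close>

lemma antiparallel_exchange:
  assumes fin: "finite (carrier X)"
    and xC: "x \<in> carrier X" and yC: "y \<in> carrier X"
    and pC: "p \<in> carrier X" and bC: "b \<in> carrier X"
    and h: "b \<triangleright>\<^sub>o p = x \<bullet>\<^sub>u y" "p \<triangleright>\<^sub>u b = y \<bullet>\<^sub>o x"
  shows "b \<bullet>\<^sub>o p = x \<triangleright>\<^sub>u y \<and> p \<bullet>\<^sub>u b = y \<triangleright>\<^sub>o x"
proof -
  define A where "A = y \<triangleright>\<^sub>o x"
  define s where "s = x \<triangleright>\<^sub>u x"
  define t where "t = y \<bullet>\<^sub>o x"
  have AC: "A \<in> carrier X" and sC: "s \<in> carrier X" and tC: "t \<in> carrier X"
    unfolding A_def s_def t_def by (rule closed[OF xC yC] closed[OF yC xC] closed[OF xC xC] closed[OF yC yC])+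
  have s2: "s = x \<triangleright>\<^sub>o x" unfolding s_def by (rule diagonal[OF xC])
  obtain B where BC: "B \<in> carrier X" and B: "B \<bullet>\<^sub>o t = s \<triangleright>\<^sub>u t"
    using si.right_solve(2)[OF closed(1)[OF sC tC] tC] by blast
  have A: "A \<bullet>\<^sub>o s = t \<triangleright>\<^sub>o s"
    by (rule exchange_mixed(3)[OF yC xC xC, folded A_def t_def, folded s_def s2])
  \<comment> \<open>\<open>A\<close> and \<open>B\<close> are the two quotients of axiom (iv) for
    the parallel pair \<open>s\<close>, \<open>t\<close>.\<close>
  have c: "s \<bullet>\<^sub>u A = B \<triangleright>\<^sub>o A" "t \<bullet>\<^sub>u B = A \<triangleright>\<^sub>u B"
    using commute_rule[OF _ A B] AC BC sC tC by blast+
  obtain d where dC: "d \<in> carrier X" and d: "d \<triangleright>\<^sub>u d = B" "d \<triangleright>\<^sub>o d = B"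
    by (rule diagonal_solve[OF fin BC])
  obtain q where qC: "q \<in> carrier X" and q: "q \<triangleright>\<^sub>u d = t"
    using cl.right_solve(1)[OF tC dC] by blast
  \<comment> \<open>Since \<open>B\<close> is the diagonal value of \<open>d\<close>, the fourth
    mixed law turns the second part of \<open>c\<close> into an equation in which \<open>B\<close>
    can be cancelled.\<close>
  have "(q \<bullet>\<^sub>u d) \<triangleright>\<^sub>u B = A \<triangleright>\<^sub>u B"
    using exchange_mixed(4)[OF qC dC dC] unfolding q d c by (rule sym)
  then have qd: "q \<bullet>\<^sub>u d = A" by (rule cl.right_cancel(1)[OF _ closed(3)[OF qC dC] AC BC])
  have "(d \<triangleright>\<^sub>o q) \<triangleright>\<^sub>o (d \<bullet>\<^sub>o q) = B \<triangleright>\<^sub>o A"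
    using exchange_mixed(1)[OF dC qC dC] unfolding qd d .
  also have "\<dots> = (x \<bullet>\<^sub>u y) \<triangleright>\<^sub>o (x \<triangleright>\<^sub>u y)"
    using exchange_mixed(5)[OF xC xC yC] unfolding A_def[symmetric] s2[symmetric] c by simp
  finally have e1: "(d \<triangleright>\<^sub>o q) \<triangleright>\<^sub>o (d \<bullet>\<^sub>o q) = (x \<bullet>\<^sub>u y) \<triangleright>\<^sub>o (x \<triangleright>\<^sub>u y)" .
  have "(d \<bullet>\<^sub>o q) \<triangleright>\<^sub>u (d \<triangleright>\<^sub>o q) = B \<bullet>\<^sub>o t"
    using exchange_mixed(6)[OF dC dC qC] unfolding q d by (rule sym)
  also have "\<dots> = (x \<triangleright>\<^sub>u y) \<triangleright>\<^sub>u (x \<bullet>\<^sub>u y)"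
    unfolding B using exchange_mixed(2)[OF xC xC yC] unfolding s_def[symmetric] t_def[symmetric] .
  finally have eq: "d \<bullet>\<^sub>o q = x \<triangleright>\<^sub>u y \<and> d \<triangleright>\<^sub>o q = x \<bullet>\<^sub>u y"
    using e1 by (rule cl.switch_cancel) (intro closed xC yC dC qC)+
  \<comment> \<open>By \<open>h\<close> the pairs \<open>(q, d)\<close> and \<open>(p, b)\<close>
    have the same image under the switch, so the auxiliary elements are the given ones.\<close>
  have "q = p \<and> d = b"
    by (rule cl.switch_cancel) (use eq h q qC dC pC bC in \<open>simp_all add: t_def\<close>)
  then show ?thesis using eq qd A_def by simp
qed

text \<open>The other choice of over-strand at the classical crossing. The argument is the same with
  the roles distributed differently: axiom (iv) is again applied to \<open>s\<close> and
  \<open>t\<close>, but the diagonal elements are now \<open>A\<close>, coming from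
  \<open>y\<close>, and \<open>t\<close>, coming from \<open>d\<close>.\<close>

lemma antiparallel_exchange':
  assumes fin: "finite (carrier X)"
    and xC: "x \<in> carrier X" and yC: "y \<in> carrier X"
    and pC: "p \<in> carrier X" and bC: "b \<in> carrier X"
    and h: "b \<triangleright>\<^sub>u p = x \<bullet>\<^sub>u y" "p \<triangleright>\<^sub>o b = y \<bullet>\<^sub>o x"
  shows "b \<bullet>\<^sub>o p = x \<triangleright>\<^sub>o y \<and> p \<bullet>\<^sub>u b = y \<triangleright>\<^sub>u x"
proof -
  define s where "s = x \<triangleright>\<^sub>o y"
  define A where "A = y \<triangleright>\<^sub>o y"
  define B where "B = x \<bullet>\<^sub>u y"
  have AC: "A \<in> carrier X" and sC: "s \<in> carrier X" and BC: "B \<in> carrier X"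
    unfolding A_def s_def B_def by (rule closed[OF xC yC] closed[OF yC xC] closed[OF xC xC] closed[OF yC yC])+
  have A2: "A = y \<triangleright>\<^sub>u y" unfolding A_def by (rule diagonal[OF yC, symmetric])
  obtain t where tC: "t \<in> carrier X" and t: "t \<triangleright>\<^sub>o s = A \<bullet>\<^sub>o s"
    using cl.right_solve(2)[OF closed(4)[OF AC sC] sC] by blast
  obtain B' where B'C: "B' \<in> carrier X" and B': "B' \<bullet>\<^sub>o t = s \<triangleright>\<^sub>u t"
    using si.right_solve(2)[OF closed(1)[OF sC tC] tC] by blast
  have c: "s \<bullet>\<^sub>u A = B' \<triangleright>\<^sub>o A" "t \<bullet>\<^sub>u B' = A \<triangleright>\<^sub>u B'"
    using commute_rule[OF _ t[symmetric] B'] AC B'C sC tC by blast+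
  have "B' \<triangleright>\<^sub>o A = B \<triangleright>\<^sub>o A"
    unfolding c(1)[symmetric] by (rule exchange_mixed(5)[OF xC yC yC, folded s_def A_def A2 B_def])
  then have B'_eq: "B' = B" by (rule cl.right_cancel(2)[OF _ B'C BC AC])
  obtain d where dC: "d \<in> carrier X" and d: "d \<triangleright>\<^sub>u d = t" "d \<triangleright>\<^sub>o d = t"
    by (rule diagonal_solve[OF fin tC])
  obtain r where rC: "r \<in> carrier X" and r: "r \<triangleright>\<^sub>u d = B"
    using cl.right_solve(1)[OF BC dC] by blast
  have "(r \<bullet>\<^sub>o d) \<triangleright>\<^sub>u t = s \<triangleright>\<^sub>u t"
    using exchange_mixed(6)[OF rC dC dC] unfolding r d B'[unfolded B'_eq] by (rule sym)
  then have rd: "r \<bullet>\<^sub>o d = s" by (rule cl.right_cancel(1)[OF _ closed(4)[OF rC dC] sC tC])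
  have "(d \<bullet>\<^sub>u r) \<triangleright>\<^sub>u (d \<triangleright>\<^sub>o r) = A \<triangleright>\<^sub>u B"
    using exchange_mixed(4)[OF dC dC rC] unfolding r d c(2)[unfolded B'_eq] by (rule sym)
  also have "\<dots> = (y \<triangleright>\<^sub>u x) \<triangleright>\<^sub>u (y \<bullet>\<^sub>o x)"
    unfolding A2 B_def by (rule exchange_mixed(2)[OF yC xC yC, symmetric])
  finally have e1: "(d \<bullet>\<^sub>u r) \<triangleright>\<^sub>u (d \<triangleright>\<^sub>o r) = (y \<triangleright>\<^sub>u x) \<triangleright>\<^sub>u (y \<bullet>\<^sub>o x)" .
  have "(d \<triangleright>\<^sub>o r) \<triangleright>\<^sub>o (d \<bullet>\<^sub>u r) = t \<triangleright>\<^sub>o s"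
    using exchange_mixed(1)[OF dC dC rC] unfolding rd d by (rule sym)
  also have "\<dots> = (y \<bullet>\<^sub>o x) \<triangleright>\<^sub>o (y \<triangleright>\<^sub>u x)"
    unfolding t by (rule exchange_mixed(3)[OF yC yC xC, folded s_def A_def])
  finally have eq: "d \<bullet>\<^sub>u r = y \<triangleright>\<^sub>u x \<and> d \<triangleright>\<^sub>o r = y \<bullet>\<^sub>o x"
    using e1 by (intro cl.switch_cancel closed xC yC dC rC)
  have "r = b \<and> d = p"
    by (rule cl.switch_cancel) (use eq h r rC dC pC bC in \<open>simp_all add: B_def\<close>)
  then show ?thesis using eq rd s_def by simp
qed

end

section \<open>Three strands\<close>

text \<open>
  The label of strand \<open>i\<close> acted on by strand \<open>j\<close> is computed by \<open>f i j\<close>. Label every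
  piece of a strand by the sides (\<open>True\<close> for left) of the two other strands on which it
  lies, in the order of their indices. Independently of all orientations, the crossing of
  strands \<open>i\<close> and \<open>j\<close> relates the pieces on one fixed side of the third strand; a triangle
  uses one side for each crossing, and the move replaces all three sides by the opposite ones.
  The exchange laws say that all twelve labels extend consistently to both sides at once.
\<close>

locale triangle_ops =
  fixes A :: "'a set" and f :: "nat \<Rightarrow> nat \<Rightarrow> 'a \<Rightarrow> 'a \<Rightarrow> 'a"
  assumes ops: "\<lbrakk>i < 3; j < 3; i \<noteq> j\<rbrakk> \<Longrightarrow> crossing_ops A (f i j) (f j i)"
    and exchange: "\<lbrakk>i < 3; j < 3; k < 3; distinct [i, j, k]; x \<in> A; y \<in> A; z \<in> A\<rbrakk> \<Longrightarrow>
      f i k (f i j x y) (f k j z y) = f i j (f i k x z) (f j k y z)"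
begin

sublocale o01: crossing_ops A "f 0 1" "f 1 0" by (rule ops) auto
sublocale o02: crossing_ops A "f 0 2" "f 2 0" by (rule ops) auto
sublocale o12: crossing_ops A "f 1 2" "f 2 1" by (rule ops) auto

text \<open>The eight patterns of sides are the vertices of a cube (the possible regions), the
  pieces \<open>P\<close>, \<open>Q\<close>, \<open>R\<close> of strands 0, 1, 2 are its edges, and
  the possible crossings its faces. The condition is the rule at the three faces that meet in the
  vertex \<open>(s0, s1, s2)\<close>, the inner region of the triangle.\<close>

definition half_cube :: "bool \<Rightarrow> bool \<Rightarrow> bool \<Rightarrow> (bool \<Rightarrow> bool \<Rightarrow> 'a) \<Rightarrow>
    (bool \<Rightarrow> bool \<Rightarrow> 'a) \<Rightarrow> (bool \<Rightarrow> bool \<Rightarrow> 'a) \<Rightarrow> bool" where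
  "half_cube s0 s1 s2 P Q R \<longleftrightarrow>
     crossing_rule (f 0 1) (f 1 0) (P True s2) (P False s2) (Q True s2) (Q False s2) \<and>
     crossing_rule (f 0 2) (f 2 0) (P s1 True) (P s1 False) (R True s1) (R False s1) \<and>
     crossing_rule (f 1 2) (f 2 1) (Q s0 True) (Q s0 False) (R s0 True) (R s0 False)"

definition labels_in :: "(bool \<Rightarrow> bool \<Rightarrow> 'a) \<Rightarrow> bool" where
  "labels_in P \<longleftrightarrow> (\<forall>a b. P a b \<in> A)"

text \<open>The three edges at the all-left vertex generate all labels. A label to the right of both
  other strands can be computed along two faces, and the exchange laws say that the results
  agree.\<close>

lemma cube:
  assumes "x \<in> A" "y \<in> A" "z \<in> A"
  obtains P Q R where "labels_in P" "labels_in Q" "labels_in R"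
    "\<And>s0 s1 s2. half_cube s0 s1 s2 P Q R" "P True True = x" "Q True True = y" "R True True = z"
proof -
  define P where "P = (\<lambda>a b. if a then (if b then x else f 0 2 x z)
    else (if b then f 0 1 x y else f 0 1 (f 0 2 x z) (f 1 2 y z)))"
  define Q where "Q = (\<lambda>a b. if a then (if b then y else f 1 2 y z)
    else (if b then f 1 0 y x else f 1 0 (f 1 2 y z) (f 0 2 x z)))"
  define R where "R = (\<lambda>a b. if a then (if b then z else f 2 1 z y)
    else (if b then f 2 0 z x else f 2 0 (f 2 1 z y) (f 0 1 x y)))"
  have "labels_in P" "labels_in Q" "labels_in R"
    unfolding labels_in_def P_def Q_def R_def
    using assms by (auto simp del: One_nat_def intro!: o01.closed o02.closed o12.closed)
  moreover have "half_cube s0 s1 s2 P Q R" for s0 s1 s2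
    using exchange[of 0 1 2 x y z] exchange[of 1 0 2 y x z] exchange[of 2 0 1 z x y] assms
    unfolding half_cube_def crossing_rule_def P_def Q_def R_def by (cases s0; cases s1; cases s2) simp_all
  ultimately show thesis using that[of P Q R] by (simp add: P_def Q_def R_def)
qed

text \<open>The omitted label \<open>P (\<not> s) (\<not> t)\<close> lies on none of the three faces
  of the half cube at hand.\<close>

definition agree :: "bool \<Rightarrow> bool \<Rightarrow> (bool \<Rightarrow> bool \<Rightarrow> 'a) \<Rightarrow> (bool \<Rightarrow> bool \<Rightarrow> 'a) \<Rightarrow> bool" where
  "agree s t P P' \<longleftrightarrow> P s t = P' s t \<and> P (\<not> s) t = P' (\<not> s) t \<and> P s (\<not> t) = P' s (\<not> t)"

lemma half_cube_iff:
  "half_cube s0 s1 s2 P Q R \<longleftrightarrow>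
     P False s2 = f 0 1 (P True s2) (Q True s2) \<and> Q False s2 = f 1 0 (Q True s2) (P True s2) \<and>
     P s1 False = f 0 2 (P s1 True) (R True s1) \<and> R False s1 = f 2 0 (R True s1) (P s1 True) \<and>
     Q s0 False = f 1 2 (Q s0 True) (R s0 True) \<and> R s0 False = f 2 1 (R s0 True) (Q s0 True)"
  by (auto simp: half_cube_def crossing_rule_def)

text \<open>It suffices to find labels at the all-left vertex whose cube restricts to the given
  half. A label there that lies on the half is kept; a missing one is recovered by right inversion
  or, if strands 0 and 1 both miss theirs, by inverting the switch.\<close>

lemma cube_extends:
  assumes half: "half_cube s0 s1 s2 P Q R" and inA: "labels_in P" "labels_in Q" "labels_in R"
  shows "\<exists>P' Q' R'. labels_in P' \<and> labels_in Q' \<and> labels_in R' \<and>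
    (\<forall>r0 r1 r2. half_cube r0 r1 r2 P' Q' R') \<and>
    agree s1 s2 P P' \<and> agree s0 s2 Q Q' \<and> agree s0 s1 R R'"
proof -
  have PA: "P a b \<in> A" and QA: "Q a b \<in> A" and RA: "R a b \<in> A" for a b
    using inA by (auto simp: labels_in_def)
  note h = half[unfolded half_cube_iff]
  obtain x y z where xyz: "x \<in> A" "y \<in> A" "z \<in> A"
    and x: "s1 \<or> s2 \<Longrightarrow> x = P True True" "\<not> s1 \<Longrightarrow> \<not> s2 \<Longrightarrow> f 0 1 x y = P False True"
    and y: "s0 \<or> s2 \<Longrightarrow> y = Q True True" "\<not> s0 \<Longrightarrow> \<not> s2 \<Longrightarrow> f 1 0 y x = Q False True"
    and z: "s0 \<or> s1 \<Longrightarrow> z = R True True" "\<not> s0 \<Longrightarrow> \<not> s1 \<Longrightarrow> f 2 1 z y = R True False"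
  proof -
    obtain x1 where x1: "x1 \<in> A" "f 0 1 x1 (Q True True) = P False True"
      using o01.right_solve(1)[OF PA QA] by blast
    obtain y1 where y1: "y1 \<in> A" "f 1 0 y1 (P True True) = Q False True"
      using o01.right_solve(2)[OF QA PA] by blast
    obtain x2 y2 where xy2: "x2 \<in> A" "y2 \<in> A" "f 0 1 x2 y2 = P False True" "f 1 0 y2 x2 = Q False True"
      using o01.switch_solve[OF PA QA] by blast
    obtain z1 where z1: "z1 \<in> A" "f 2 1 z1 (Q True True) = R True False"
      using o12.right_solve(2)[OF RA QA] by blast
    obtain z2 where z2: "z2 \<in> A" "f 2 1 z2 y2 = R True False"
      using o12.right_solve(2)[OF RA xy2(2)] by blast
    consider "s2" "s0 \<or> s1" | "s2" "\<not> s0" "\<not> s1" | "\<not> s2" "s0" "s1" | "\<not> s2" "s0" "\<not> s1"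
      | "\<not> s2" "\<not> s0" "s1" | "\<not> s2" "\<not> s0" "\<not> s1" by blast
    then show thesis
    proof cases
      case 1 show thesis by (rule that[of "P True True" "Q True True" "R True True"]) (use 1 PA QA RA in auto)
    next
      case 2 show thesis by (rule that[of "P True True" "Q True True" z1]) (use 2 PA QA z1 in auto)
    next
      case 3 show thesis by (rule that[of "P True True" "Q True True" "R True True"]) (use 3 PA QA RA in auto)
    next
      case 4 show thesis by (rule that[of x1 "Q True True" "R True True"]) (use 4 x1 QA RA in auto)
    next
      case 5 show thesis by (rule that[of "P True True" y1 "R True True"]) (use 5 y1 PA RA in auto)
    next
      case 6 show thesis by (rule that[of x2 y2 z2]) (use 6 xy2 z2 in auto)
    qed
  qed
  obtain P' Q' R' where inA': "labels_in P'" "labels_in Q'" "labels_in R'"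
      and all: "\<And>s0 s1 s2. half_cube s0 s1 s2 P' Q' R'"
      and v: "P' True True = x" "Q' True True = y" "R' True True = z"
    using cube[OF xyz] by blast
  have PA': "P' a b \<in> A" and QA': "Q' a b \<in> A" and RA': "R' a b \<in> A" for a b
    using inA' by (auto simp: labels_in_def)
  have c: "P' False s = f 0 1 (P' True s) (Q' True s)" "Q' False s = f 1 0 (Q' True s) (P' True s)"
    "P' s False = f 0 2 (P' s True) (R' True s)" "R' False s = f 2 0 (R' True s) (P' s True)"
    "Q' s False = f 1 2 (Q' s True) (R' s True)" "R' s False = f 2 1 (R' s True) (Q' s True)" for s
    using all[of s s s] unfolding half_cube_iff by auto
  have "agree s1 s2 P P' \<and> agree s0 s2 Q Q' \<and> agree s0 s1 R R'"
  \<comment> \<open>Agreement spreads along the faces of the half: where the left labels agree the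
    right ones follow, and where a right label is known cancellation leads back to the left. With
    all sides \<open>False\<close> the last pair needs the switch.\<close>
  proof (cases s0; cases s1; cases s2)
    assume s: "s0" "s1" "s2"
    have s': "s0 = True" "s1 = True" "s2 = True" using s by auto
    note h' = h[unfolded s']
    have v': "P' True True = P True True" "Q' True True = Q True True" "R' True True = R True True"
      using v x(1) y(1) z(1) s by simp_all
    show ?thesis unfolding agree_def s'
      using c(1-6)[of True] h' v' by simp
  next
    assume s: "\<not> s0" "\<not> s1" "\<not> s2"
    have s': "s0 = False" "s1 = False" "s2 = False" using s by auto
    note h' = h[unfolded s']
    have 1: "P' False True = P False True" "Q' False True = Q False True"
      using c(1,2)[of True] x(2) y(2) v s by metis+
    have 2: "R' True False = R True False" using c(6)[of True] z(2) v s by metis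
    have 3: "P' False False = P False False" "R' False False = R False False"
      using c(3,4)[of False] h' 1 2 by metis+
    have 4: "R' False True = R False True"
      using c(6)[of False] h' 1 3 o12.right_cancel(2)[OF _ RA' RA QA, of False True False True False True] by metis
    have 5: "Q' False False = Q False False" using c(5)[of False] h' 1 4 by metis
    have 6: "P' True False = P True False \<and> Q' True False = Q True False"
      using c(1,2)[of False] h' 3 5 by (intro o01.switch_cancel PA QA PA' QA') metis+
    show ?thesis unfolding agree_def s' using 1 2 3 4 5 6 by simp
  next
    assume s: "s0" "\<not> s1" "\<not> s2"
    have s': "s0 = True" "s1 = False" "s2 = False" using s by auto
    note h' = h[unfolded s']
    have v': "Q' True True = Q True True" "R' True True = R True True"
      using v y(1) z(1) s by simp_all
    have 1: "Q' True False = Q True False" "R' True False = R True False"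
      using c(5,6)[of True] h' v' by metis+
    have 2: "P' False True = P False True" using c(1)[of True] x(2) v v' s by metis
    have 3: "P' False False = P False False" "R' False False = R False False"
      using c(3,4)[of False] h' 1 2 by metis+
    have 4: "P' True False = P True False"
      using c(1)[of False] h' 1 3 o01.right_cancel(1)[OF _ PA' PA QA, of True False True False True False] by metis
    have 5: "Q' False False = Q False False" using c(2)[of False] h' 1 4 by metis
    show ?thesis unfolding agree_def s' using v' 1 2 3 4 5 by simp
  next
    assume s: "\<not> s0" "s1" "\<not> s2"
    have s': "s0 = False" "s1 = True" "s2 = False" using s by auto
    note h' = h[unfolded s']
    have v': "P' True True = P True True" "R' True True = R True True"
      using v x(1) z(1) s by simp_all
    have 1: "P' True False = P True False" "R' False True = R False True"
      using c(3,4)[of True] h' v' by metis+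
    have 2: "Q' False True = Q False True" using c(2)[of True] y(2) v v' s by metis
    have 3: "Q' False False = Q False False" "R' False False = R False False"
      using c(5,6)[of False] h' 1 2 by metis+
    have 4: "Q' True False = Q True False"
      using c(2)[of False] h' 1 3 o01.right_cancel(2)[OF _ QA' QA PA, of True False True False True False] by metis
    have 5: "P' False False = P False False" using c(1)[of False] h' 1 4 by metis
    show ?thesis unfolding agree_def s' using v' 1 2 3 4 5 by simp
  next
    assume s: "\<not> s0" "\<not> s1" "s2"
    have s': "s0 = False" "s1 = False" "s2 = True" using s by auto
    note h' = h[unfolded s']
    have v': "P' True True = P True True" "Q' True True = Q True True"
      using v x(1) y(1) s by simp_all
    have 1: "P' False True = P False True" "Q' False True = Q False True"
      using c(1,2)[of True] h' v' by metis+
    have 2: "R' True False = R True False" using c(6)[of True] z(2) v v' s by metis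
    have 3: "P' False False = P False False" "R' False False = R False False"
      using c(3,4)[of False] h' 1 2 by metis+
    have 4: "R' False True = R False True"
      using c(6)[of False] h' 1 3 o12.right_cancel(2)[OF _ RA' RA QA, of False True False True False True] by metis
    have 5: "Q' False False = Q False False" using c(5)[of False] h' 1 4 by metis
    show ?thesis unfolding agree_def s' using v' 1 2 3 4 5 by simp
  next
    assume s: "\<not> s0" "s1" "s2"
    have s': "s0 = False" "s1 = True" "s2 = True" using s by auto
    note h' = h[unfolded s']
    have v': "P' True True = P True True" "Q' True True = Q True True" "R' True True = R True True"
      using v x(1) y(1) z(1) s by simp_all
    have 1: "P' False True = P False True" "Q' False True = Q False True" "P' True False = P True False"
      "R' False True = R False True"
      using c(1-4)[of True] h' v' by metis+
    have 2: "Q' False False = Q False False" "R' False False = R False False"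
      using c(5,6)[of False] h' 1 by metis+
    show ?thesis unfolding agree_def s' using v' 1 2 by simp
  next
    assume s: "s0" "\<not> s1" "s2"
    have s': "s0 = True" "s1 = False" "s2 = True" using s by auto
    note h' = h[unfolded s']
    have v': "P' True True = P True True" "Q' True True = Q True True" "R' True True = R True True"
      using v x(1) y(1) z(1) s by simp_all
    have 1: "P' False True = P False True" "Q' False True = Q False True" "Q' True False = Q True False"
      "R' True False = R True False"
      using c(1,2,5,6)[of True] h' v' by metis+
    have 2: "P' False False = P False False" "R' False False = R False False"
      using c(3,4)[of False] h' 1 by metis+
    show ?thesis unfolding agree_def s' using v' 1 2 by simp
  next
    assume s: "s0" "s1" "\<not> s2"
    have s': "s0 = True" "s1 = True" "s2 = False" using s by auto
    note h' = h[unfolded s']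
    have v': "P' True True = P True True" "Q' True True = Q True True" "R' True True = R True True"
      using v x(1) y(1) z(1) s by simp_all
    have 1: "P' True False = P True False" "R' False True = R False True" "Q' True False = Q True False"
      "R' True False = R True False"
      using c(3-6)[of True] h' v' by metis+
    have 2: "P' False False = P False False" "Q' False False = Q False False"
      using c(1,2)[of False] h' 1 by metis+
    show ?thesis unfolding agree_def s' using v' 1 2 by simp
  qed
  then show ?thesis using inA' all by blast
qed

end

section \<open>Algebra of the moves\<close>

context crossing_ops begin

text \<open>Determinacy at a crossing: the four combinations of before and after for the label known
  on each strand are the four preceding uniqueness facts.\<close>

lemma rule_unique:
  assumes r: "oriented_rule e f h b a b' a'" "oriented_rule e f h c d c' d'"
    and A: "{a, b, a', b', c, d, c', d'} \<subseteq> A"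
    and known: "b = c \<or> a = d" "b' = c' \<or> a' = d'"
  shows "a = d \<and> b = c \<and> a' = d' \<and> b' = c'"
proof -
  consider "b = c" "b' = c'" | "b = c" "a' = d'" | "a = d" "b' = c'" | "a = d" "a' = d'"
    using known by blast
  then show ?thesis
  proof cases
    case 1 then show ?thesis using rule_forward_unique[of e b a b' a' d d'] r A by simp
  next
    case 2 then show ?thesis using rule_across_unique[of e b a b' a' d c'] r A by simp
  next
    case 3 then show ?thesis using rule_across_back_unique[of e b a b' a' c d'] r A by simp
  next
    case 4 then show ?thesis using rule_backward_unique[of e b a b' a' c c'] r A by simp
  qed
qed

end

text \<open>
  Two strands crossing twice. The second strand meets the two crossings in the same order as the
  first one iff \<open>par\<close>; \<open>m0\<close> and \<open>m1\<close> label the pieces between the crossings.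
\<close>

definition clasp :: "bool \<Rightarrow> bool \<Rightarrow> ('a \<Rightarrow> 'a \<Rightarrow> 'a) \<Rightarrow> ('a \<Rightarrow> 'a \<Rightarrow> 'a) \<Rightarrow>
    ('a \<Rightarrow> 'a \<Rightarrow> 'a) \<Rightarrow> ('a \<Rightarrow> 'a \<Rightarrow> 'a) \<Rightarrow> 'a \<Rightarrow> 'a \<Rightarrow> 'a \<Rightarrow> 'a \<Rightarrow> 'a \<Rightarrow> 'a \<Rightarrow> bool" where
  "clasp par e f h f' h' x0 m0 w0 x1 m1 w1 \<longleftrightarrow>
     oriented_rule e f h x0 m0 (if par then x1 else m1) (if par then m1 else w1) \<and>
     oriented_rule (\<not> e) f' h' m0 w0 (if par then m1 else x1) (if par then w1 else m1)"

lemma clasp_parallel_commute: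
  "clasp True e f h f' h' x0 m0 w0 x1 m1 w1 \<longleftrightarrow> clasp True (\<not> e) h f h' f' x1 m1 w1 x0 m0 w0"
  by (auto simp: clasp_def oriented_rule_def crossing_rule_def)

text \<open>Prescribed are the labels of the two ends at the first crossing of strand 0: its own
  start and the start or, for antiparallel strands, the end of strand 1. They determine that
  crossing, and the middle labels found there determine the next one.\<close>

lemma clasp_exists:
  assumes ops: "crossing_ops A f h" "crossing_ops A f' h'" and "u \<in> A" "v \<in> A"
  obtains m0 w0 x1 m1 w1 where "{m0, w0, x1, m1, w1} \<subseteq> A"
    "clasp par e f h f' h' u m0 w0 x1 m1 w1" "(if par then x1 else w1) = v"
proof -
  interpret o1: crossing_ops A f h by (rule ops)
  interpret o2: crossing_ops A f' h' by (rule ops)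
  show thesis
  proof (cases par)
    case True
    obtain m0 m1 where m: "m0 \<in> A" "m1 \<in> A" "oriented_rule e f h u m0 v m1"
      by (rule o1.rule_forward[OF assms(3,4)])
    obtain w0 w1 where "w0 \<in> A" "w1 \<in> A" "oriented_rule (\<not> e) f' h' m0 w0 m1 w1"
      by (rule o2.rule_forward[OF m(1,2)])
    then show thesis using that[of m0 w0 v m1 w1] m True assms by (simp add: clasp_def)
  next
    case False
    obtain m0 m1 where m: "m0 \<in> A" "m1 \<in> A" "oriented_rule e f h u m0 m1 v"
      by (rule o1.rule_across[OF assms(3,4)])
    obtain w0 x1 where "w0 \<in> A" "x1 \<in> A" "oriented_rule (\<not> e) f' h' m0 w0 x1 m1"
      by (rule o2.rule_across[OF m(1,2)])
    then show thesis using that[of m0 w0 x1 m1 v] m False assms by (simp add: clasp_def)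
  qed
qed

lemma clasp_unique:
  assumes ops: "crossing_ops A f h" "crossing_ops A f' h'"
    and A: "{x0, m0, w0, x1, m1, w1} \<subseteq> A" "{n0, v0, y1, n1, v1} \<subseteq> A"
    and c: "clasp par e f h f' h' x0 m0 w0 x1 m1 w1" "clasp par e f h f' h' x0 n0 v0 y1 n1 v1"
    and key: "(if par then x1 else w1) = (if par then y1 else v1)"
  shows "m0 = n0 \<and> w0 = v0 \<and> x1 = y1 \<and> m1 = n1 \<and> w1 = v1"
proof (cases par)
  case True
  have r: "oriented_rule e f h x0 m0 x1 m1" "oriented_rule e f h x0 n0 y1 n1"
    "oriented_rule (\<not> e) f' h' m0 w0 m1 w1" "oriented_rule (\<not> e) f' h' n0 v0 n1 v1" and "x1 = y1"
    using c key True by (simp_all add: clasp_def)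
  have m: "m0 = n0 \<and> x0 = x0 \<and> m1 = n1 \<and> x1 = y1"
    by (rule crossing_ops.rule_unique[OF ops(1) r(1,2)]) (use A \<open>x1 = y1\<close> in simp_all)
  have "w0 = v0 \<and> m0 = n0 \<and> w1 = v1 \<and> m1 = n1"
    by (rule crossing_ops.rule_unique[OF ops(2) r(3,4)]) (use A m in simp_all)
  then show ?thesis using m by blast
next
  case False
  have r: "oriented_rule e f h x0 m0 m1 w1" "oriented_rule e f h x0 n0 n1 v1"
    "oriented_rule (\<not> e) f' h' m0 w0 x1 m1" "oriented_rule (\<not> e) f' h' n0 v0 y1 n1" and "w1 = v1"
    using c key False by (simp_all add: clasp_def)
  have m: "m0 = n0 \<and> x0 = x0 \<and> w1 = v1 \<and> m1 = n1"
    by (rule crossing_ops.rule_unique[OF ops(1) r(1,2)]) (use A \<open>w1 = v1\<close> in simp_all)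
  have "w0 = v0 \<and> m0 = n0 \<and> m1 = n1 \<and> x1 = y1"
    by (rule crossing_ops.rule_unique[OF ops(2) r(3,4)]) (use A m in simp_all)
  then show ?thesis using m by blast
qed

text \<open>
  Both diagrams of a clasp move are determined by two of the four end labels, so a passage of
  labellings from one diagram to the other is automatically invertible.
\<close>

lemma clasp_converse:
  assumes ops: "crossing_ops A f h" "crossing_ops A f' h'" "crossing_ops A g k" "crossing_ops A g' k'"
    and fwd: "\<And>x0 m0 w0 x1 m1 w1. {x0, m0, w0, x1, m1, w1} \<subseteq> A \<Longrightarrow>
      clasp par e f h f' h' x0 m0 w0 x1 m1 w1 \<Longrightarrow>
      \<exists>n0\<in>A. \<exists>n1\<in>A. clasp par e g k g' k' x0 n0 w0 x1 n1 w1"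
    and A: "{x0, n0, w0, x1, n1, w1} \<subseteq> A" and c: "clasp par e g k g' k' x0 n0 w0 x1 n1 w1"
  shows "\<exists>m0\<in>A. \<exists>m1\<in>A. clasp par e f h f' h' x0 m0 w0 x1 m1 w1"
proof -
  let ?v = "if par then x1 else w1"
  have x0: "x0 \<in> A" and v: "?v \<in> A" using A by auto
  obtain m0 v0 y1 m1 v1 where m: "{m0, v0, y1, m1, v1} \<subseteq> A"
      and mc: "clasp par e f h f' h' x0 m0 v0 y1 m1 v1" and key: "(if par then y1 else v1) = ?v"
    by (rule clasp_exists[OF ops(1,2) x0 v])
  have mA: "{x0, m0, v0, y1, m1, v1} \<subseteq> A" using m x0 by simp
  obtain n0' n1' where n': "n0' \<in> A" "n1' \<in> A" and nc: "clasp par e g k g' k' x0 n0' v0 y1 n1' v1"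
    using fwd[OF mA mc] by blast
  have n'A: "{n0', v0, y1, n1', v1} \<subseteq> A" using m n' by simp
  have "n0 = n0' \<and> w0 = v0 \<and> x1 = y1 \<and> n1 = n1' \<and> w1 = v1"
    by (rule clasp_unique[OF ops(3,4) A n'A c nc key[symmetric]])
  then show ?thesis using mc mA by blast
qed

text \<open>Both crossings impose the same relation when read outwards from the pieces
  \<open>m0\<close> and \<open>m1\<close> between them, so determinacy identifies the outer
  labels.\<close>

lemma cancelling_clasp:
  assumes "crossing_ops A f h" "{x0, m0, w0, x1, m1, w1} \<subseteq> A"
    "clasp par e f h f h x0 m0 w0 x1 m1 w1"
  shows "x0 = w0 \<and> x1 = w1"
proof -
  have r: "oriented_rule e f h x0 m0 (if par then x1 else m1) (if par then m1 else w1)"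
    "oriented_rule e f h w0 m0 (if par then w1 else m1) (if par then m1 else x1)"
    using assms(3) by (simp_all add: clasp_def oriented_rule_reverse)
  have "m0 = m0 \<and> x0 = w0 \<and> (if par then m1 else w1) = (if par then m1 else x1) \<and>
      (if par then x1 else m1) = (if par then w1 else m1)"
    by (rule crossing_ops.rule_unique[OF assms(1) r]) (use assms(2) in simp_all)
  then show ?thesis by (simp split: if_splits)
qed

lemma cancelling_clasp_exists:
  assumes ops: "crossing_ops A f h" and A: "x0 \<in> A" "x1 \<in> A"
  shows "\<exists>m0\<in>A. \<exists>m1\<in>A. clasp par e f h f h x0 m0 x0 x1 m1 x1"
proof -
  obtain m0 w0 y1 m1 w1 where mA: "{m0, w0, y1, m1, w1} \<subseteq> A"
    and c: "clasp par e f h f h x0 m0 w0 y1 m1 w1" and key: "(if par then y1 else w1) = x1"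
    by (rule clasp_exists[OF ops ops A])
  have "x0 = w0 \<and> y1 = w1"
    by (rule cancelling_clasp[OF ops _ c]) (use mA A in simp)
  then have "w0 = x0" "y1 = x1" "w1 = x1" using key by (auto split: if_splits)
  then show ?thesis using c mA by blast
qed

section \<open>Exchange moves and kinks in a psyquandle\<close>

context psyquandle begin

text \<open>Axiom (iv) in the form of a clasp: its elements \<open>x\<close>, \<open>y\<close> are
  \<open>x0\<close>, \<open>n1\<close>, and its two quotients are \<open>m1\<close>,
  \<open>w0\<close>.\<close>

lemma parallel_exchange:
  assumes C: "{x0, n0, w0, x1, n1, w1} \<subseteq> carrier X"
    and c: "clasp True True (tri_u X) (tri_o X) (dot_o X) (dot_u X) x0 n0 w0 x1 n1 w1"
  shows "\<exists>m0\<in>carrier X. \<exists>m1\<in>carrier X.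
    clasp True True (dot_u X) (dot_o X) (tri_o X) (tri_u X) x0 m0 w0 x1 m1 w1"
proof -
  have n: "n0 = x0 \<triangleright>\<^sub>u n1" "x1 = n1 \<triangleright>\<^sub>o x0" "n0 = w0 \<bullet>\<^sub>o n1" "w1 = n1 \<bullet>\<^sub>u w0"
    using c by (auto simp: clasp_def oriented_rule_def crossing_rule_def)
  obtain m1 where m1: "m1 \<in> carrier X" "m1 \<bullet>\<^sub>o x0 = x1"
    using si.right_solve(2)[of x1 x0] C by auto
  have "x0 \<bullet>\<^sub>u m1 = w0 \<triangleright>\<^sub>o m1" "n1 \<bullet>\<^sub>u w0 = m1 \<triangleright>\<^sub>u w0"
    using commute_rule[of x0 n1 m1 w0] C m1 n by simp_all
  then have "clasp True True (dot_u X) (dot_o X) (tri_o X) (tri_u X) x0 (x0 \<bullet>\<^sub>u m1) w0 x1 m1 w1"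
    using n m1 by (simp add: clasp_def oriented_rule_def crossing_rule_def)
  moreover have "x0 \<bullet>\<^sub>u m1 \<in> carrier X" using C m1 closed(3) by simp
  ultimately show ?thesis using m1 by blast
qed

text \<open>What commutes with a crossing commutes with its inverse. An inverse classical crossing
  is put before the given singular one, the preceding lemma moves it behind, and right cancellation
  against the given classical crossing shows that the resulting singular crossing is the required
  one.\<close>

lemma parallel_exchange':
  assumes C: "{x0, m0, w0, x1, m1, w1} \<subseteq> carrier X"
    and c: "clasp True True (dot_u X) (dot_o X) (tri_u X) (tri_o X) x0 m0 w0 x1 m1 w1"
  shows "\<exists>n0\<in>carrier X. \<exists>n1\<in>carrier X.
    clasp True True (tri_o X) (tri_u X) (dot_o X) (dot_u X) x0 n0 w0 x1 n1 w1"
proof -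
  have m: "m0 = x0 \<bullet>\<^sub>u m1" "x1 = m1 \<bullet>\<^sub>o x0" "m0 = w0 \<triangleright>\<^sub>u m1" "w1 = m1 \<triangleright>\<^sub>o w0"
    using c by (auto simp: clasp_def oriented_rule_def crossing_rule_def)
  obtain n1 where n1: "n1 \<in> carrier X" "n1 \<triangleright>\<^sub>u x0 = x1"
    using cl.right_solve(1)[of x1 x0] C by auto
  define n0 where "n0 = x0 \<triangleright>\<^sub>o n1"
  have n0: "n0 \<in> carrier X" unfolding n0_def by (rule closed) (use C n1 in auto)
  \<comment> \<open>The inserted crossing leads from \<open>n1\<close>, \<open>n0\<close> to
    \<open>x1\<close>, \<open>x0\<close>; the strands are listed in the opposite order here.\<close>
  have "clasp True True (tri_u X) (tri_o X) (dot_o X) (dot_u X) n1 x1 m1 n0 x0 m0"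
    using m n0_def n1 by (simp add: clasp_def oriented_rule_def crossing_rule_def)
  then obtain p0 p1 where p: "p0 \<in> carrier X" "p1 \<in> carrier X" and
      pc: "clasp True True (dot_u X) (dot_o X) (tri_o X) (tri_u X) n1 p0 m1 n0 p1 m0"
    using parallel_exchange[of n1 x1 m1 n0 x0 m0] C n0 n1 by blast
  then have q: "p0 = n1 \<bullet>\<^sub>u p1" "n0 = p1 \<bullet>\<^sub>o n1" "p0 = m1 \<triangleright>\<^sub>o p1" "m0 = p1 \<triangleright>\<^sub>u m1"
    by (auto simp: clasp_def oriented_rule_def crossing_rule_def)
  have "p1 = w0" by (rule cl.right_cancel(1)[of _ m1]) (use q m p C in auto)
  then have "clasp True True (tri_o X) (tri_u X) (dot_o X) (dot_u X) x0 n0 w0 x1 n1 w1"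
    using q m n1 n0_def by (simp add: clasp_def oriented_rule_def crossing_rule_def)
  then show ?thesis using n0 n1 by blast
qed

lemma parallel_exchange_forward:
  assumes C: "{x0, m0, w0, x1, m1, w1} \<subseteq> carrier X"
    and tris: "(fc, hc) \<in> {(tri_u X, tri_o X), (tri_o X, tri_u X)}"
    and c: "clasp True True (dot_u X) (dot_o X) fc hc x0 m0 w0 x1 m1 w1"
  shows "\<exists>n0\<in>carrier X. \<exists>n1\<in>carrier X. clasp True True hc fc (dot_o X) (dot_u X) x0 n0 w0 x1 n1 w1"
proof -
  consider "fc = tri_u X" "hc = tri_o X" | "fc = tri_o X" "hc = tri_u X" using tris by blast
  then show ?thesis
  proof cases
    case 1 show ?thesis using parallel_exchange'[OF C c[unfolded 1]] unfolding 1 .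
  next
    \<comment> \<open>This choice of the over-strand is axiom (iv) read backwards.\<close>
    case 2 show ?thesis unfolding 2
      by (rule clasp_converse[OF classical_ops si.flipped singular_ops cl.flipped
            parallel_exchange C c[unfolded 2]])
  qed
qed

text \<open>If \<open>e\<close> holds, the middle labels are computed from the end labels, and the
  new ones can be written down. Otherwise the end labels are computed from the middle ones; the new
  middle labels come from inverting the switch, and the antiparallel law is applied to middle
  instead of end labels.\<close>

lemma antiparallel_exchange_forward:
  assumes fin: "finite (carrier X)" and C: "{x0, m0, w0, x1, m1, w1} \<subseteq> carrier X"
    and dots: "(fs, hs) = (if e then (dot_u X, dot_o X) else (dot_o X, dot_u X))"
    and tris: "(fc, hc) \<in> {(tri_u X, tri_o X), (tri_o X, tri_u X)}"
    and c: "clasp False e fs hs fc hc x0 m0 w0 x1 m1 w1"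
  shows "\<exists>n0\<in>carrier X. \<exists>n1\<in>carrier X. clasp False e hc fc hs fs x0 n0 w0 x1 n1 w1"
proof (cases e)
  case True
  have [simp]: "fs = dot_u X" "hs = dot_o X" using dots True by auto
  have m: "x0 \<bullet>\<^sub>u w1 = fc w0 x1" "w1 \<bullet>\<^sub>o x0 = hc x1 w0"
    using c True by (auto simp: clasp_def oriented_rule_def crossing_rule_def)
  consider "fc = tri_u X" "hc = tri_o X" | "fc = tri_o X" "hc = tri_u X" using tris by blast
  then have n: "w0 \<bullet>\<^sub>o x1 = hc x0 w1 \<and> x1 \<bullet>\<^sub>u w0 = fc w1 x0"
  proof cases
    case 1 show ?thesis unfolding 1
      by (rule antiparallel_exchange'[OF fin _ _ _ _ m[unfolded 1, symmetric]]) (use C in simp_all)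
  next
    case 2 show ?thesis unfolding 2
      by (rule antiparallel_exchange[OF fin _ _ _ _ m[unfolded 2, symmetric]]) (use C in simp_all)
  qed
  have inC: "w0 \<bullet>\<^sub>o x1 \<in> carrier X" "x1 \<bullet>\<^sub>u w0 \<in> carrier X" using C closed by auto
  have "clasp False e hc fc hs fs x0 (w0 \<bullet>\<^sub>o x1) w0 x1 (x1 \<bullet>\<^sub>u w0) w1"
    using n True by (simp add: clasp_def oriented_rule_def crossing_rule_def)
  then show ?thesis using inC by blast
next
  case False
  have [simp]: "fs = dot_o X" "hs = dot_u X" using dots False by auto
  have m: "x0 = m0 \<bullet>\<^sub>o m1" "w1 = m1 \<bullet>\<^sub>u m0" "w0 = fc m0 m1" "x1 = hc m1 m0"
    using c False by (simp_all add: clasp_def oriented_rule_def crossing_rule_def)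
  have ops: "crossing_ops (carrier X) hc fc" using tris classical_ops cl.flipped by auto
  obtain n0 n1 where nC: "n0 \<in> carrier X" "n1 \<in> carrier X" and n: "hc n0 n1 = x0" "fc n1 n0 = w1"
    using crossing_ops.switch_solve[OF ops, of x0 w1] C by auto
  consider "fc = tri_u X" "hc = tri_o X" | "fc = tri_o X" "hc = tri_u X" using tris by blast
  then have n': "n1 \<bullet>\<^sub>o n0 = hc m1 m0 \<and> n0 \<bullet>\<^sub>u n1 = fc m0 m1"
  proof cases
    case 1
    have "n1 \<triangleright>\<^sub>u n0 = m1 \<bullet>\<^sub>u m0" "n0 \<triangleright>\<^sub>o n1 = m0 \<bullet>\<^sub>o m1" using n[unfolded 1] m(1,2) by argo+
    from antiparallel_exchange'[OF fin _ _ nC this] show ?thesis unfolding 1 using C by simp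
  next
    case 2
    have "n1 \<triangleright>\<^sub>o n0 = m1 \<bullet>\<^sub>u m0" "n0 \<triangleright>\<^sub>u n1 = m0 \<bullet>\<^sub>o m1" using n[unfolded 2] m(1,2) by argo+
    from antiparallel_exchange[OF fin _ _ nC this] show ?thesis unfolding 2 using C by simp
  qed
  have "clasp False e hc fc hs fs x0 n0 w0 x1 n1 w1"
    using n n'[folded m(3,4)] False by (simp add: clasp_def oriented_rule_def crossing_rule_def)
  then show ?thesis using nC by blast
qed

lemma exchange_forward:
  assumes fin: "finite (carrier X)" and C: "{x0, m0, w0, x1, m1, w1} \<subseteq> carrier X"
    and dots: "(fs, hs) = (if e then (dot_u X, dot_o X) else (dot_o X, dot_u X))"
    and tris: "(fc, hc) \<in> {(tri_u X, tri_o X), (tri_o X, tri_u X)}"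
    and c: "clasp par e fs hs fc hc x0 m0 w0 x1 m1 w1"
  shows "\<exists>n0\<in>carrier X. \<exists>n1\<in>carrier X. clasp par e hc fc hs fs x0 n0 w0 x1 n1 w1"
proof (cases par)
  case False
  then show ?thesis using antiparallel_exchange_forward[OF fin C dots tris] c by simp
next
  case True
  show ?thesis
  proof (cases e)
    case True
    then show ?thesis using parallel_exchange_forward[OF C tris] c dots \<open>par\<close> by simp
  next
    case False
    have C': "{x1, m1, w1, x0, m0, w0} \<subseteq> carrier X" using C by auto
    have tris': "(hc, fc) \<in> {(tri_u X, tri_o X), (tri_o X, tri_u X)}" using tris by blast
    have d: "fs = dot_o X" "hs = dot_u X" using dots False by auto
    \<comment> \<open>Renumbering the parallel strands negates \<open>e\<close> and leads back to
      the case treated above.\<close>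
    have "clasp True True (dot_u X) (dot_o X) hc fc x1 m1 w1 x0 m0 w0"
      using c \<open>par\<close> False unfolding d by (subst clasp_parallel_commute) simp
    from parallel_exchange_forward[OF C' tris' this]
    obtain n0 n1 where "n0 \<in> carrier X" "n1 \<in> carrier X"
      "clasp True True fc hc (dot_o X) (dot_u X) x1 n1 w1 x0 n0 w0" by blast
    moreover from this(3) have "clasp par e hc fc hs fs x0 n0 w0 x1 n1 w1"
      using \<open>par\<close> False unfolding d by (subst (asm) clasp_parallel_commute) simp
    ultimately show ?thesis by blast
  qed
qed

lemma exchange_backward:
  assumes fin: "finite (carrier X)" and C: "{x0, n0, w0, x1, n1, w1} \<subseteq> carrier X"
    and dots: "(fs, hs) = (if e then (dot_u X, dot_o X) else (dot_o X, dot_u X))"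
    and tris: "(fc, hc) \<in> {(tri_u X, tri_o X), (tri_o X, tri_u X)}"
    and c: "clasp par e hc fc hs fs x0 n0 w0 x1 n1 w1"
  shows "\<exists>m0\<in>carrier X. \<exists>m1\<in>carrier X. clasp par e fs hs fc hc x0 m0 w0 x1 m1 w1"
proof (rule clasp_converse[OF _ _ _ _ exchange_forward[OF fin _ dots tris] C c])
  show "crossing_ops (carrier X) fs hs" "crossing_ops (carrier X) hs fs"
    using dots singular_ops si.flipped by (auto split: if_splits)
  show "crossing_ops (carrier X) fc hc" "crossing_ops (carrier X) hc fc"
    using tris classical_ops cl.flipped by auto
qed

text \<open>In one kind of kink the outer labels are the two diagonal values of the middle label,
  which agree by axiom (i). In the other kind the middle label is computed from both outer ones;
  comparing with its diagonal preimage under the switch forces these to coincide.\<close>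

lemma kink:
  assumes fin: "finite (carrier X)" and C: "{x, m, w} \<subseteq> carrier X"
    and tris: "(f, h) \<in> {(tri_u X, tri_o X), (tri_o X, tri_u X)}"
    and r: "oriented_rule e f h x m m w"
  shows "x = w"
proof -
  have ops: "crossing_ops (carrier X) f h" using tris classical_ops cl.flipped by auto
  show ?thesis
  proof (cases e)
    case True
    then have m: "m = f x w \<and> m = h w x"
      using r unfolding oriented_rule_def crossing_rule_def by argo
    have mC: "m \<in> carrier X" using C by simp
    obtain y where y: "y \<in> carrier X" "y \<triangleright>\<^sub>u y = m" "y \<triangleright>\<^sub>o y = m"
      by (rule diagonal_solve[OF fin mC])
    have "f y y = m \<and> h y y = m" using tris y(2,3) by blast
    then have "f x w = f y y" "h w x = h y y" using m by argo+
    then have "x = y \<and> w = y"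
      by (rule crossing_ops.switch_cancel[OF ops]) (use y(1) C in simp_all)
    then show ?thesis by blast
  next
    case False
    then have m: "x = f m m \<and> w = h m m"
      using r unfolding oriented_rule_def crossing_rule_def by argo
    have "m \<triangleright>\<^sub>u m = m \<triangleright>\<^sub>o m" using C by (intro diagonal) simp
    then have "f m m = h m m" using tris by fastforce
    then show ?thesis using m by argo
  qed
qed

lemma kink_exists:
  assumes fin: "finite (carrier X)" and x: "x \<in> carrier X"
    and tris: "(f, h) \<in> {(tri_u X, tri_o X), (tri_o X, tri_u X)}"
  shows "\<exists>m\<in>carrier X. oriented_rule e f h x m m x"
proof (cases e)
  case True
  have "f x x = h x x" using tris diagonal[OF x] by fastforce
  then have "oriented_rule e f h x (f x x) (f x x) x"
    using True unfolding oriented_rule_def crossing_rule_def by argo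
  moreover have "f x x \<in> carrier X" using tris closed(1,2)[OF x x] by fastforce
  ultimately show ?thesis by blast
next
  case False
  obtain y where y: "y \<in> carrier X" "y \<triangleright>\<^sub>u y = x" "y \<triangleright>\<^sub>o y = x"
    by (rule diagonal_solve[OF fin x])
  have "f y y = x" "h y y = x" using tris y(2,3) by blast+
  then have "oriented_rule e f h x y y x"
    using False by (simp add: oriented_rule_def crossing_rule_def)
  then show ?thesis using y(1) by blast
qed

end

section \<open>Triangles described by order and direction of their crossings\<close>

context triangle_ops begin

text \<open>\<open>fst_at i j\<close> says that strand \<open>i\<close> meets strand
  \<open>j\<close> before the remaining strand; \<open>x\<close>, \<open>m\<close>, \<open>w\<close>
  label the start of each strand, the side of the triangle on it, and its end.\<close>

definition triangle_rules :: "(nat \<Rightarrow> nat \<Rightarrow> bool) \<Rightarrow> (nat \<Rightarrow> nat \<Rightarrow> bool) \<Rightarrow>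
    (nat \<Rightarrow> 'a) \<Rightarrow> (nat \<Rightarrow> 'a) \<Rightarrow> (nat \<Rightarrow> 'a) \<Rightarrow> bool" where
  "triangle_rules e fst_at x m w \<longleftrightarrow> (\<forall>(i, j) \<in> {(0, 1), (0, 2), (1, 2)}.
     oriented_rule (e i j) (f i j) (f j i)
       (if fst_at i j then x i else m i) (if fst_at i j then m i else w i)
       (if fst_at j i then x j else m j) (if fst_at j i then m j else w j))"

text \<open>Translates time into sides: \<open>s\<close> and \<open>s'\<close> say that the middle
  piece of the respective strand is its left piece at this crossing. Beyond that, orientation only
  decides which end label, \<open>x\<close> or \<open>w\<close>, is on the other side.\<close>

lemma oriented_rule_by_side:
  "oriented_rule e g h (if F then x else m) (if F then m else w) (if F' then x' else m') (if F' then m' else w')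
   \<longleftrightarrow> (let n = (if F then x else w); n' = (if F' then x' else w'); s = (F \<noteq> e); s' = (F' = e) in
     crossing_rule g h (if s then m else n) (if s then n else m) (if s' then m' else n') (if s' then n' else m'))"
  by (cases e; cases F; cases F') (simp_all add: oriented_rule_def Let_def)

lemma triangle_rules_unfold:
  "triangle_rules e F x m w \<longleftrightarrow>
     oriented_rule (e 0 1) (f 0 1) (f 1 0) (if F 0 1 then x 0 else m 0) (if F 0 1 then m 0 else w 0)
       (if F 1 0 then x 1 else m 1) (if F 1 0 then m 1 else w 1) \<and>
     oriented_rule (e 0 2) (f 0 2) (f 2 0) (if F 0 2 then x 0 else m 0) (if F 0 2 then m 0 else w 0)
       (if F 2 0 then x 2 else m 2) (if F 2 0 then m 2 else w 2) \<and>
     oriented_rule (e 1 2) (f 1 2) (f 2 1) (if F 1 2 then x 1 else m 1) (if F 1 2 then m 1 else w 1)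
       (if F 2 1 then x 2 else m 2) (if F 2 1 then m 2 else w 2)"
  by (simp add: triangle_rules_def del: One_nat_def split del: if_split)

text \<open>The sides of the triangle are the three edges of the cube at the vertex
  \<open>(s0, s1, s2)\<close>. Each of these parameters is given twice because it can be read off at
  two crossings.\<close>

lemma triangle_rules_iff_half_cube:
  assumes e: "e 1 0 = (\<not> e 0 1)" "e 2 0 = (\<not> e 0 2)" "e 2 1 = (\<not> e 1 2)"
    and F: "F 0 2 = (\<not> F 0 1)" "F 1 2 = (\<not> F 1 0)" "F 2 1 = (\<not> F 2 0)"
    and s: "s0 = (F 1 2 = e 1 0)" "s0 = (F 2 1 = e 2 0)" "s1 = (F 0 2 = e 0 1)" "s1 = (F 2 0 = e 2 1)"
      "s2 = (F 0 1 = e 0 2)" "s2 = (F 1 0 = e 1 2)"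
    and P: "P s1 s2 = m 0" "P (\<not> s1) s2 = (if F 0 1 then x 0 else w 0)" "P s1 (\<not> s2) = (if F 0 2 then x 0 else w 0)"
    and Q: "Q s0 s2 = m 1" "Q (\<not> s0) s2 = (if F 1 0 then x 1 else w 1)" "Q s0 (\<not> s2) = (if F 1 2 then x 1 else w 1)"
    and R: "R s0 s1 = m 2" "R (\<not> s0) s1 = (if F 2 0 then x 2 else w 2)" "R s0 (\<not> s1) = (if F 2 1 then x 2 else w 2)"
  shows "triangle_rules e F x m w \<longleftrightarrow> half_cube s0 s1 s2 P Q R"
proof -
  have val: "G True = (if s then G s else G (\<not> s))" "G False = (if s then G (\<not> s) else G s)"
    for G :: "bool \<Rightarrow> 'a" and s by auto
  have sides: "(F 0 1 \<noteq> e 0 1) = s1" "(F 1 0 = e 0 1) = s0" "(F 0 2 \<noteq> e 0 2) = s2"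
    "(F 2 0 = e 0 2) = s0" "(F 1 2 \<noteq> e 1 2) = s2" "(F 2 1 = e 1 2) = s1"
    apply (simp only: s(3) F(1), blast)
    apply (simp only: s(1) F(2) e(1), blast)
    apply (simp only: s(5) F(1), blast)
    apply (simp only: s(2) F(3) e(2), blast)
    apply (simp only: s(6) F(2), blast)
    by (simp only: s(4) F(3) e(3), blast)
  have "triangle_rules e F x m w \<longleftrightarrow>
    crossing_rule (f 0 1) (f 1 0) (if s1 then P s1 s2 else P (\<not> s1) s2) (if s1 then P (\<not> s1) s2 else P s1 s2)
      (if s0 then Q s0 s2 else Q (\<not> s0) s2) (if s0 then Q (\<not> s0) s2 else Q s0 s2) \<and>
    crossing_rule (f 0 2) (f 2 0) (if s2 then P s1 s2 else P s1 (\<not> s2)) (if s2 then P s1 (\<not> s2) else P s1 s2)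
      (if s0 then R s0 s1 else R (\<not> s0) s1) (if s0 then R (\<not> s0) s1 else R s0 s1) \<and>
    crossing_rule (f 1 2) (f 2 1) (if s2 then Q s0 s2 else Q s0 (\<not> s2)) (if s2 then Q s0 (\<not> s2) else Q s0 s2)
      (if s1 then R s0 s1 else R s0 (\<not> s1)) (if s1 then R s0 (\<not> s1) else R s0 s1)"
    unfolding triangle_rules_unfold oriented_rule_by_side Let_def P Q R sides by (rule refl)
  also have "\<dots> \<longleftrightarrow> half_cube s0 s1 s2 P Q R"
    unfolding half_cube_def by (cases s0; cases s1; cases s2) simp_all
  finally show ?thesis .
qed

text \<open>The hypotheses \<open>coherent\<close> say that the two crossings on a strand agree
  about the side on which the triangle lies. The given labels form the half cube at one vertex; its
  extension is read off at the opposite vertex, where every strand meets the other two in reverse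
  order with the same end labels.\<close>

lemma triangle_move:
  assumes e: "e 1 0 = (\<not> e 0 1)" "e 2 0 = (\<not> e 0 2)" "e 2 1 = (\<not> e 1 2)"
    and F: "F 0 2 = (\<not> F 0 1)" "F 1 2 = (\<not> F 1 0)" "F 2 1 = (\<not> F 2 0)"
    and coherent: "(F 0 1 = e 0 2) = (F 1 0 = e 1 2)" "(F 0 2 = e 0 1) = (F 2 0 = e 2 1)"
      "(F 1 2 = e 1 0) = (F 2 1 = e 2 0)"
    and A: "\<forall>i<3. x i \<in> A \<and> m i \<in> A \<and> w i \<in> A"
    and r: "triangle_rules e F x m w"
  shows "\<exists>m'. (\<forall>i<3. m' i \<in> A) \<and> triangle_rules e (\<lambda>i j. \<not> F i j) x m' w"
proof -
  define s0 s1 s2 where s: "s0 = (F 1 2 = e 1 0)" "s1 = (F 0 2 = e 0 1)" "s2 = (F 0 1 = e 0 2)"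
  have s': "s0 = (F 2 1 = e 2 0)" "s1 = (F 2 0 = e 2 1)" "s2 = (F 1 0 = e 1 2)"
    using s coherent by blast+
  \<comment> \<open>The fourth value belongs to the other half only and is free; the label
    \<open>m\<close> fills it to stay in the carrier.\<close>
  define P where "P = (\<lambda>a b. if a \<noteq> s1 \<and> b = s2 then (if F 0 1 then x 0 else w 0)
    else if a = s1 \<and> b \<noteq> s2 then (if F 0 2 then x 0 else w 0) else m 0)"
  define Q where "Q = (\<lambda>a b. if a \<noteq> s0 \<and> b = s2 then (if F 1 0 then x 1 else w 1)
    else if a = s0 \<and> b \<noteq> s2 then (if F 1 2 then x 1 else w 1) else m 1)"
  define R where "R = (\<lambda>a b. if a \<noteq> s0 \<and> b = s1 then (if F 2 0 then x 2 else w 2)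
    else if a = s0 \<and> b \<noteq> s1 then (if F 2 1 then x 2 else w 2) else m 2)"
  have P: "P s1 s2 = m 0" "P (\<not> s1) s2 = (if F 0 1 then x 0 else w 0)" "P s1 (\<not> s2) = (if F 0 2 then x 0 else w 0)"
    and Q: "Q s0 s2 = m 1" "Q (\<not> s0) s2 = (if F 1 0 then x 1 else w 1)" "Q s0 (\<not> s2) = (if F 1 2 then x 1 else w 1)"
    and R: "R s0 s1 = m 2" "R (\<not> s0) s1 = (if F 2 0 then x 2 else w 2)" "R s0 (\<not> s1) = (if F 2 1 then x 2 else w 2)"
    unfolding P_def Q_def R_def by simp_all
  have inA: "labels_in P" "labels_in Q" "labels_in R"
    using A unfolding labels_in_def P_def Q_def R_def by auto
  have "half_cube s0 s1 s2 P Q R"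
    by (rule triangle_rules_iff_half_cube[THEN iffD1, OF e F s(1) s'(1) s(2) s'(2) s(3) s'(3) P Q R r])
  from cube_extends[OF this inA]
  obtain P' Q' R' where inA': "labels_in P'" "labels_in Q'" "labels_in R'"
    and half: "half_cube (\<not> s0) (\<not> s1) (\<not> s2) P' Q' R'"
    and ag: "agree s1 s2 P P'" "agree s0 s2 Q Q'" "agree s0 s1 R R'" by blast
  \<comment> \<open>The new sides of the triangle are the edges at the opposite vertex.\<close>
  define m' where "m' = (\<lambda>i::nat. if i = 0 then P' (\<not> s1) (\<not> s2) else if i = 1 then Q' (\<not> s0) (\<not> s2)
    else R' (\<not> s0) (\<not> s1))"
  have "triangle_rules e (\<lambda>i j. \<not> F i j) x m' w"
  proof (rule triangle_rules_iff_half_cube[THEN iffD2, OF e _ _ _ _ _ _ _ _ _ _ _ _ _ _ _ _ _ _ half])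
    show "P' (\<not> s1) (\<not> s2) = m' 0" "Q' (\<not> s0) (\<not> s2) = m' 1" "R' (\<not> s0) (\<not> s1) = m' 2"
      by (simp_all add: m'_def)
    show "P' (\<not> \<not> s1) (\<not> s2) = (if \<not> F 0 1 then x 0 else w 0)"
      "P' (\<not> s1) (\<not> \<not> s2) = (if \<not> F 0 2 then x 0 else w 0)"
      "Q' (\<not> \<not> s0) (\<not> s2) = (if \<not> F 1 0 then x 1 else w 1)"
      "Q' (\<not> s0) (\<not> \<not> s2) = (if \<not> F 1 2 then x 1 else w 1)"
      "R' (\<not> \<not> s0) (\<not> s1) = (if \<not> F 2 0 then x 2 else w 2)"
      "R' (\<not> s0) (\<not> \<not> s1) = (if \<not> F 2 1 then x 2 else w 2)"
      using ag P Q R F unfolding agree_def by simp_all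
  qed (use F s s' in blast)+
  moreover have "\<forall>i<3. m' i \<in> A" using inA' by (simp add: m'_def labels_in_def)
  ultimately show ?thesis by blast
qed

text \<open>At each crossing every strand has an end label on one side, so determinacy applies to
  each crossing separately.\<close>

lemma triangle_rules_unique:
  assumes A: "\<forall>i<3. x i \<in> A \<and> m i \<in> A \<and> w i \<in> A \<and> m' i \<in> A"
    and r: "triangle_rules e F x m w" "triangle_rules e F x m' w"
  shows "\<forall>i<3. m i = m' i"
proof -
  have *: "m i = m' i \<and> m j = m' j" if "(i, j) \<in> {(0, 1), (0, 2), (1, 2)}" for i j
  proof -
    have ij: "i < 3" "j < 3" "i \<noteq> j" using that by auto
    have r': "oriented_rule (e i j) (f i j) (f j i)
       (if F i j then x i else m i) (if F i j then m i else w i)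
       (if F j i then x j else m j) (if F j i then m j else w j)"
      "oriented_rule (e i j) (f i j) (f j i)
       (if F i j then x i else m' i) (if F i j then m' i else w i)
       (if F j i then x j else m' j) (if F j i then m' j else w j)"
      using r that unfolding triangle_rules_def by blast+
    have "(if F i j then m i else w i) = (if F i j then m' i else w i) \<and>
      (if F i j then x i else m i) = (if F i j then x i else m' i) \<and>
      (if F j i then m j else w j) = (if F j i then m' j else w j) \<and>
      (if F j i then x j else m j) = (if F j i then x j else m' j)"
      by (rule crossing_ops.rule_unique[OF ops[OF ij] r']) (use A ij in simp_all)
    then show ?thesis by (cases "F i j"; cases "F j i") simp_all
  qed
  have "m 0 = m' 0 \<and> m 1 = m' 1" "m 0 = m' 0 \<and> m 2 = m' 2" by (rule *; simp)+
  then show ?thesis by (auto simp: less_Suc_eq numeral_3_eq_3 numeral_2_eq_2)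
qed

end

lemma index_cases:
  fixes i j k :: nat
  assumes "i < 3" "j < 3" "k < 3" "distinct [i, j, k]"
  shows "(i, j, k) \<in> {(0, 1, 2), (0, 2, 1), (1, 0, 2), (1, 2, 0), (2, 0, 1), (2, 1, 0)}"
proof -
  have "i \<in> {0, 1, 2}" "j \<in> {0, 1, 2}" "k \<in> {0, 1, 2}" using assms by auto
  then show ?thesis using assms(4) by (elim insertE emptyE) simp_all
qed

context psyquandle begin

text \<open>Strands are numbered from top to bottom, as in \<open>move_III\<close>, so
  \<open>i\<close> passes over \<open>j\<close> iff \<open>i < j\<close>. The exchange axioms (iii),
  read in both directions, cover the six orderings.\<close>

lemma triangle_ops_classical: "triangle_ops (carrier X) (\<lambda>i j. if i < j then tri_o X else tri_u X)"
proof (rule triangle_ops.intro)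
  fix i j k :: nat and x y z
  assume "i < 3" "j < 3" "i \<noteq> j"
  then show "crossing_ops (carrier X) (if i < j then tri_o X else tri_u X) (if j < i then tri_o X else tri_u X)"
    using classical_ops cl.flipped by auto
next
  fix i j k :: nat and x y z
  assume ijk: "i < 3" "j < 3" "k < 3" "distinct [i, j, k]"
    and C: "x \<in> carrier X" "y \<in> carrier X" "z \<in> carrier X"
  have "(i, j, k) \<in> {(0, 1, 2), (0, 2, 1), (1, 0, 2), (1, 2, 0), (2, 0, 1), (2, 1, 0)}"
    by (rule index_cases[OF ijk])
  then show "(if i < k then tri_o X else tri_u X) ((if i < j then tri_o X else tri_u X) x y)
        ((if k < j then tri_o X else tri_u X) z y) =
      (if i < j then tri_o X else tri_u X) ((if i < k then tri_o X else tri_u X) x z)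
        ((if j < k then tri_o X else tri_u X) y z)"
    by - (elim insertE emptyE; clarsimp;
        rule exchange_classical[OF C] exchange_classical[OF C(1,3,2), symmetric])
qed

text \<open>Strands 0 and 1 meet singularly, with \<open>e\<close> telling which of them takes the
  underlined operation; strand 2 passes over or under both. The exchange laws needed are those of
  axiom (v).\<close>

lemma triangle_ops_slide:
  fixes e over
  defines "f \<equiv> (\<lambda>i j :: nat.
    if i = 2 then (if over then tri_o X else tri_u X) else if j = 2 then (if over then tri_u X else tri_o X)
    else if (i < j) = e then dot_u X else dot_o X)"
  shows "triangle_ops (carrier X) f"
proof (rule triangle_ops.intro)
  fix i j k :: nat and x y z
  assume "i < 3" "j < 3" "i \<noteq> j"
  then show "crossing_ops (carrier X) (f i j) (f j i)"
    using classical_ops cl.flipped singular_ops si.flipped unfolding f_def by (auto simp: not_less)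
next
  fix i j k :: nat and x y z
  assume ijk: "i < 3" "j < 3" "k < 3" "distinct [i, j, k]"
    and C: "x \<in> carrier X" "y \<in> carrier X" "z \<in> carrier X"
  have "(i, j, k) \<in> {(0, 1, 2), (0, 2, 1), (1, 0, 2), (1, 2, 0), (2, 0, 1), (2, 1, 0)}"
    by (rule index_cases[OF ijk])
  then show "f i k (f i j x y) (f k j z y) = f i j (f i k x z) (f j k y z)"
    unfolding f_def
    by - (elim insertE emptyE; cases over; cases e; clarsimp;
        rule exchange_mixed[OF C] exchange_mixed[OF C(1,3,2), symmetric])
qed

end

section \<open>Colorings as functions of the parameters\<close>

definition crossing_param :: "singular_diagram \<Rightarrow> nat \<times> real \<Rightarrow> bool" where
  "crossing_param D p \<longleftrightarrow> (\<exists>q. crosses D p q)"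

definition strand_op :: "('a, 'm) psyquandle_scheme \<Rightarrow> singular_diagram \<Rightarrow>
    nat \<times> real \<Rightarrow> nat \<times> real \<Rightarrow> 'a \<Rightarrow> 'a \<Rightarrow> 'a" where
  "strand_op X D p q =
     (if pt D p \<in> sing D then (if 0 < turn D p q then dot_u X else dot_o X)
      else if p \<in> over D then tri_o X else tri_u X)"

text \<open>A limit in the discrete sense, without a topology on the labels. Left and right limits
  take the place of \<open>semiarc_before\<close> and \<open>semiarc_after\<close>.\<close>

definition left_limit :: "(nat \<times> real \<Rightarrow> 'a) \<Rightarrow> nat \<times> real \<Rightarrow> 'a" where
  "left_limit g p = (THE v. \<forall>\<^sub>F t in at_left (snd p). g (fst p, t) = v)"

definition right_limit :: "(nat \<times> real \<Rightarrow> 'a) \<Rightarrow> nat \<times> real \<Rightarrow> 'a" where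
  "right_limit g p = (THE v. \<forall>\<^sub>F t in at_right (snd p). g (fst p, t) = v)"

lemma left_limitI: "\<forall>\<^sub>F t in at_left (snd p). g (fst p, t) = v \<Longrightarrow> left_limit g p = v"
  unfolding left_limit_def
proof (rule the_equality)
  fix v' assume "\<forall>\<^sub>F t in at_left (snd p). g (fst p, t) = v" "\<forall>\<^sub>F t in at_left (snd p). g (fst p, t) = v'"
  then have "\<forall>\<^sub>F t in at_left (snd p). v' = v" by eventually_elim simp
  then show "v' = v" by simp
qed

lemma right_limitI: "\<forall>\<^sub>F t in at_right (snd p). g (fst p, t) = v \<Longrightarrow> right_limit g p = v"
  unfolding right_limit_def
proof (rule the_equality)
  fix v' assume "\<forall>\<^sub>F t in at_right (snd p). g (fst p, t) = v" "\<forall>\<^sub>F t in at_right (snd p). g (fst p, t) = v'"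
  then have "\<forall>\<^sub>F t in at_right (snd p). v' = v" by eventually_elim simp
  then show "v' = v" by simp
qed

definition rule_at :: "('a, 'm) psyquandle_scheme \<Rightarrow> singular_diagram \<Rightarrow>
    (nat \<times> real \<Rightarrow> 'a) \<Rightarrow> nat \<times> real \<Rightarrow> nat \<times> real \<Rightarrow> bool" where
  "rule_at X D g p q \<longleftrightarrow>
     oriented_rule (0 < turn D p q) (strand_op X D p q) (strand_op X D q p)
       (left_limit g p) (right_limit g p) (left_limit g q) (right_limit g q)"

text \<open>The value \<open>undefined\<close> off the domain makes such functions determined by
  their labels, as bijections between sets of them require. The rule ranges over all ordered
  crossing pairs, so that no strand has to be singled out.\<close>

definition param_colorings ::
    "('a, 'm) psyquandle_scheme \<Rightarrow> singular_diagram \<Rightarrow> (nat \<times> real \<Rightarrow> 'a) set" where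
  "param_colorings X D = {g.
     (\<forall>p. if p \<in> params D \<and> \<not> crossing_param D p then g p \<in> carrier X else g p = undefined) \<and>
     (\<forall>i t. g (i, t + 1) = g (i, t)) \<and>
     (\<forall>p\<in>params D. \<not> crossing_param D p \<longrightarrow> (\<forall>\<^sub>F t in at (snd p). g (fst p, t) = g p)) \<and>
     (\<forall>p q. crosses D p q \<longrightarrow> rule_at X D g p q)}"

lemma same_param_refl [simp]: "same_param p p"
  by (simp add: same_param_def)

lemma same_param_sym: "same_param p q \<Longrightarrow> same_param q p"
  unfolding same_param_def using Ints_minus[of "snd p - snd q"] by simp

lemma same_param_trans: "same_param p q \<Longrightarrow> same_param q r \<Longrightarrow> same_param p r"
  unfolding same_param_def using Ints_add[of "snd p - snd q" "snd q - snd r"] by simp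

lemma same_param_shift [simp]: "same_param (i, t + of_int m) (i, t)" "same_param (i, t) (i, t + of_int m)"
  by (simp_all add: same_param_def)

lemma same_paramE:
  assumes "same_param p q"
  obtains m :: int where "p = (fst q, snd q + of_int m)"
  using assms unfolding same_param_def by (metis Ints_cases add.commute diff_add_cancel prod.collapse)

lemma periodic_shift:
  fixes g :: "nat \<times> real \<Rightarrow> 'a"
  assumes "\<And>t. g (i, t + 1) = g (i, t)"
  shows "g (i, t + of_int m) = g (i, t)"
proof (induction m arbitrary: t rule: int_induct[where k=0])
  case (step1 k)
  have "g (i, t + of_int (k + 1)) = g (i, (t + of_int k) + 1)" by (simp add: algebra_simps)
  then show ?case using assms[of "t + of_int k"] step1(2)[of t] by simp
next
  case (step2 k)
  have "g (i, t + of_int (k - 1) + 1) = g (i, t + of_int k)" by (simp add: algebra_simps)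
  then show ?case using assms[of "t + of_int (k - 1)"] step2(2)[of t] by simp
qed simp

lemma param_colorings_shift:
  assumes "g \<in> param_colorings X D" "same_param p q"
  shows "g p = g q"
  using assms(2)
  by (rule same_paramE) (use periodic_shift[of g] assms(1) in \<open>auto simp: param_colorings_def\<close>)

lemma param_colorings_undefined:
  "g \<in> param_colorings X D \<Longrightarrow> \<not> (p \<in> params D \<and> \<not> crossing_param D p) \<Longrightarrow> g p = undefined"
proof -
  assume "g \<in> param_colorings X D" and p: "\<not> (p \<in> params D \<and> \<not> crossing_param D p)"
  then have "if p \<in> params D \<and> \<not> crossing_param D p then g p \<in> carrier X else g p = undefined"
    unfolding param_colorings_def by blast
  then show "g p = undefined" using p by simp
qed

lemma param_colorings_rule: "g \<in> param_colorings X D \<Longrightarrow> crosses D p q \<Longrightarrow> rule_at X D g p q"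
  unfolding param_colorings_def by blast

lemma params_iff: "p \<in> params D \<longleftrightarrow> fst p < ncomp D"
  by (cases p) (auto simp: params_def)

lemma crosses_commute: "crosses D p q \<Longrightarrow> crosses D q p"
  using same_param_sym[of q p] by (auto simp: crosses_def)

lemma turn_commute: "turn D q p = - turn D p q"
  by (simp add: turn_def sgn_if algebra_simps)

section \<open>Diagrams: periodicity, uniqueness of partners, isolated crossings\<close>

locale diagram =
  fixes D :: singular_diagram
  assumes diagram: "is_singular_diagram D"
begin

lemma C1: "i < ncomp D \<Longrightarrow> curve D i C1_differentiable_on UNIV"
  using diagram by (simp add: is_singular_diagram_def)

lemma differentiable: "i < ncomp D \<Longrightarrow> curve D i differentiable at t"
  using C1_differentiable_on_eq[THEN iffD1, OF C1] by blast

lemma has_tangent: "i < ncomp D \<Longrightarrow> (curve D i has_vector_derivative tangent D (i, t)) (at t)"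
  unfolding tangent_def using differentiable vector_derivative_works by fastforce

lemma continuous: "i < ncomp D \<Longrightarrow> continuous_on S (curve D i)"
  by (intro continuous_at_imp_continuous_on ballI) (rule has_vector_derivative_continuous[OF has_tangent])

lemma pt_same_param: "p \<in> params D \<Longrightarrow> same_param p q \<Longrightarrow> pt D p = pt D q"
proof (erule same_paramE)
  fix m assume "p \<in> params D" and p: "p = (fst q, snd q + of_int m)"
  then have i: "fst q < ncomp D" by (simp add: params_iff)
  have "curve D (fst q) (t + 1) = curve D (fst q) t" for t
    using diagram i unfolding is_singular_diagram_def by blast
  then have "pt D (fst q, t + 1) = pt D (fst q, t)" for t by (simp only: pt_def fst_conv snd_conv)
  from periodic_shift[of "pt D", OF this, of "snd q" m] show "pt D p = pt D q"
    unfolding p prod.collapse .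
qed

lemma same_param_params: "same_param p q \<Longrightarrow> p \<in> params D \<longleftrightarrow> q \<in> params D"
  by (simp add: params_iff same_param_def)

lemma tangent_same_param:
  assumes "p \<in> params D" "same_param p q"
  shows "tangent D p = tangent D q"
proof -
  obtain m where p: "p = (fst q, snd q + of_int m)" using assms(2) by (rule same_paramE)
  have i: "fst q < ncomp D" using assms p by (simp add: params_iff)
  have "((\<lambda>t. curve D (fst q) (t + of_int m)) has_vector_derivative tangent D (fst q, snd q + of_int m)) (at (snd q))"
  proof -
    have "((\<lambda>t. t + of_int m) has_vector_derivative 1) (at (snd q))"
      by (auto intro!: derivative_eq_intros)
    from vector_diff_chain_at[OF this has_tangent[OF i]] show ?thesis by (simp add: o_def)
  qed
  moreover have "(\<lambda>t. curve D (fst q) (t + of_int m)) = curve D (fst q)"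
  proof
    fix t show "curve D (fst q) (t + of_int m) = curve D (fst q) t"
      using pt_same_param[of "(fst q, t + of_int m)" "(fst q, t)"] i by (simp add: pt_def params_iff)
  qed
  ultimately show ?thesis
    using vector_derivative_unique_at[OF _ has_tangent[OF i, of "snd q"]] p by simp
qed

lemma crosses_same_param:
  assumes "same_param p p'" "same_param q q'"
  shows "crosses D p q \<longleftrightarrow> crosses D p' q'"
proof -
  have "crosses D p' q'" if "crosses D p q" "same_param p p'" "same_param q q'" for p q p' q'
    using that pt_same_param[of p p'] pt_same_param[of q q'] same_param_params same_param_sym same_param_trans
    unfolding crosses_def by metis
  then show ?thesis using assms same_param_sym by blast
qed

lemma crosses_unique: "crosses D p q \<Longrightarrow> crosses D p r \<Longrightarrow> same_param q r"
  using diagram unfolding is_singular_diagram_def by blast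

lemma turn_nonzero: "crosses D p q \<Longrightarrow> turn D p q \<noteq> 0"
  using diagram unfolding is_singular_diagram_def by blast

lemma turn_pos_iff: "crosses D p q \<Longrightarrow> 0 < turn D q p \<longleftrightarrow> \<not> 0 < turn D p q"
  using turn_nonzero[of p q] turn_commute[of D q p] by linarith

lemma turn_same_param:
  "\<lbrakk>p \<in> params D; q \<in> params D; same_param p p'; same_param q q'\<rbrakk> \<Longrightarrow> turn D p q = turn D p' q'"
  using tangent_same_param by (simp add: turn_def)

lemma over_iff: "crosses D p q \<Longrightarrow> pt D p \<notin> sing D \<Longrightarrow> p \<in> over D \<longleftrightarrow> q \<notin> over D"
  using diagram unfolding is_singular_diagram_def by blast

lemma crosses_params: "crosses D p q \<Longrightarrow> p \<in> params D \<and> q \<in> params D"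
  by (simp add: crosses_def)

lemma strand_op_same_param:
  assumes "crosses D p q" "same_param p p'" "same_param q q'"
  shows "strand_op X D p q = strand_op X D p' q'"
proof -
  have c: "crosses D p' q" "crosses D p' q'" using assms crosses_same_param same_param_refl by blast+
  have "pt D p = pt D p'" using assms crosses_params pt_same_param by blast
  moreover have "turn D p q = turn D p' q'" using assms crosses_params turn_same_param by blast
  \<comment> \<open>Periodicity of \<open>over D\<close> follows from the crossing conditions:
    \<open>p\<close> and \<open>p'\<close> both cross \<open>q\<close>, and membership of
    \<open>q\<close> decides for both.\<close>
  moreover have "p \<in> over D \<longleftrightarrow> p' \<in> over D" if "pt D p \<notin> sing D"
    using over_iff[OF assms(1)] over_iff[OF c(1)] that \<open>pt D p = pt D p'\<close> by simp
  ultimately show ?thesis by (auto simp: strand_op_def)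
qed

lemma crossing_param_same_param: "same_param p p' \<Longrightarrow> crossing_param D p \<longleftrightarrow> crossing_param D p'"
  unfolding crossing_param_def using crosses_same_param same_param_refl by blast

lemma crossing_param_iff: "crossing_param D p \<longleftrightarrow> p \<in> params D \<and> pt D p \<in> crossings D"
proof
  assume "p \<in> params D \<and> pt D p \<in> crossings D"
  then obtain q r where p: "p \<in> params D" "pt D p = pt D q" and qr: "crosses D q r"
    by (auto simp: crossings_def)
  show "crossing_param D p"
  proof (cases "same_param p q")
    case True
    then have "crosses D p r" using qr crosses_same_param[of p q r r] by simp
    then show ?thesis unfolding crossing_param_def by blast
  next
    case False
    then have "crosses D p q" using p qr by (simp add: crosses_def)
    then show ?thesis unfolding crossing_param_def by blast
  qed
next
  assume "crossing_param D p"
  then obtain q where "crosses D p q" unfolding crossing_param_def by blast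
  then show "p \<in> params D \<and> pt D p \<in> crossings D" unfolding crossings_def crosses_def by blast
qed

text \<open>There are finitely many crossing points, and uniqueness of the partner leaves at most
  one other parameter within distance 1/2 at the same point: two of them would differ by an integer
  of absolute value below 1. A smaller neighbourhood excludes it.\<close>

lemma crossings_isolated:
  assumes i: "i < ncomp D"
  shows "\<forall>\<^sub>F t in at x. \<not> crossing_param D (i, t)"
proof -
  have "\<forall>\<^sub>F t in at x. curve D i t \<noteq> w" for w
  proof (cases "curve D i x = w")
    case False
    have "(curve D i \<longlongrightarrow> curve D i x) (at x)"
      using continuous[OF i, of UNIV] by (simp add: continuous_on_eq_continuous_at isCont_def)
    then show ?thesis using False tendsto_imp_eventually_ne by blast
  next
    case True
    have crs: "crosses D (i, x) (i, t)" if "t \<noteq> x" "\<bar>t - x\<bar> < 1 / 2" "curve D i t = w" for t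
    proof -
      have "x - t \<notin> \<int>" using that Ints_nonzero_abs_ge1[of "x - t"] by linarith
      then show ?thesis using that i True by (simp add: crosses_def params_iff same_param_def pt_def)
    qed
    show ?thesis
    proof (cases "\<exists>u. u \<noteq> x \<and> \<bar>u - x\<bar> < 1 / 2 \<and> curve D i u = w")
      case True
      then obtain u where u: "u \<noteq> x" "\<bar>u - x\<bar> < 1 / 2" "curve D i u = w" by blast
      have "curve D i t \<noteq> w" if t: "t \<noteq> x" "dist t x < \<bar>u - x\<bar>" for t
      proof
        assume "curve D i t = w"
        then have "same_param (i, t) (i, u)"
          using crosses_unique[OF crs crs, of t u] t u by (auto simp: dist_real_def)
        then have "t - u \<in> \<int>" by (simp add: same_param_def)
        then have "t = u" using Ints_nonzero_abs_ge1[of "t - u"] t u unfolding dist_real_def by linarith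
        then show False using t by (simp add: dist_real_def)
      qed
      then show ?thesis unfolding eventually_at using u(1) by (intro exI[of _ "\<bar>u - x\<bar>"]) auto
    next
      case False
      then show ?thesis unfolding eventually_at by (intro exI[of _ "1 / 2"]) (auto simp: dist_real_def)
    qed
  qed
  moreover have "finite (crossings D)" using diagram by (simp add: is_singular_diagram_def)
  ultimately have "\<forall>\<^sub>F t in at x. \<forall>w\<in>crossings D. curve D i t \<noteq> w"
    by (simp add: eventually_ball_finite)
  then show ?thesis by eventually_elim (auto simp: crossing_param_iff pt_def)
qed

lemma no_crossing_left:
  assumes "i < ncomp D"
  obtains y where "y < x" "\<And>t. y \<le> t \<Longrightarrow> t < x \<Longrightarrow> \<not> crossing_param D (i, t)"
proof -
  have "\<forall>\<^sub>F t in at_left x. \<not> crossing_param D (i, t)"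
    using crossings_isolated[OF assms] eventually_at_split by blast
  then obtain b where b: "b < x" "\<And>t. b < t \<Longrightarrow> t < x \<Longrightarrow> \<not> crossing_param D (i, t)"
    by (auto simp: eventually_at_left_field)
  \<comment> \<open>Moving inwards makes \<open>y\<close> itself a noncrossing parameter, so that
    its label can serve as the value on the whole interval.\<close>
  obtain y where "b < y" "y < x" using b(1) dense by blast
  then show thesis using that[of y] b by auto
qed

lemma no_crossing_right:
  assumes "i < ncomp D"
  obtains y where "x < y" "\<And>t. x < t \<Longrightarrow> t \<le> y \<Longrightarrow> \<not> crossing_param D (i, t)"
proof -
  have "\<forall>\<^sub>F t in at_right x. \<not> crossing_param D (i, t)"
    using crossings_isolated[OF assms] eventually_at_split by blast
  then obtain b where b: "x < b" "\<And>t. x < t \<Longrightarrow> t < b \<Longrightarrow> \<not> crossing_param D (i, t)"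
    by (auto simp: eventually_at_right_field)
  obtain y where "x < y" "y < b" using b(1) dense by blast
  then show thesis using that[of y] b by auto
qed

context
  fixes X :: "('a, 'm) psyquandle_scheme" and g
  assumes g: "g \<in> param_colorings X D"
begin

lemma constant_between:
  assumes i: "i < ncomp D" and "s \<le> t" and nc: "\<And>u. s \<le> u \<Longrightarrow> u \<le> t \<Longrightarrow> \<not> crossing_param D (i, u)"
  shows "g (i, s) = g (i, t)"
proof (rule connected_local_const[of "{s..t}"])
  show "\<forall>a\<in>{s..t}. \<forall>\<^sub>F b in at a within {s..t}. g (i, a) = g (i, b)"
  proof
    fix a assume "a \<in> {s..t}"
    then have "(i, a) \<in> params D" "\<not> crossing_param D (i, a)" using i nc[of a] by (simp_all add: params_iff)
    then have "\<forall>\<^sub>F b in at (snd (i, a)). g (fst (i, a), b) = g (i, a)"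
      using g unfolding param_colorings_def by blast
    then have "\<forall>\<^sub>F b in at a. g (i, b) = g (i, a)" by simp
    then have "\<forall>\<^sub>F b in at a within {s..t}. g (i, b) = g (i, a)"
      using at_le[of "{s..t}" UNIV a] filter_leD by blast
    then show "\<forall>\<^sub>F b in at a within {s..t}. g (i, a) = g (i, b)" by eventually_elim simp
  qed
qed (use assms in auto)

lemma value_in: "i < ncomp D \<Longrightarrow> \<not> crossing_param D (i, t) \<Longrightarrow> g (i, t) \<in> carrier X"
  using g by (auto simp: param_colorings_def params_iff split: if_splits)

lemma left_limit_eq:
  assumes i: "i < ncomp D" and "y < x" and nc: "\<And>t. y \<le> t \<Longrightarrow> t < x \<Longrightarrow> \<not> crossing_param D (i, t)"
  shows "left_limit g (i, x) = g (i, y)"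
proof (rule left_limitI)
  have "g (i, t) = g (i, y)" if "y < t" "t < x" for t
    using constant_between[of i y t] i nc that by auto
  then show "\<forall>\<^sub>F t in at_left (snd (i, x)). g (fst (i, x), t) = g (i, y)"
    using \<open>y < x\<close> by (auto simp: eventually_at_left_field)
qed

lemma right_limit_eq:
  assumes i: "i < ncomp D" and "x < y" and nc: "\<And>t. x < t \<Longrightarrow> t \<le> y \<Longrightarrow> \<not> crossing_param D (i, t)"
  shows "right_limit g (i, x) = g (i, y)"
proof (rule right_limitI)
  have "g (i, t) = g (i, y)" if "x < t" "t < y" for t
    using constant_between[of i t y] i nc that by auto
  then show "\<forall>\<^sub>F t in at_right (snd (i, x)). g (fst (i, x), t) = g (i, y)"
    using \<open>x < y\<close> by (auto simp: eventually_at_right_field)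
qed

lemma left_limit_in: "i < ncomp D \<Longrightarrow> left_limit g (i, x) \<in> carrier X"
  by (rule no_crossing_left[of i x]) (use left_limit_eq[of i] value_in in auto)

lemma right_limit_in: "i < ncomp D \<Longrightarrow> right_limit g (i, x) \<in> carrier X"
  by (rule no_crossing_right[of i x]) (use right_limit_eq[of i] value_in in auto)

end

end

section \<open>The correspondence with colorings of semiarcs\<close>

definition to_params :: "singular_diagram \<Rightarrow> (complex set \<Rightarrow> 'a) \<Rightarrow> nat \<times> real \<Rightarrow> 'a" where
  "to_params D f p = (if p \<in> params D \<and> \<not> crossing_param D p
     then f (connected_component_set (pt D ` params D - crossings D) (pt D p)) else undefined)"

context diagram begin

abbreviation "strands \<equiv> pt D ` params D - crossings D"
abbreviation "semiarc_at p \<equiv> connected_component_set strands (pt D p)"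

lemma pt_in_strands: "p \<in> params D \<Longrightarrow> \<not> crossing_param D p \<Longrightarrow> pt D p \<in> strands"
  by (auto simp: crossing_param_iff)

lemma semiarc_at_in: "p \<in> params D \<Longrightarrow> \<not> crossing_param D p \<Longrightarrow> semiarc_at p \<in> semiarcs D"
  unfolding semiarcs_def by (rule componentsI) (rule pt_in_strands)

lemma semiarcs_eq: "semiarcs D = semiarc_at ` {p \<in> params D. \<not> crossing_param D p}"
  unfolding semiarcs_def components_def by (auto simp: crossing_param_iff)

lemma same_semiarc:
  assumes i: "i < ncomp D" and nc: "\<And>u. u \<in> S \<Longrightarrow> \<not> crossing_param D (i, u)"
    and S: "topological_space_class.connected S" "s \<in> S" "t \<in> S"
  shows "semiarc_at (i, s) = semiarc_at (i, t)"
proof -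
  have "topological_space_class.connected (curve D i ` S)" by (rule connected_continuous_image[OF continuous[OF i] S(1)])
  moreover have "curve D i ` S \<subseteq> strands"
    using nc i pt_in_strands[of "(i, _)"] by (auto simp: pt_def params_iff)
  ultimately have "connected_component strands (curve D i s) (curve D i t)"
    using S by (auto simp: connected_component_def)
  then have "curve D i t \<in> connected_component_set strands (curve D i s)" by simp
  from connected_component_eq[OF this] show ?thesis by (simp add: pt_def)
qed

text \<open>Resolves the \<open>THE\<close> in \<open>semiarc_before\<close>: two components that
  both contain the strand just before \<open>x\<close> meet, hence are equal.\<close>

lemma semiarc_before_eq:
  assumes i: "i < ncomp D" and y: "y < x" and nc: "\<And>t. y \<le> t \<Longrightarrow> t < x \<Longrightarrow> \<not> crossing_param D (i, t)"
  shows "semiarc_before D (i, x) = semiarc_at (i, y)"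
  unfolding semiarc_before_def
proof (rule the_equality)
  have eq: "semiarc_at (i, t) = semiarc_at (i, y)" "pt D (i, t) \<in> semiarc_at (i, t)" if "y < t" "t < x" for t
    using same_semiarc[of i "{y..<x}" t y] pt_in_strands[of "(i, t)"] i nc that y
    by (auto simp: params_iff)
  have A: "semiarc_at (i, y) \<in> semiarcs D"
    using semiarc_at_in[of "(i, y)"] i nc y by (simp add: params_iff)
  have ev: "\<forall>\<^sub>F t in at_left x. pt D (i, t) \<in> semiarc_at (i, y)"
    unfolding eventually_at_left_field using y eq by blast
  show "semiarc_at (i, y) \<in> semiarcs D \<and>
      (\<forall>\<^sub>F t in at_left (snd (i, x)). pt D (fst (i, x), t) \<in> semiarc_at (i, y))"
    using A ev by simp
  fix B assume B: "B \<in> semiarcs D \<and> (\<forall>\<^sub>F t in at_left (snd (i, x)). pt D (fst (i, x), t) \<in> B)"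
  then have "\<forall>\<^sub>F t in at_left x. pt D (i, t) \<in> B \<inter> semiarc_at (i, y)"
    using ev by (auto elim: eventually_elim2)
  then have "B \<inter> semiarc_at (i, y) \<noteq> {}"
    using eventually_happens'[OF trivial_limit_at_left_real] by blast
  then show "B = semiarc_at (i, y)"
    using components_eq[of B strands "semiarc_at (i, y)"] A B unfolding semiarcs_def by blast
qed

lemma semiarc_after_eq:
  assumes i: "i < ncomp D" and y: "x < y" and nc: "\<And>t. x < t \<Longrightarrow> t \<le> y \<Longrightarrow> \<not> crossing_param D (i, t)"
  shows "semiarc_after D (i, x) = semiarc_at (i, y)"
  unfolding semiarc_after_def
proof (rule the_equality)
  have eq: "semiarc_at (i, t) = semiarc_at (i, y)" "pt D (i, t) \<in> semiarc_at (i, t)" if "x < t" "t < y" for t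
    using same_semiarc[of i "{x<..y}" t y] pt_in_strands[of "(i, t)"] i nc that y
    by (auto simp: params_iff)
  have A: "semiarc_at (i, y) \<in> semiarcs D"
    using semiarc_at_in[of "(i, y)"] i nc y by (simp add: params_iff)
  have ev: "\<forall>\<^sub>F t in at_right x. pt D (i, t) \<in> semiarc_at (i, y)"
    unfolding eventually_at_right_field using y eq by blast
  show "semiarc_at (i, y) \<in> semiarcs D \<and>
      (\<forall>\<^sub>F t in at_right (snd (i, x)). pt D (fst (i, x), t) \<in> semiarc_at (i, y))"
    using A ev by simp
  fix B assume B: "B \<in> semiarcs D \<and> (\<forall>\<^sub>F t in at_right (snd (i, x)). pt D (fst (i, x), t) \<in> B)"
  then have "\<forall>\<^sub>F t in at_right x. pt D (i, t) \<in> B \<inter> semiarc_at (i, y)"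
    using ev by (auto elim: eventually_elim2)
  then have "B \<inter> semiarc_at (i, y) \<noteq> {}"
    using eventually_happens'[OF trivial_limit_at_right_real] by blast
  then show "B = semiarc_at (i, y)"
    using components_eq[of B strands "semiarc_at (i, y)"] A B unfolding semiarcs_def by blast
qed

lemma left_limit_to_params:
  assumes "p \<in> params D" shows "left_limit (to_params D f) p = f (semiarc_before D p)"
proof (cases p)
  case (Pair i x)
  then have i: "i < ncomp D" using assms by (simp add: params_iff)
  obtain y where y: "y < x" "\<And>t. y \<le> t \<Longrightarrow> t < x \<Longrightarrow> \<not> crossing_param D (i, t)"
    using no_crossing_left[OF i, of x] by blast
  have "to_params D f (i, t) = f (semiarc_at (i, y))" if "y < t" "t < x" for t
    using same_semiarc[of i "{y..<x}" t y] i y that by (auto simp: to_params_def params_iff)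
  then have "\<forall>\<^sub>F t in at_left x. to_params D f (i, t) = f (semiarc_at (i, y))"
    unfolding eventually_at_left_field using y(1) by blast
  then show ?thesis using left_limitI[where p=p and g="to_params D f"] semiarc_before_eq[OF i y] Pair by simp
qed

lemma right_limit_to_params:
  assumes "p \<in> params D" shows "right_limit (to_params D f) p = f (semiarc_after D p)"
proof (cases p)
  case (Pair i x)
  then have i: "i < ncomp D" using assms by (simp add: params_iff)
  obtain y where y: "x < y" "\<And>t. x < t \<Longrightarrow> t \<le> y \<Longrightarrow> \<not> crossing_param D (i, t)"
    using no_crossing_right[OF i, of x] by blast
  have "to_params D f (i, t) = f (semiarc_at (i, y))" if "x < t" "t < y" for t
    using same_semiarc[of i "{x<..y}" t y] i y that by (auto simp: to_params_def params_iff)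
  then have "\<forall>\<^sub>F t in at_right x. to_params D f (i, t) = f (semiarc_at (i, y))"
    unfolding eventually_at_right_field using y(1) by blast
  then show ?thesis using right_limitI[where p=p and g="to_params D f"] semiarc_after_eq[OF i y] Pair by simp
qed

lemma rule_at_to_params:
  assumes "crosses D p q"
  shows "rule_at X D (to_params D f) p q \<longleftrightarrow>
    crossing_rule (strand_op X D p q) (strand_op X D q p)
      (f (left_semiarc D p q)) (f (right_semiarc D p q)) (f (left_semiarc D q p)) (f (right_semiarc D q p))"
  using assms crosses_params[OF assms] turn_pos_iff[OF assms]
  by (simp add: rule_at_def oriented_rule_def left_semiarc_def right_semiarc_def
      left_limit_to_params right_limit_to_params)

text \<open>In \<open>colorings\<close> the two strands of a crossing are distinguished, by over and
  under or by direction, and only one order is considered; here both orders occur. Symmetry of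
  \<open>crossing_rule\<close> reconciles the two.\<close>

lemma colorings_iff:
  "f \<in> colorings X D \<longleftrightarrow> f \<in> semiarcs D \<rightarrow>\<^sub>E carrier X \<and>
     (\<forall>p q. crosses D p q \<longrightarrow> rule_at X D (to_params D f) p q)"
proof -
  define R where "R p q \<longleftrightarrow> crossing_rule (strand_op X D p q) (strand_op X D q p)
      (f (left_semiarc D p q)) (f (right_semiarc D p q)) (f (left_semiarc D q p)) (f (right_semiarc D q p))" for p q
  have sym: "R p q \<longleftrightarrow> R q p" for p q unfolding R_def by (rule crossing_rule_commute)
  have over: "R p q \<longleftrightarrow>
        f (right_semiarc D p q) = tri_u X (f (left_semiarc D p q)) (f (left_semiarc D q p)) \<and>
        f (right_semiarc D q p) = tri_o X (f (left_semiarc D q p)) (f (left_semiarc D p q))"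
    if "crosses_over D q p" for p q
  proof -
    have "pt D q = pt D p" "pt D q \<notin> sing D" "q \<in> over D" "p \<notin> over D"
      using that over_iff[of q p] by (auto simp: crosses_over_def crosses_def)
    then show ?thesis by (simp add: R_def crossing_rule_def strand_op_def)
  qed
  have sing: "R p q \<longleftrightarrow>
        f (right_semiarc D p q) = dot_u X (f (left_semiarc D p q)) (f (left_semiarc D q p)) \<and>
        f (right_semiarc D q p) = dot_o X (f (left_semiarc D q p)) (f (left_semiarc D p q))"
    if "crosses_singularly D p q \<and> 0 < turn D p q" for p q
  proof -
    have "pt D q = pt D p" "pt D q \<in> sing D" "\<not> 0 < turn D q p"
      using that turn_pos_iff[of p q] by (auto simp: crosses_singularly_def crosses_def)
    then show ?thesis using that by (simp add: R_def crossing_rule_def strand_op_def)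
  qed
  have cases: "crosses_over D q p \<or> crosses_over D p q \<or> crosses_singularly D p q \<and> 0 < turn D p q \<or>
      crosses_singularly D q p \<and> 0 < turn D q p" if "crosses D p q" for p q
  proof -
    have "crosses D q p" "pt D q = pt D p" using crosses_commute[OF that] that by (simp_all add: crosses_def)
    then show ?thesis using that over_iff[OF that] turn_pos_iff[OF that]
      unfolding crosses_over_def crosses_singularly_def by auto
  qed
  have imp: "crosses_over D q p \<Longrightarrow> crosses D p q" "crosses_singularly D p q \<Longrightarrow> crosses D p q" for p q
    by (auto simp: crosses_over_def crosses_singularly_def intro: crosses_commute)
  have "(\<forall>p q. crosses D p q \<longrightarrow> rule_at X D (to_params D f) p q) \<longleftrightarrow> (\<forall>p q. crosses D p q \<longrightarrow> R p q)"
    by (auto simp: rule_at_to_params R_def)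
  also have "\<dots> \<longleftrightarrow> (\<forall>p q. crosses_over D q p \<longrightarrow> R p q) \<and>
      (\<forall>p q. crosses_singularly D p q \<and> 0 < turn D p q \<longrightarrow> R p q)"
    using cases imp sym by blast
  finally show ?thesis unfolding colorings_def using over sing by auto
qed

lemma to_params_in:
  assumes "f \<in> colorings X D"
  shows "to_params D f \<in> param_colorings X D"
proof -
  have f: "f \<in> semiarcs D \<rightarrow>\<^sub>E carrier X" and r: "\<And>p q. crosses D p q \<Longrightarrow> rule_at X D (to_params D f) p q"
    using assms by (auto simp: colorings_iff)
  have "to_params D f p \<in> carrier X" if "p \<in> params D" "\<not> crossing_param D p" for p
    using PiE_mem[OF f semiarc_at_in[OF that]] that by (simp add: to_params_def)
  moreover have "to_params D f (i, t + 1) = to_params D f (i, t)" for i t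
  proof -
    have sp: "same_param (i, t + 1) (i, t)" using same_param_shift(1)[of i t 1] by simp
    show ?thesis
      using pt_same_param[OF _ sp] crossing_param_same_param[OF sp] same_param_params[OF sp]
      by (simp add: to_params_def)
  qed
  moreover have "\<forall>\<^sub>F t in at (snd p). to_params D f (fst p, t) = to_params D f p"
    if p: "p \<in> params D" "\<not> crossing_param D p" for p
  proof (cases p)
    case (Pair i x)
    have i: "i < ncomp D" using p Pair by (simp add: params_iff)
    obtain y where y: "y < x" "\<And>t. y \<le> t \<Longrightarrow> t < x \<Longrightarrow> \<not> crossing_param D (i, t)"
      using no_crossing_left[OF i, of x] by blast
    obtain z where z: "x < z" "\<And>t. x < t \<Longrightarrow> t \<le> z \<Longrightarrow> \<not> crossing_param D (i, t)"
      using no_crossing_right[OF i, of x] by blast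
    have nc: "\<not> crossing_param D (i, t)" if "t \<in> {y<..<z}" for t
      using y(2)[of t] z(2)[of t] p Pair that by (cases t x rule: linorder_cases) auto
    have "to_params D f (i, t) = to_params D f (i, x)" if "t \<in> {y<..<z}" for t
      using same_semiarc[OF i nc, of "{y<..<z}" t x] nc[OF that] nc[of x] that i y(1) z(1)
      by (auto simp: to_params_def params_iff)
    moreover have "\<forall>\<^sub>F t in at x. t \<in> {y<..<z}"
      using y(1) z(1) by (intro eventually_at_in_open') auto
    ultimately show ?thesis using Pair by (auto elim: eventually_mono)
  qed
  ultimately show ?thesis using r by (auto simp: param_colorings_def to_params_def)
qed

lemma same_param_if_pt_eq:
  "\<lbrakk>p \<in> params D; q \<in> params D; \<not> crossing_param D p; pt D p = pt D q\<rbrakk> \<Longrightarrow> same_param p q"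
  unfolding crossing_param_def crosses_def by metis

text \<open>
  Together with the crossings, each level set has a compact image. As the carrier is finite, this
  partitions a semiarc into finitely many closed sets, so that only one of them is nonempty.
\<close>

lemma compact_level_set:
  assumes g: "g \<in> param_colorings X D"
  shows "compact (pt D ` {p \<in> params D. crossing_param D p \<or> g p = v})"
proof -
  \<comment> \<open>By periodicity a single period, which is compact, carries the whole
    image.\<close>
  define K where "K i = {t \<in> {0..1}. crossing_param D (i, t) \<or> g (i, t) = v}" for i
  \<comment> \<open>Near a noncrossing parameter there are no crossings and the label is constant,
    so the complement is open.\<close>
  have cl: "closed {t. crossing_param D (i, t) \<or> g (i, t) = v}" if i: "i < ncomp D" for i
    unfolding closed_def open_subopen[of "- _"]
  proof
    fix x assume x: "x \<in> - {t. crossing_param D (i, t) \<or> g (i, t) = v}"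
    then have "\<forall>\<^sub>F t in at (snd (i, x)). g (fst (i, x), t) = g (i, x)"
      using g i unfolding param_colorings_def by (auto simp: params_iff)
    from eventually_conj[OF crossings_isolated[OF i, of x] this[simplified]]
    have "\<forall>\<^sub>F t in at x. t \<in> - {t. crossing_param D (i, t) \<or> g (i, t) = v}"
      by (rule eventually_mono) (use x in auto)
    then have "\<forall>\<^sub>F t in nhds x. t \<in> - {t. crossing_param D (i, t) \<or> g (i, t) = v}"
      using x by (auto simp: eventually_nhds_conv_at)
    then show "\<exists>T. open T \<and> x \<in> T \<and> T \<subseteq> - {t. crossing_param D (i, t) \<or> g (i, t) = v}"
      unfolding eventually_nhds by blast
  qed
  have "compact (\<Union>i<ncomp D. curve D i ` K i)"
  proof (rule compact_UN)
    fix i assume "i \<in> {..<ncomp D}"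
    then have i: "i < ncomp D" by simp
    have "K i = {0..1} \<inter> {t. crossing_param D (i, t) \<or> g (i, t) = v}" by (auto simp: K_def)
    then have "compact (K i)" using compact_Int_closed[OF compact_Icc cl[OF i]] by simp
    then show "compact (curve D i ` K i)" by (rule compact_continuous_image[OF continuous[OF i]])
  qed simp
  moreover have "pt D ` {p \<in> params D. crossing_param D p \<or> g p = v} = (\<Union>i<ncomp D. curve D i ` K i)"
  proof (intro equalityI subsetI)
    fix y assume "y \<in> pt D ` {p \<in> params D. crossing_param D p \<or> g p = v}"
    then obtain i t where p: "(i, t) \<in> params D" "crossing_param D (i, t) \<or> g (i, t) = v"
      and y: "y = pt D (i, t)" by auto
    define u where "u = frac t"
    have sp: "same_param (i, t) (i, u)" by (simp add: u_def frac_def same_param_def)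
    have "0 \<le> u" "u \<le> 1" using frac_ge_0[of t] frac_lt_1[of t] by (simp_all add: u_def)
    then have "u \<in> K i" using p crossing_param_same_param[OF sp] param_colorings_shift[OF g sp]
      by (simp add: K_def)
    moreover have "y = curve D i u" using pt_same_param[OF p(1) sp] y by (simp add: pt_def)
    ultimately show "y \<in> (\<Union>i<ncomp D. curve D i ` K i)" using p(1) by (auto simp: params_iff)
  next
    fix y assume "y \<in> (\<Union>i<ncomp D. curve D i ` K i)"
    then obtain i t where "i < ncomp D" "t \<in> K i" "y = curve D i t" by auto
    then show "y \<in> pt D ` {p \<in> params D. crossing_param D p \<or> g p = v}"
      by (intro image_eqI[of _ _ "(i, t)"]) (auto simp: K_def pt_def params_iff)
  qed
  ultimately show ?thesis by simp
qed

text \<open>A noncrossing point belongs to a single passage, so different level sets are disjoint on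
  the semiarc. If \<open>g q\<close> differed from \<open>g p\<close>, the closed set
  \<open>K (g p)\<close> and the finite union \<open>L\<close> of the others would disconnect
  it.\<close>

lemma constant_on_semiarc:
  assumes fin: "finite (carrier X)" and g: "g \<in> param_colorings X D"
    and p: "p \<in> params D" "\<not> crossing_param D p" and q: "q \<in> params D" "\<not> crossing_param D q"
    and eq: "semiarc_at p = semiarc_at q"
  shows "g p = g q"
proof (rule ccontr)
  assume ne: "g p \<noteq> g q"
  define K where "K v = pt D ` {p \<in> params D. crossing_param D p \<or> g p = v}" for v
  define L where "L = (\<Union>v\<in>carrier X - {g p}. K v)"
  have K: "closed (K v)" for v
    unfolding K_def by (rule compact_imp_closed[OF compact_level_set[OF g]])
  then have L: "closed L" unfolding L_def using fin by (intro closed_UN) auto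
  have inX: "g r \<in> carrier X" if "r \<in> params D" "\<not> crossing_param D r" for r
    using value_in[OF g, of "fst r" "snd r"] that by (simp add: params_iff)
  have sub: "semiarc_at p \<subseteq> strands" by (rule connected_component_subset)
  have nc: "\<not> crossing_param D r" if "r \<in> params D" "pt D r \<in> strands" for r
    using that by (auto simp: crossing_param_iff)
  have "semiarc_at p \<subseteq> K (g p) \<union> L"
  proof
    fix y assume "y \<in> semiarc_at p"
    then obtain r where r: "r \<in> params D" "y = pt D r" "\<not> crossing_param D r" using sub nc by blast
    then show "y \<in> K (g p) \<union> L" using inX[of r] by (cases "g r = g p") (auto simp: K_def L_def)
  qed
  moreover have "K (g p) \<inter> L \<inter> semiarc_at p = {}"
  proof (rule ccontr)
    assume "K (g p) \<inter> L \<inter> semiarc_at p \<noteq> {}"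
    then obtain y where y1: "y \<in> K (g p)" "y \<in> L" "y \<in> semiarc_at p" by blast
    then obtain v where "y \<in> K v" "v \<noteq> g p" unfolding L_def by blast
    moreover have "y \<in> strands" using sub y1(3) by blast
    ultimately have y: "y \<in> K (g p)" "y \<in> K v" "v \<noteq> g p" "y \<in> strands" using y1(1) by blast+
    from y(1) obtain r where r: "r \<in> params D" "pt D r = y" "crossing_param D r \<or> g r = g p"
      unfolding K_def by blast
    from y(2) obtain r' where r': "r' \<in> params D" "pt D r' = y" "crossing_param D r' \<or> g r' = v"
      unfolding K_def by blast
    have "\<not> crossing_param D r" "\<not> crossing_param D r'" using nc[of r] nc[of r'] y(4) r r' by simp_all
    moreover from this have "g r = g r'"
      using param_colorings_shift[OF g same_param_if_pt_eq, of r r'] r(1,2) r'(1,2) by simp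
    ultimately show False using r(3) r'(3) y(3) by simp
  qed
  moreover have "pt D p \<in> K (g p)" "pt D q \<in> L"
    using p q ne inX[OF q] by (auto simp: K_def L_def)
  moreover have "pt D p \<in> semiarc_at p" "pt D q \<in> semiarc_at q"
    using pt_in_strands[OF p] pt_in_strands[OF q] by simp_all
  ultimately show False
    using connected_closedD[OF connected_connected_component, of "K (g p)" L strands "pt D p"] K L eq by blast
qed

lemma to_params_surj:
  assumes fin: "finite (carrier X)" and g: "g \<in> param_colorings X D"
  shows "\<exists>f\<in>colorings X D. to_params D f = g"
proof -
  \<comment> \<open>By \<open>constant_on_semiarc\<close> the choice of the representing parameter
    does not affect the label.\<close>
  define r where "r A = (SOME p. p \<in> params D \<and> \<not> crossing_param D p \<and> semiarc_at p = A)" for A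
  define f where "f = (\<lambda>A\<in>semiarcs D. g (r A))"
  have r: "r A \<in> params D \<and> \<not> crossing_param D (r A) \<and> semiarc_at (r A) = A" if "A \<in> semiarcs D" for A
    unfolding r_def by (rule someI_ex) (use that in \<open>auto simp: semiarcs_eq\<close>)
  have val: "f (semiarc_at p) = g p" if "p \<in> params D" "\<not> crossing_param D p" for p
    using constant_on_semiarc[OF fin g _ _ that] r[OF semiarc_at_in[OF that]] semiarc_at_in[OF that]
    by (simp add: f_def)
  have "to_params D f p = g p" for p
    using val param_colorings_undefined[OF g] unfolding to_params_def by presburger
  then have tp: "to_params D f = g" by blast
  have "f \<in> semiarcs D \<rightarrow>\<^sub>E carrier X"
  proof (rule PiE_I)
    fix A assume A: "A \<in> semiarcs D"
    then show "f A \<in> carrier X"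
      using value_in[OF g, of "fst (r A)" "snd (r A)"] r[OF A] by (simp add: f_def params_iff)
  qed (simp add: f_def)
  then have "f \<in> colorings X D" using g by (auto simp: colorings_iff tp param_colorings_def)
  then show ?thesis using tp by blast
qed

lemma to_params_inj:
  assumes "f \<in> colorings X D" "f' \<in> colorings X D" "to_params D f = to_params D f'"
  shows "f = f'"
proof (rule PiE_ext[of f "semiarcs D" "\<lambda>_. carrier X"])
  fix A assume "A \<in> semiarcs D"
  then obtain p where "p \<in> params D" "\<not> crossing_param D p" "A = semiarc_at p" by (auto simp: semiarcs_eq)
  then show "f A = f' A" using fun_cong[OF assms(3), of p] by (simp add: to_params_def)
qed (use assms in \<open>auto simp: colorings_iff\<close>)

lemma to_params_bij:
  assumes "finite (carrier X)"
  shows "bij_betw (to_params D) (colorings X D) (param_colorings X D)"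
  unfolding bij_betw_def
proof (intro conjI equalityI subsetI)
  show "inj_on (to_params D) (colorings X D)" by (rule inj_onI) (rule to_params_inj)
  show "g \<in> to_params D ` colorings X D" if "g \<in> param_colorings X D" for g
    using to_params_surj[OF assms that] by blast
qed (use to_params_in in blast)

end

section \<open>Endomorphisms acting on colorings, and the quiver\<close>

definition push :: "singular_diagram \<Rightarrow> ('a \<Rightarrow> 'a) \<Rightarrow> (nat \<times> real \<Rightarrow> 'a) \<Rightarrow> nat \<times> real \<Rightarrow> 'a" where
  "push D \<phi> g p = (if p \<in> params D \<and> \<not> crossing_param D p then \<phi> (g p) else undefined)"

context diagram begin

lemma left_limit_attained:
  assumes "g \<in> param_colorings X D" "p \<in> params D"
  shows "\<forall>\<^sub>F t in at_left (snd p). g (fst p, t) = left_limit g p"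
    "\<forall>\<^sub>F t in at_left (snd p). \<not> crossing_param D (fst p, t)"
proof -
  obtain i x where p: "p = (i, x)" "i < ncomp D" using assms by (cases p) (auto simp: params_iff)
  obtain y where y: "y < x" "\<And>t. y \<le> t \<Longrightarrow> t < x \<Longrightarrow> \<not> crossing_param D (i, t)"
    using no_crossing_left[OF p(2), of x] by blast
  have "g (i, t) = left_limit g p" if "y < t" "t < x" for t
    using left_limit_eq[OF assms(1) p(2), of t x] y that p(1) by auto
  then show "\<forall>\<^sub>F t in at_left (snd p). g (fst p, t) = left_limit g p"
    unfolding eventually_at_left_field using y(1) p(1) by auto
  show "\<forall>\<^sub>F t in at_left (snd p). \<not> crossing_param D (fst p, t)"
    unfolding eventually_at_left_field using y p(1) by auto
qed

lemma right_limit_attained: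
  assumes "g \<in> param_colorings X D" "p \<in> params D"
  shows "\<forall>\<^sub>F t in at_right (snd p). g (fst p, t) = right_limit g p"
    "\<forall>\<^sub>F t in at_right (snd p). \<not> crossing_param D (fst p, t)"
proof -
  obtain i x where p: "p = (i, x)" "i < ncomp D" using assms by (cases p) (auto simp: params_iff)
  obtain y where y: "x < y" "\<And>t. x < t \<Longrightarrow> t \<le> y \<Longrightarrow> \<not> crossing_param D (i, t)"
    using no_crossing_right[OF p(2), of x] by blast
  have "g (i, t) = right_limit g p" if "x < t" "t < y" for t
    using right_limit_eq[OF assms(1) p(2), of x t] y that p(1) by auto
  then show "\<forall>\<^sub>F t in at_right (snd p). g (fst p, t) = right_limit g p"
    unfolding eventually_at_right_field using y(1) p(1) by auto
  show "\<forall>\<^sub>F t in at_right (snd p). \<not> crossing_param D (fst p, t)"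
    unfolding eventually_at_right_field using y p(1) by auto
qed

lemma limits_in:
  assumes "g \<in> param_colorings X D" "p \<in> params D"
  shows "left_limit g p \<in> carrier X" "right_limit g p \<in> carrier X"
  using left_limit_in[OF assms(1), of "fst p" "snd p"] right_limit_in[OF assms(1), of "fst p" "snd p"]
    assms(2) by (simp_all add: params_iff)

lemma strand_op_hom:
  assumes "\<phi> \<in> psyquandle_hom X X" "x \<in> carrier X" "y \<in> carrier X"
  shows "\<phi> (strand_op X D p q x y) = strand_op X D p q (\<phi> x) (\<phi> y)"
  using assms by (simp add: psyquandle_hom_def strand_op_def)

lemma push_in:
  assumes g: "g \<in> param_colorings X D" and \<phi>: "\<phi> \<in> psyquandle_hom X X"
  shows "push D \<phi> g \<in> param_colorings X D"
proof -
  have \<phi>in: "\<phi> x \<in> carrier X" if "x \<in> carrier X" for x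
    using \<phi> that by (auto simp: psyquandle_hom_def)
  have "push D \<phi> g p \<in> carrier X" if "p \<in> params D" "\<not> crossing_param D p" for p
    using value_in[OF g, of "fst p" "snd p"] that \<phi>in by (simp add: push_def params_iff)
  moreover have "push D \<phi> g (i, t + 1) = push D \<phi> g (i, t)" for i t
  proof -
    have sp: "same_param (i, t + 1) (i, t)" using same_param_shift(1)[of i t 1] by simp
    show ?thesis
      using param_colorings_shift[OF g sp] crossing_param_same_param[OF sp] same_param_params[OF sp]
      by (simp add: push_def)
  qed
  moreover have "\<forall>\<^sub>F t in at (snd p). push D \<phi> g (fst p, t) = push D \<phi> g p"
    if p: "p \<in> params D" "\<not> crossing_param D p" for p
  proof -
    have i: "fst p < ncomp D" using p by (simp add: params_iff)
    have "\<forall>\<^sub>F t in at (snd p). g (fst p, t) = g p" using g p by (auto simp: param_colorings_def)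
    from eventually_conj[OF this crossings_isolated[OF i, of "snd p"]]
    show ?thesis by (rule eventually_mono) (use p i in \<open>auto simp: push_def params_iff\<close>)
  qed
  moreover have "rule_at X D (push D \<phi> g) p q" if c: "crosses D p q" for p q
  proof -
    have lim: "left_limit (push D \<phi> g) r = \<phi> (left_limit g r)"
        "right_limit (push D \<phi> g) r = \<phi> (right_limit g r)" if r: "r \<in> params D" for r
    proof -
      have i: "fst r < ncomp D" using r by (simp add: params_iff)
      from eventually_conj[OF left_limit_attained[OF g r]]
      have "\<forall>\<^sub>F t in at_left (snd r). push D \<phi> g (fst r, t) = \<phi> (left_limit g r)"
        by (rule eventually_mono) (use i in \<open>auto simp: push_def params_iff\<close>)
      then show "left_limit (push D \<phi> g) r = \<phi> (left_limit g r)" by (rule left_limitI)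
      from eventually_conj[OF right_limit_attained[OF g r]]
      have "\<forall>\<^sub>F t in at_right (snd r). push D \<phi> g (fst r, t) = \<phi> (right_limit g r)"
        by (rule eventually_mono) (use i in \<open>auto simp: push_def params_iff\<close>)
      then show "right_limit (push D \<phi> g) r = \<phi> (right_limit g r)" by (rule right_limitI)
    qed
    have pq: "p \<in> params D" "q \<in> params D" using crosses_params[OF c] by simp_all
    have "rule_at X D g p q" by (rule param_colorings_rule[OF g c])
    then show ?thesis
      unfolding rule_at_def oriented_rule_def crossing_rule_def lim[OF pq(1)] lim[OF pq(2)]
      using strand_op_hom[OF \<phi>] limits_in[OF g pq(1)] limits_in[OF g pq(2)] by metis
  qed
  ultimately show ?thesis unfolding param_colorings_def by (auto simp: push_def)
qed

lemma to_params_compose: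
  "to_params D (compose (semiarcs D) \<phi> f) = push D \<phi> (to_params D f)"
  by (rule ext) (auto simp: to_params_def push_def compose_def semiarc_at_in)

lemma compose_in_colorings:
  assumes f: "f \<in> colorings X D" and \<phi>: "\<phi> \<in> psyquandle_hom X X"
  shows "compose (semiarcs D) \<phi> f \<in> colorings X D"
  unfolding colorings_iff
proof (intro conjI allI impI)
  have "f A \<in> carrier X" if "A \<in> semiarcs D" for A
    using f that unfolding colorings_iff by (auto dest: PiE_mem)
  then show "compose (semiarcs D) \<phi> f \<in> semiarcs D \<rightarrow>\<^sub>E carrier X"
    using \<phi> by (intro PiE_I) (auto simp: compose_def psyquandle_hom_def)
next
  fix p q assume "crosses D p q"
  then show "rule_at X D (to_params D (compose (semiarcs D) \<phi> f)) p q"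
    using param_colorings_rule[OF push_in[OF to_params_in[OF f] \<phi>]] by (simp add: to_params_compose)
qed

end

text \<open>Stands for an isomorphism of quivers that keeps the endomorphism attached to each edge.
  Formulated without semiarcs, it composes directly along a sequence of moves.\<close>

definition coloring_equiv ::
    "('a, 'm) psyquandle_scheme \<Rightarrow> ('a \<Rightarrow> 'a) set \<Rightarrow> singular_diagram \<Rightarrow> singular_diagram \<Rightarrow> bool" where
  "coloring_equiv X S D D' \<longleftrightarrow> (\<exists>\<beta>. bij_betw \<beta> (param_colorings X D) (param_colorings X D') \<and>
     (\<forall>g\<in>param_colorings X D. \<forall>\<phi>\<in>S. \<beta> (push D \<phi> g) = push D' \<phi> (\<beta> g)))"

lemma coloring_equiv_trans:
  assumes "coloring_equiv X S D D'" "coloring_equiv X S D' D''"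
  shows "coloring_equiv X S D D''"
proof -
  obtain \<beta> \<gamma> where b: "bij_betw \<beta> (param_colorings X D) (param_colorings X D')"
      "\<And>g \<phi>. g \<in> param_colorings X D \<Longrightarrow> \<phi> \<in> S \<Longrightarrow> \<beta> (push D \<phi> g) = push D' \<phi> (\<beta> g)"
    and c: "bij_betw \<gamma> (param_colorings X D') (param_colorings X D'')"
      "\<And>g \<phi>. g \<in> param_colorings X D' \<Longrightarrow> \<phi> \<in> S \<Longrightarrow> \<gamma> (push D' \<phi> g) = push D'' \<phi> (\<gamma> g)"
    using assms unfolding coloring_equiv_def by blast
  have "(\<gamma> \<circ> \<beta>) (push D \<phi> g) = push D'' \<phi> ((\<gamma> \<circ> \<beta>) g)" if "g \<in> param_colorings X D" "\<phi> \<in> S" for g \<phi>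
    using b(2)[OF that] c(2)[OF bij_betw_apply[OF b(1) that(1)] that(2)] by simp
  then show ?thesis unfolding coloring_equiv_def using bij_betw_trans[OF b(1) c(1)] by blast
qed

lemma coloring_equiv_refl: "coloring_equiv X S D D"
  unfolding coloring_equiv_def by (rule exI[of _ id]) simp

text \<open>The inverse bijection is equivariant because members of \<open>S\<close>, being
  endomorphisms, map colorings of \<open>D\<close> to colorings of \<open>D\<close>, on which the
  bijection can be undone.\<close>

lemma coloring_equiv_sym:
  assumes D: "is_singular_diagram D" and S: "S \<subseteq> psyquandle_hom X X" and e: "coloring_equiv X S D D'"
  shows "coloring_equiv X S D' D"
proof -
  interpret diagram D by unfold_locales (rule D)
  obtain \<beta> where b: "bij_betw \<beta> (param_colorings X D) (param_colorings X D')"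
      "\<And>g \<phi>. g \<in> param_colorings X D \<Longrightarrow> \<phi> \<in> S \<Longrightarrow> \<beta> (push D \<phi> g) = push D' \<phi> (\<beta> g)"
    using e unfolding coloring_equiv_def by blast
  let ?\<gamma> = "inv_into (param_colorings X D) \<beta>"
  have "?\<gamma> (push D' \<phi> g) = push D \<phi> (?\<gamma> g)" if g: "g \<in> param_colorings X D'" and \<phi>: "\<phi> \<in> S" for g \<phi>
  proof -
    have h: "?\<gamma> g \<in> param_colorings X D" "\<beta> (?\<gamma> g) = g"
      using bij_betw_apply[OF bij_betw_inv_into[OF b(1)] g] bij_betw_inv_into_right[OF b(1) g] by auto
    then have "push D' \<phi> g = \<beta> (push D \<phi> (?\<gamma> g))" using b(2)[OF h(1) \<phi>] by simp
    moreover have "push D \<phi> (?\<gamma> g) \<in> param_colorings X D" using push_in h(1) S \<phi> by blast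
    ultimately show ?thesis using bij_betw_inv_into_left[OF b(1)] by simp
  qed
  then show ?thesis unfolding coloring_equiv_def using bij_betw_inv_into[OF b(1)] by blast
qed

text \<open>Builds the bijection from a relation that is total and single-valued in both directions.
  Equivariance is then automatic: pushing a related pair gives a related pair, and the partner of
  \<open>push D \<phi> g\<close> is unique.\<close>

lemma coloring_equivI:
  assumes D': "is_singular_diagram D'" and S: "S \<subseteq> psyquandle_hom X X"
    and total: "\<And>g. g \<in> param_colorings X D \<Longrightarrow> \<exists>g'\<in>param_colorings X D'. R g g'"
      "\<And>g'. g' \<in> param_colorings X D' \<Longrightarrow> \<exists>g\<in>param_colorings X D. R g g'"
    and unique: "\<And>g g\<^sub>1 g\<^sub>2. \<lbrakk>g \<in> param_colorings X D; g\<^sub>1 \<in> param_colorings X D'; g\<^sub>2 \<in> param_colorings X D';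
        R g g\<^sub>1; R g g\<^sub>2\<rbrakk> \<Longrightarrow> g\<^sub>1 = g\<^sub>2"
      "\<And>g g\<^sub>1 g\<^sub>2. \<lbrakk>g \<in> param_colorings X D'; g\<^sub>1 \<in> param_colorings X D; g\<^sub>2 \<in> param_colorings X D;
        R g\<^sub>1 g; R g\<^sub>2 g\<rbrakk> \<Longrightarrow> g\<^sub>1 = g\<^sub>2"
    and push: "\<And>g g' \<phi>. \<lbrakk>g \<in> param_colorings X D; g' \<in> param_colorings X D'; R g g'; \<phi> \<in> S\<rbrakk> \<Longrightarrow>
        R (push D \<phi> g) (push D' \<phi> g')"
    and D: "is_singular_diagram D"
  shows "coloring_equiv X S D D'"
proof -
  interpret D: diagram D by unfold_locales (rule D)
  interpret D': diagram D' by unfold_locales (rule D')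
  obtain \<beta> where \<beta>: "\<And>g. g \<in> param_colorings X D \<Longrightarrow> \<beta> g \<in> param_colorings X D' \<and> R g (\<beta> g)"
    using total(1) by metis
  have "bij_betw \<beta> (param_colorings X D) (param_colorings X D')"
    unfolding bij_betw_def
  proof (intro conjI equalityI subsetI)
    show "inj_on \<beta> (param_colorings X D)"
      by (rule inj_onI) (metis \<beta> unique(2))
    fix g' assume g': "g' \<in> param_colorings X D'"
    then obtain g where g: "g \<in> param_colorings X D" "R g g'" using total(2) by blast
    then have "g' = \<beta> g" using unique(1)[OF g(1) g'] \<beta>[OF g(1)] by blast
    then show "g' \<in> \<beta> ` param_colorings X D" using g(1) by blast
  qed (use \<beta> in auto)
  moreover have "\<beta> (push D \<phi> g) = push D' \<phi> (\<beta> g)" if "g \<in> param_colorings X D" "\<phi> \<in> S" for g \<phi>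
  proof -
    have "\<phi> \<in> psyquandle_hom X X" using S that by blast
    then have p: "push D \<phi> g \<in> param_colorings X D" "push D' \<phi> (\<beta> g) \<in> param_colorings X D'"
      using D.push_in D'.push_in \<beta> that by blast+
    then show ?thesis
      using unique(1)[OF p(1)] \<beta>[OF p(1)] push[OF that(1) _ _ that(2)] \<beta>[OF that(1)] by blast
  qed
  ultimately show ?thesis unfolding coloring_equiv_def by blast
qed

lemma coloring_quiver_iso:
  assumes fin: "finite (carrier X)" and S: "S \<subseteq> psyquandle_hom X X"
    and D: "is_singular_diagram D" and D': "is_singular_diagram D'" and e: "coloring_equiv X S D D'"
  shows "digraph_iso (coloring_quiver X S D) (coloring_quiver X S D')"
proof -
  interpret D: diagram D by unfold_locales (rule D)
  interpret D': diagram D' by unfold_locales (rule D')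
  obtain \<beta> where b: "bij_betw \<beta> (param_colorings X D) (param_colorings X D')"
      "\<And>g \<phi>. g \<in> param_colorings X D \<Longrightarrow> \<phi> \<in> S \<Longrightarrow> \<beta> (push D \<phi> g) = push D' \<phi> (\<beta> g)"
    using e unfolding coloring_equiv_def by blast
  have tp: "bij_betw (to_params D) (colorings X D) (param_colorings X D)"
    and tp': "bij_betw (to_params D') (colorings X D') (param_colorings X D')"
    by (rule D.to_params_bij[OF fin] D'.to_params_bij[OF fin])+
  define \<gamma> where "\<gamma> = inv_into (colorings X D') (to_params D') \<circ> (\<beta> \<circ> to_params D)"
  have \<gamma>: "bij_betw \<gamma> (colorings X D) (colorings X D')"
    unfolding \<gamma>_def by (intro bij_betw_trans[OF _ bij_betw_inv_into[OF tp']] bij_betw_trans[OF tp b(1)])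
  have comm: "\<gamma> (compose (semiarcs D) \<phi> f) = compose (semiarcs D') \<phi> (\<gamma> f)"
    if f: "f \<in> colorings X D" and \<phi>: "\<phi> \<in> S" for f \<phi>
  proof -
    have \<phi>': "\<phi> \<in> psyquandle_hom X X" using S \<phi> by blast
    have tg: "to_params D' (\<gamma> h) = \<beta> (to_params D h)" if "h \<in> colorings X D" for h
      using bij_betw_inv_into_right[OF tp' bij_betw_apply[OF b(1) bij_betw_apply[OF tp that]]]
      by (simp add: \<gamma>_def)
    have "to_params D' (\<gamma> (compose (semiarcs D) \<phi> f)) = to_params D' (compose (semiarcs D') \<phi> (\<gamma> f))"
      using tg[OF D.compose_in_colorings[OF f \<phi>']] tg[OF f] b(2)[OF D.to_params_in[OF f] \<phi>]
      by (simp add: D.to_params_compose D'.to_params_compose)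
    then show ?thesis
      using D'.to_params_inj[OF bij_betw_apply[OF \<gamma> D.compose_in_colorings[OF f \<phi>']]
          D'.compose_in_colorings[OF bij_betw_apply[OF \<gamma> f] \<phi>']] by blast
  qed
  \<comment> \<open>Edges keep their endomorphism. The record also carries the head and tail maps of
    the image, which are those of the target quiver.\<close>
  define h where "h = \<lparr>iso_verts = \<gamma>, iso_arcs = (\<lambda>(f, \<phi>). (\<gamma> f, \<phi>)),
    iso_head = head (coloring_quiver X S D'), iso_tail = tail (coloring_quiver X S D')\<rparr>"
  have "pre_digraph.digraph_isomorphism (coloring_quiver X S D) h"
    unfolding pre_digraph.digraph_isomorphism_def
  proof (intro conjI ballI)
    show "wf_digraph (coloring_quiver X S D)"
      by unfold_locales (use D.compose_in_colorings S in \<open>auto simp: coloring_quiver_def\<close>)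
    show "inj_on (iso_verts h) (verts (coloring_quiver X S D))"
      using bij_betw_imp_inj_on[OF \<gamma>] by (simp add: h_def coloring_quiver_def)
    show "inj_on (iso_arcs h) (arcs (coloring_quiver X S D))"
      using bij_betw_imp_inj_on[OF \<gamma>] by (auto simp: h_def coloring_quiver_def inj_on_def)
  qed (use comm in \<open>auto simp: h_def coloring_quiver_def\<close>)
  moreover have "(\<lambda>(f, \<phi>). (\<gamma> f, \<phi>)) ` (colorings X D \<times> S) = colorings X D' \<times> S"
    using bij_betw_imp_surj_on[OF \<gamma>] by force
  then have "coloring_quiver X S D' = app_iso h (coloring_quiver X S D)"
    using bij_betw_imp_surj_on[OF \<gamma>] by (simp add: app_iso_def h_def coloring_quiver_def)
  ultimately show ?thesis unfolding digraph_iso_def by blast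
qed

section \<open>Planar isotopy and reparametrization\<close>

text \<open>Monotonicity together with surjectivity is what transports one-sided neighbourhoods, and
  with them left and right limits.\<close>

definition strict_surj :: "(real \<Rightarrow> real) \<Rightarrow> bool" where
  "strict_surj \<theta> \<longleftrightarrow> strict_mono \<theta> \<and> surj \<theta>"

lemma strict_surj_at_left:
  assumes "strict_surj \<theta>" "\<forall>\<^sub>F t in at_left (\<theta> x). P t"
  shows "\<forall>\<^sub>F t in at_left x. P (\<theta> t)"
proof -
  obtain b where b: "b < \<theta> x" "\<And>t. b < t \<Longrightarrow> t < \<theta> x \<Longrightarrow> P t"
    using assms(2) by (auto simp: eventually_at_left_field)
  obtain c where "b = \<theta> c" using assms(1) by (metis strict_surj_def surjD)
  then show ?thesis
    unfolding eventually_at_left_field using b assms(1) strict_mono_less[of \<theta>]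
    by (intro exI[of _ c]) (auto simp: strict_surj_def)
qed

lemma strict_surj_at_right:
  assumes "strict_surj \<theta>" "\<forall>\<^sub>F t in at_right (\<theta> x). P t"
  shows "\<forall>\<^sub>F t in at_right x. P (\<theta> t)"
proof -
  obtain b where b: "\<theta> x < b" "\<And>t. \<theta> x < t \<Longrightarrow> t < b \<Longrightarrow> P t"
    using assms(2) by (auto simp: eventually_at_right_field)
  obtain c where "b = \<theta> c" using assms(1) by (metis strict_surj_def surjD)
  then show ?thesis
    unfolding eventually_at_right_field using b assms(1) strict_mono_less[of \<theta>]
    by (intro exI[of _ c]) (auto simp: strict_surj_def)
qed

lemma strict_surj_inv:
  assumes "strict_surj \<theta>" shows "strict_surj (inv \<theta>)"
proof -
  have "inj \<theta>" "surj \<theta>" using assms strict_mono_imp_inj_on by (auto simp: strict_surj_def)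
  moreover have "strict_mono (inv \<theta>)"
    using assms strict_mono_inv[of \<theta>] \<open>inj \<theta>\<close> by (simp add: strict_surj_def)
  ultimately show ?thesis by (simp add: strict_surj_def inj_imp_surj_inv)
qed

definition pull :: "singular_diagram \<Rightarrow> (nat \<times> real \<Rightarrow> nat \<times> real) \<Rightarrow> (nat \<times> real \<Rightarrow> 'a) \<Rightarrow>
    nat \<times> real \<Rightarrow> 'a" where
  "pull D \<Phi> g p = (if p \<in> params D then g (\<Phi> p) else undefined)"

text \<open>A map of Gauss diagrams: up to renumbering and reparametrization it preserves the
  crossing pairs with their directions and types, the data that govern
  \<open>param_colorings\<close>.\<close>

definition gauss_map :: "singular_diagram \<Rightarrow> singular_diagram \<Rightarrow> (nat \<times> real \<Rightarrow> nat \<times> real) \<Rightarrow> bool" where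
  "gauss_map D D' \<Phi> \<longleftrightarrow>
     (\<exists>\<pi> \<theta>. (\<forall>i<ncomp D'. \<pi> i < ncomp D \<and> strict_surj (\<theta> i) \<and> (\<forall>t. \<theta> i (t + 1) = \<theta> i t + 1)) \<and>
        (\<forall>i<ncomp D'. \<forall>t. \<Phi> (i, t) = (\<pi> i, \<theta> i t))) \<and>
     (\<forall>p\<in>params D'. crossing_param D' p \<longleftrightarrow> crossing_param D (\<Phi> p)) \<and>
     (\<forall>p q. crosses D' p q \<longrightarrow> crosses D (\<Phi> p) (\<Phi> q) \<and>
        turn D' p q = turn D (\<Phi> p) (\<Phi> q) \<and>
        (pt D' p \<in> sing D' \<longleftrightarrow> pt D (\<Phi> p) \<in> sing D) \<and> (p \<in> over D' \<longleftrightarrow> \<Phi> p \<in> over D))"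

lemma pull_in:
  assumes D: "is_singular_diagram D" and D': "is_singular_diagram D'"
    and \<Phi>: "gauss_map D D' \<Phi>" and g: "g \<in> param_colorings X D"
  shows "pull D' \<Phi> g \<in> param_colorings X D'"
proof -
  interpret D: diagram D by unfold_locales (rule D)
  interpret D': diagram D' by unfold_locales (rule D')
  obtain \<pi> \<theta> where
    *: "\<forall>i<ncomp D'. \<pi> i < ncomp D \<and> strict_surj (\<theta> i) \<and> (\<forall>t. \<theta> i (t + 1) = \<theta> i t + 1)"
      "\<forall>i<ncomp D'. \<forall>t. \<Phi> (i, t) = (\<pi> i, \<theta> i t)"
    using \<Phi>[unfolded gauss_map_def, THEN conjunct1] by blast
  then have \<pi>: "\<pi> i < ncomp D" and \<theta>: "strict_surj (\<theta> i)" "\<theta> i (t + 1) = \<theta> i t + 1"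
    and \<Phi>_eq: "\<Phi> (i, t) = (\<pi> i, \<theta> i t)" if "i < ncomp D'" for i t
    using that by simp_all
  have \<Phi>p: "\<Phi> p \<in> params D" if "p \<in> params D'" for p
    using that \<pi> \<Phi>_eq by (cases p) (auto simp: params_iff)
  have cp: "crossing_param D' p \<longleftrightarrow> crossing_param D (\<Phi> p)" if "p \<in> params D'" for p
    using \<Phi> that unfolding gauss_map_def by blast
  have pull_eq: "pull D' \<Phi> g (i, t) = g (\<pi> i, \<theta> i t)" if "i < ncomp D'" for i t
    using that \<Phi>_eq by (simp add: pull_def params_iff)
  have left: "\<forall>\<^sub>F t in at_left (snd p). pull D' \<Phi> g (fst p, t) = v"
    if p: "p \<in> params D'" and "\<forall>\<^sub>F t in at_left (snd (\<Phi> p)). g (fst (\<Phi> p), t) = v" for p v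
  proof (cases p)
    case (Pair i x)
    have i: "i < ncomp D'" using p Pair by (simp add: params_iff)
    then have "\<forall>\<^sub>F t in at_left (\<theta> i x). g (\<pi> i, t) = v" using that(2) Pair \<Phi>_eq by simp
    from strict_surj_at_left[OF \<theta>(1)[OF i] this] show ?thesis using Pair by (simp add: pull_eq[OF i])
  qed
  have right: "\<forall>\<^sub>F t in at_right (snd p). pull D' \<Phi> g (fst p, t) = v"
    if p: "p \<in> params D'" and "\<forall>\<^sub>F t in at_right (snd (\<Phi> p)). g (fst (\<Phi> p), t) = v" for p v
  proof (cases p)
    case (Pair i x)
    have i: "i < ncomp D'" using p Pair by (simp add: params_iff)
    then have "\<forall>\<^sub>F t in at_right (\<theta> i x). g (\<pi> i, t) = v" using that(2) Pair \<Phi>_eq by simp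
    from strict_surj_at_right[OF \<theta>(1)[OF i] this] show ?thesis using Pair by (simp add: pull_eq[OF i])
  qed
  have lims: "left_limit (pull D' \<Phi> g) p = left_limit g (\<Phi> p)"
    "right_limit (pull D' \<Phi> g) p = right_limit g (\<Phi> p)" if p: "p \<in> params D'" for p
    using left_limitI[OF left[OF p D.left_limit_attained(1)[OF g \<Phi>p[OF p]]]]
      right_limitI[OF right[OF p D.right_limit_attained(1)[OF g \<Phi>p[OF p]]]] by blast+
  have undef: "pull D' \<Phi> g p = undefined" if "\<not> (p \<in> params D' \<and> \<not> crossing_param D' p)" for p
    using param_colorings_undefined[OF g, of "\<Phi> p"] that cp by (auto simp: pull_def)
  have "pull D' \<Phi> g p \<in> carrier X" if "p \<in> params D'" "\<not> crossing_param D' p" for p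
    using D.value_in[OF g, of "fst (\<Phi> p)" "snd (\<Phi> p)"] \<Phi>p[OF that(1)] that cp by (simp add: pull_def params_iff)
  moreover have "pull D' \<Phi> g (i, t + 1) = pull D' \<Phi> g (i, t)" for i t
    using pull_eq \<theta>(2) g by (cases "i < ncomp D'") (auto simp: param_colorings_def pull_def params_iff)
  moreover have "\<forall>\<^sub>F t in at (snd p). pull D' \<Phi> g (fst p, t) = pull D' \<Phi> g p"
    if p: "p \<in> params D'" "\<not> crossing_param D' p" for p
  proof -
    have "\<forall>\<^sub>F t in at (snd (\<Phi> p)). g (fst (\<Phi> p), t) = g (\<Phi> p)"
      using g \<Phi>p[OF p(1)] cp[OF p(1)] p(2) unfolding param_colorings_def by blast
    then show ?thesis
      using left[OF p(1), of "g (\<Phi> p)"] right[OF p(1), of "g (\<Phi> p)"] p(1)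
      by (simp add: eventually_at_split pull_def)
  qed
  moreover have "rule_at X D' (pull D' \<Phi> g) p q" if c: "crosses D' p q" for p q
  proof -
    have c': "crosses D' q p" by (rule crosses_commute[OF c])
    have \<Phi>': "crosses D (\<Phi> p) (\<Phi> q) \<and> turn D' p q = turn D (\<Phi> p) (\<Phi> q) \<and>
        (pt D' p \<in> sing D' \<longleftrightarrow> pt D (\<Phi> p) \<in> sing D) \<and> (p \<in> over D' \<longleftrightarrow> \<Phi> p \<in> over D)"
      if "crosses D' p q" for p q using \<Phi> that unfolding gauss_map_def by blast
    have "strand_op X D' p q = strand_op X D (\<Phi> p) (\<Phi> q)" "strand_op X D' q p = strand_op X D (\<Phi> q) (\<Phi> p)"
      using \<Phi>'[OF c] \<Phi>'[OF c'] by (simp_all add: strand_op_def)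
    moreover have "rule_at X D g (\<Phi> p) (\<Phi> q)" using param_colorings_rule[OF g] \<Phi>'[OF c] by blast
    ultimately show ?thesis
      using \<Phi>'[OF c] lims D'.crosses_params[OF c] by (simp add: rule_at_def)
  qed
  ultimately show ?thesis using undef unfolding param_colorings_def by simp
qed

lemma gauss_equiv:
  assumes D: "is_singular_diagram D" and D': "is_singular_diagram D'" and S: "S \<subseteq> psyquandle_hom X X"
    and \<Phi>: "gauss_map D D' \<Phi>" and \<Psi>: "gauss_map D' D \<Psi>"
    and inv: "\<And>p. p \<in> params D \<Longrightarrow> \<Phi> (\<Psi> p) = p" "\<And>p. p \<in> params D' \<Longrightarrow> \<Psi> (\<Phi> p) = p"
  shows "coloring_equiv X S D D'"
proof -
  have \<Phi>p: "\<Phi> p \<in> params D" if "p \<in> params D'" for p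
    using that \<Phi> by (cases p) (auto simp: params_iff gauss_map_def)
  have \<Psi>p: "\<Psi> p \<in> params D'" if "p \<in> params D" for p
    using that \<Psi> by (cases p) (auto simp: params_iff gauss_map_def)
  have cp: "crossing_param D' p \<longleftrightarrow> crossing_param D (\<Phi> p)" if "p \<in> params D'" for p
    using \<Phi> that unfolding gauss_map_def by blast
  have inv1: "pull D \<Psi> (pull D' \<Phi> g) = g" if "g \<in> param_colorings X D" for g
    using param_colorings_undefined[OF that] inv \<Psi>p by (auto simp: pull_def)
  have inv2: "pull D' \<Phi> (pull D \<Psi> g) = g" if "g \<in> param_colorings X D'" for g
    using param_colorings_undefined[OF that] inv \<Phi>p by (auto simp: pull_def)
  show ?thesis
  proof (rule coloring_equivI[OF D' S _ _ _ _ _ D, where R = "\<lambda>g g'. g' = pull D' \<Phi> g"])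
    fix g g' \<phi> assume "g' = pull D' \<Phi> g"
    then show "push D' \<phi> g' = pull D' \<Phi> (push D \<phi> g)"
      using cp \<Phi>p by (auto simp: push_def pull_def)
  next
    fix g assume "g \<in> param_colorings X D"
    then show "\<exists>g'\<in>param_colorings X D'. g' = pull D' \<Phi> g" using pull_in[OF D D' \<Phi>] by blast
  next
    fix g' assume g': "g' \<in> param_colorings X D'"
    then show "\<exists>g\<in>param_colorings X D. g' = pull D' \<Phi> g"
      using pull_in[OF D' D \<Psi> g'] inv2[OF g'] by (intro bexI[of _ "pull D \<Psi> g'"]) simp_all
  next
    fix g g\<^sub>1 g\<^sub>2 assume g: "g\<^sub>1 \<in> param_colorings X D" "g\<^sub>2 \<in> param_colorings X D"
      and "g = pull D' \<Phi> g\<^sub>1" "g = pull D' \<Phi> g\<^sub>2"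
    then have "pull D \<Psi> (pull D' \<Phi> g\<^sub>1) = pull D \<Psi> (pull D' \<Phi> g\<^sub>2)" by metis
    then show "g\<^sub>1 = g\<^sub>2" using inv1[OF g(1)] inv1[OF g(2)] by metis
  qed blast
qed

text \<open>\<open>Im (cnj u * v)\<close> is the determinant of \<open>u\<close> and
  \<open>v\<close>, and the first factor on the right is the determinant of
  \<open>A\<close>.\<close>

lemma isotopy_turn:
  assumes "linear A" "bij A"
  shows "Im (cnj (A u) * A v) = Im (cnj (A 1) * A \<i>) * Im (cnj u * v)"
proof -
  have e: "A w = of_real (Re w) * A 1 + of_real (Im w) * A \<i>" for w
  proof -
    have "w = Re w *\<^sub>R 1 + Im w *\<^sub>R \<i>" by (simp add: complex_eq_iff)
    then have "A w = A (Re w *\<^sub>R 1 + Im w *\<^sub>R \<i>)" by (rule arg_cong)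
    also have "\<dots> = Re w *\<^sub>R A 1 + Im w *\<^sub>R A \<i>"
      by (simp only: linear_add[OF assms(1)] linear_scale[OF assms(1)])
    finally show ?thesis by (simp add: scaleR_conv_of_real)
  qed
  show ?thesis by (subst (1 2) e) (simp add: algebra_simps)
qed

text \<open>If the determinant vanished, \<open>A \<i>\<close> would be the real multiple of
  \<open>A 1\<close> with the projection coefficient \<open>c\<close>, against injectivity.\<close>

lemma isotopy_det_nonzero:
  assumes A: "linear A" "bij A"
  shows "Im (cnj (A 1) * A \<i>) \<noteq> 0"
proof
  assume 0: "Im (cnj (A 1) * A \<i>) = 0"
  have nz: "A 1 \<noteq> 0"
    using bij_is_inj[OF A(2)] linear_0[OF A(1)] by (metis injD zero_neq_one)
  define c where "c = Re (cnj (A 1) * A \<i>) / (cmod (A 1))\<^sup>2"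
  have "cnj (A 1) * A \<i> = of_real (Re (cnj (A 1) * A \<i>))" using 0 by (simp add: complex_eq_iff)
  then have "A 1 * (cnj (A 1) * A \<i>) = of_real (Re (cnj (A 1) * A \<i>)) * A 1" by (simp add: mult.commute)
  then have "of_real ((cmod (A 1))\<^sup>2) * A \<i> = of_real (Re (cnj (A 1) * A \<i>)) * A 1"
    by (simp only: complex_norm_square mult.assoc)
  then have "A \<i> = of_real c * A 1" using nz unfolding c_def by (simp add: field_simps)
  also have "\<dots> = A (of_real c)" using linear_scale[OF A(1), of c 1] by (simp add: scaleR_conv_of_real)
  finally have "\<i> = of_real c" using bij_is_inj[OF A(2)] by (simp add: injD)
  then show False by (simp add: complex_eq_iff)
qed

text \<open>Along the isotopy the determinant of the derivative at \<open>z\<close> starts at 1, is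
  continuous and never zero.\<close>

lemma isotopy_det_pos:
  assumes H: "diffeotopy H"
    and H': "\<And>s z. s \<in> {0..1} \<Longrightarrow> (H s has_derivative blinfun_apply (H' s z)) (at z) \<and> bij (blinfun_apply (H' s z))"
    and cont: "continuous_on ({0..1} \<times> UNIV) (\<lambda>(s, z). H' s z :: complex \<Rightarrow>\<^sub>L complex)"
  shows "0 < Im (cnj (H' 1 z 1) * H' 1 z \<i>)"
proof (rule ccontr)
  let ?d = "\<lambda>s. Im (cnj (H' s z 1) * H' s z \<i>)"
  assume "\<not> 0 < ?d 1"
  have "continuous_on {0..1} (\<lambda>s. (s, z))" by (intro continuous_intros)
  then have "continuous_on {0..1} (\<lambda>s. H' s z)"
    using continuous_on_compose2[OF cont, of "{0..1}" "\<lambda>s. (s, z)"] by auto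
  then have c: "continuous_on {0..1} ?d" by (intro continuous_intros)
  have "H 0 = id" using H by (auto simp: diffeotopy_def)
  then have "blinfun_apply (H' 0 z) = id"
    using has_derivative_unique[of id "blinfun_apply (H' 0 z)" z id] H'[of 0 z] by simp
  then have "?d 0 = 1" by simp
  then obtain s where s: "0 \<le> s" "s \<le> 1" "?d s = 0"
    using IVT2'[of ?d 1 0 0] c \<open>\<not> 0 < ?d 1\<close> by auto
  have "linear (blinfun_apply (H' s z))" by (rule bounded_linear.linear[OF blinfun.bounded_linear_right])
  moreover have "bij (blinfun_apply (H' s z))" using H'[of s z] s by simp
  ultimately show False using isotopy_det_nonzero s(3) by blast
qed

text \<open>Parameters stay fixed under an isotopy, so the identity is the map of Gauss diagrams.
  The chain rule and the positive determinant show that directions at crossings are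
  preserved.\<close>

lemma planar_isotopy_equiv:
  assumes D: "is_singular_diagram D" and D': "is_singular_diagram D'" and S: "S \<subseteq> psyquandle_hom X X"
    and iso: "planar_isotopic D D'"
  shows "coloring_equiv X S D D'"
proof -
  interpret D: diagram D by unfold_locales (rule D)
  interpret D': diagram D' by unfold_locales (rule D')
  obtain H where H: "diffeotopy H" and n: "ncomp D' = ncomp D"
    and pt: "\<And>p. p \<in> params D \<Longrightarrow> pt D' p = H 1 (pt D p)"
    and over: "\<And>p. p \<in> params D \<Longrightarrow> p \<in> over D' \<longleftrightarrow> p \<in> over D" and sing: "sing D' = H 1 ` sing D"
    using iso unfolding planar_isotopic_def by blast
  obtain H' :: "real \<Rightarrow> complex \<Rightarrow> complex \<Rightarrow>\<^sub>L complex" where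
    H': "\<And>s z. s \<in> {0..1} \<Longrightarrow> (H s has_derivative blinfun_apply (H' s z)) (at z) \<and> bij (blinfun_apply (H' s z))"
    and H'c: "continuous_on ({0..1} \<times> UNIV) (\<lambda>(s, z). H' s z)"
    using H unfolding diffeotopy_def by blast
  have params: "params D' = params D" by (simp add: params_def n)
  have inj: "inj (H 1)" using H by (auto simp: diffeotopy_def bij_is_inj)
  have crosses: "crosses D' p q \<longleftrightarrow> crosses D p q" for p q
    using pt[of p] pt[of q] inj_eq[OF inj] unfolding crosses_def params by metis
  have tangent: "tangent D' (i, t) = H' 1 (pt D (i, t)) (tangent D (i, t))" if i: "i < ncomp D" for i t
  proof -
    have "curve D' i = H 1 \<circ> curve D i" using pt[of "(i, _)"] i by (auto simp: pt_def params_iff)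
    moreover have "(H 1 has_derivative blinfun_apply (H' 1 (pt D (i, t)))) (at (curve D i t))"
      using H'[of 1 "pt D (i, t)"] by (simp add: pt_def)
    then have "((H 1 \<circ> curve D i) has_vector_derivative H' 1 (pt D (i, t)) (tangent D (i, t))) (at t)"
      using vector_derivative_diff_chain_within[OF D.has_tangent[OF i, of t]] has_derivative_at_withinI by blast
    ultimately show ?thesis unfolding tangent_def[of D'] by (simp add: vector_derivative_at)
  qed
  have turn: "turn D' p q = turn D p q" if c: "crosses D p q" for p q
  proof -
    have pq: "pt D q = pt D p" "fst p < ncomp D" "fst q < ncomp D" using c by (auto simp: crosses_def params_iff)
    let ?A = "blinfun_apply (H' 1 (pt D p))"
    have A: "linear ?A" "bij ?A" using H'[of 1 "pt D p"] bounded_linear.linear[OF blinfun.bounded_linear_right] by auto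
    have "tangent D' p = ?A (tangent D p)" "tangent D' q = ?A (tangent D q)"
      using tangent[of "fst p" "snd p"] tangent[of "fst q" "snd q"] pq by simp_all
    then show ?thesis
      using isotopy_turn[OF A] isotopy_det_pos[OF H H' H'c, of "pt D p"]
      by (metis turn_def sgn_mult sgn_pos mult_1)
  qed
  have sing': "pt D' p \<in> sing D' \<longleftrightarrow> pt D p \<in> sing D" if "p \<in> params D" for p
    using pt[OF that] sing inj_image_mem_iff[OF inj] by simp
  have id: "\<exists>\<pi> \<theta>. (\<forall>i<n. \<pi> i < n \<and> strict_surj (\<theta> i) \<and> (\<forall>t. \<theta> i (t + 1) = \<theta> i t + 1)) \<and>
        (\<forall>i<n. \<forall>t. id (i, t) = (\<pi> i, \<theta> i t))" for n :: nat
    by (rule exI[of _ id], rule exI[of _ "\<lambda>_. id"]) (auto simp: strict_surj_def strict_mono_def)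
  have "gauss_map D D' id" "gauss_map D' D id"
    unfolding gauss_map_def using id n over sing' turn crosses D.crosses_params
    by (auto simp: crossing_param_def params)
  then show ?thesis by (rule gauss_equiv[OF D D' S]) auto
qed

text \<open>The reparametrization is itself the map of Gauss diagrams. Tangents are rescaled by
  positive derivatives, which leaves the sign \<open>turn\<close> unchanged.\<close>

lemma reparametrized_equiv:
  assumes D: "is_singular_diagram D" and D': "is_singular_diagram D'" and S: "S \<subseteq> psyquandle_hom X X"
    and rep: "reparametrized D D'"
  shows "coloring_equiv X S D D'"
proof -
  interpret D: diagram D by unfold_locales (rule D)
  interpret D': diagram D' by unfold_locales (rule D')
  have n: "ncomp D' = ncomp D" and sing: "sing D' = sing D" using rep by (auto simp: reparametrized_def)
  obtain \<pi> \<theta> where \<pi>: "bij_betw \<pi> {..<ncomp D} {..<ncomp D}"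
    and der: "\<And>i t. i < ncomp D \<Longrightarrow> \<exists>d>0. (\<theta> i has_real_derivative d) (at t)"
    and per: "\<And>i t. i < ncomp D \<Longrightarrow> \<theta> i (t + 1) = \<theta> i t + 1"
    and curve: "\<And>i t. i < ncomp D \<Longrightarrow> curve D' i t = curve D (\<pi> i) (\<theta> i t)"
    and over: "\<And>i t. i < ncomp D \<Longrightarrow> (i, t) \<in> over D' \<longleftrightarrow> (\<pi> i, \<theta> i t) \<in> over D"
    using rep unfolding reparametrized_def by blast
  have \<pi>n: "\<pi> i < ncomp D" if "i < ncomp D" for i using bij_betw_apply[OF \<pi>] that by simp
  have pern: "\<theta> i (t + of_int m) = \<theta> i t + of_int m" if "i < ncomp D" for i t m
    using periodic_shift[of "\<lambda>(i, t). \<theta> i t - t" i t m] per[OF that] by (simp add: algebra_simps)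
  have \<theta>: "strict_surj (\<theta> i)" if i: "i < ncomp D" for i
    unfolding strict_surj_def
  proof
    show "strict_mono (\<theta> i)"
      by (rule strict_monoI) (use der[OF i] DERIV_pos_imp_increasing in blast)
    have c: "continuous_on S (\<theta> i)" for S
      by (intro continuous_at_imp_continuous_on ballI) (use der[OF i] DERIV_isCont in blast)
    show "surj (\<theta> i)"
      unfolding surj_def
    proof
      fix y
      \<comment> \<open>As \<open>\<theta> i\<close> commutes with integer shifts, \<open>y\<close>
        lies between its values at \<open>m\<close> and \<open>m + 1\<close>.\<close>
      define m where "m = \<lfloor>y - \<theta> i 0\<rfloor>"
      have "\<theta> i (0 + of_int m) \<le> y" "y \<le> \<theta> i (0 + of_int (m + 1))"
        unfolding pern[OF i] m_def by linarith+
      then show "\<exists>x. y = \<theta> i x"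
        using IVT'[of "\<theta> i" "of_int m" y "of_int (m + 1)"] c by auto
    qed
  qed
  define \<Phi> where "\<Phi> = (\<lambda>(i, t). (\<pi> i, \<theta> i t))"
  define \<rho> where "\<rho> = inv_into {..<ncomp D} \<pi>"
  define \<Psi> where "\<Psi> = (\<lambda>(i, t). (\<rho> i, inv (\<theta> (\<rho> i)) t))"
  have \<rho>: "\<rho> i < ncomp D" "\<pi> (\<rho> i) = i" if "i < ncomp D" for i
    using bij_betw_apply[OF bij_betw_inv_into[OF \<pi>]] bij_betw_inv_into_right[OF \<pi>] that
    by (auto simp: \<rho>_def)
  have \<rho>\<pi>: "\<rho> (\<pi> i) = i" if "i < ncomp D" for i
    using bij_betw_inv_into_left[OF \<pi>] that by (simp add: \<rho>_def)
  have \<theta>inv: "\<theta> i (inv (\<theta> i) t) = t" "inv (\<theta> i) (\<theta> i t) = t" if "i < ncomp D" for i t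
    using \<theta>[OF that] by (auto simp: strict_surj_def surj_f_inv_f strict_mono_eq intro!: inv_f_f strict_mono_imp_inj_on)
  have params: "params D' = params D" by (simp add: params_def n)
  have \<Phi>\<Psi>: "\<Phi> (\<Psi> p) = p" "\<Psi> p \<in> params D" if "p \<in> params D" for p
    using that \<rho> \<theta>inv by (cases p; simp add: \<Phi>_def \<Psi>_def params_iff)+
  have \<Psi>\<Phi>: "\<Psi> (\<Phi> p) = p" "\<Phi> p \<in> params D" if "p \<in> params D" for p
    using that \<rho>\<pi> \<theta>inv \<pi>n by (cases p; simp add: \<Phi>_def \<Psi>_def params_iff)+
  have pt: "pt D' p = pt D (\<Phi> p)" if "p \<in> params D" for p
    using that curve by (cases p) (simp add: \<Phi>_def pt_def params_iff)
  have same: "same_param p q \<longleftrightarrow> same_param (\<Phi> p) (\<Phi> q)" if "p \<in> params D" "q \<in> params D" for p q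
  proof
    define i t j u where "i = fst p" "t = snd p" "j = fst q" "u = snd q"
    then have pq: "p = (i, t)" "q = (j, u)" "i < ncomp D" "j < ncomp D"
      using that by (simp_all add: params_iff)
    show "same_param (\<Phi> p) (\<Phi> q)" if "same_param p q"
      using that by (rule same_paramE) (use pq pern in \<open>auto simp: \<Phi>_def same_param_def\<close>)
    assume "same_param (\<Phi> p) (\<Phi> q)"
    then have "\<pi> i = \<pi> j" "\<theta> i t - \<theta> j u \<in> \<int>" using pq by (auto simp: \<Phi>_def same_param_def)
    then have "i = j" using inj_onD[OF bij_betw_imp_inj_on[OF \<pi>]] pq by auto
    obtain m where "\<theta> i t - \<theta> i u = of_int m" using \<open>\<theta> i t - \<theta> j u \<in> \<int>\<close> \<open>i = j\<close> by (auto elim: Ints_cases)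
    then have "\<theta> i t = \<theta> i (u + of_int m)" using pern[OF pq(3)] by simp
    then have "t = u + of_int m" using \<theta>[OF pq(3)] by (simp add: strict_surj_def strict_mono_eq)
    then show "same_param p q" using pq \<open>i = j\<close> by (simp add: same_param_def)
  qed
  have crosses: "crosses D' p q \<longleftrightarrow> crosses D (\<Phi> p) (\<Phi> q)" if "p \<in> params D" "q \<in> params D" for p q
    using that pt same \<Psi>\<Phi> by (simp add: crosses_def params)
  have cp: "crossing_param D' p \<longleftrightarrow> crossing_param D (\<Phi> p)" if p: "p \<in> params D" for p
  proof
    assume "crossing_param D' p"
    then obtain q where q: "crosses D' p q" by (auto simp: crossing_param_def)
    then show "crossing_param D (\<Phi> p)"
      using crosses[OF p, of q] D'.crosses_params[OF q] unfolding crossing_param_def params by blast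
  next
    assume "crossing_param D (\<Phi> p)"
    then obtain q where q: "crosses D (\<Phi> p) q" by (auto simp: crossing_param_def)
    then have "q \<in> params D" using D.crosses_params by blast
    then show "crossing_param D' p"
      using crosses[OF p, of "\<Psi> q"] \<Phi>\<Psi>[of q] q unfolding crossing_param_def by metis
  qed
  have tangent: "\<exists>d>0. tangent D' p = of_real d * tangent D (\<Phi> p)" if "p \<in> params D" for p
  proof -
    define i t where "i = fst p" "t = snd p"
    then have p: "p = (i, t)" "i < ncomp D" using that by (simp_all add: params_iff)
    obtain d where d: "d > 0" "(\<theta> i has_real_derivative d) (at t)" using der[OF p(2)] by blast
    have "curve D' i = curve D (\<pi> i) \<circ> \<theta> i" using curve[OF p(2)] by auto
    moreover have "((curve D (\<pi> i) \<circ> \<theta> i) has_vector_derivative d *\<^sub>R tangent D (\<pi> i, \<theta> i t)) (at t)"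
      using d(2) D.has_tangent[OF \<pi>n[OF p(2)]]
      by (intro vector_diff_chain_at) (simp_all add: has_real_derivative_iff_has_vector_derivative)
    ultimately have "tangent D' p = d *\<^sub>R tangent D (\<pi> i, \<theta> i t)"
      unfolding tangent_def[of D'] p by (simp add: vector_derivative_at)
    then show ?thesis using d(1) p(1) by (auto simp: \<Phi>_def scaleR_conv_of_real)
  qed
  have turn: "turn D' p q = turn D (\<Phi> p) (\<Phi> q)" if p: "p \<in> params D" and q: "q \<in> params D" for p q
  proof -
    obtain d e where de: "d > 0" "e > 0" "tangent D' p = of_real d * tangent D (\<Phi> p)"
      "tangent D' q = of_real e * tangent D (\<Phi> q)" using tangent[OF p] tangent[OF q] by blast
    have "Im (cnj (tangent D' p) * tangent D' q) = (d * e) * Im (cnj (tangent D (\<Phi> p)) * tangent D (\<Phi> q))"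
      unfolding de(3,4) by (simp add: algebra_simps)
    moreover have "sgn (d * e) = 1" using de by simp
    ultimately show ?thesis by (simp only: turn_def sgn_mult[of "d * e"] mult_1)
  qed
  have over': "p \<in> over D' \<longleftrightarrow> \<Phi> p \<in> over D" if "p \<in> params D" for p
    using that over by (cases p) (simp add: \<Phi>_def params_iff)
  have pq': "p \<in> params D \<and> q \<in> params D" if "crosses D' p q" for p q
    using D'.crosses_params[OF that] by (simp add: params)
  have "gauss_map D D' \<Phi>"
    unfolding gauss_map_def
  proof (intro conjI)
    show "\<exists>\<pi> \<theta>. (\<forall>i<ncomp D'. \<pi> i < ncomp D \<and> strict_surj (\<theta> i) \<and> (\<forall>t. \<theta> i (t + 1) = \<theta> i t + 1)) \<and>
        (\<forall>i<ncomp D'. \<forall>t. \<Phi> (i, t) = (\<pi> i, \<theta> i t))"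
      by (rule exI[of _ \<pi>], rule exI[of _ \<theta>]) (use \<pi>n \<theta> per n in \<open>simp add: \<Phi>_def\<close>)
    show "\<forall>p\<in>params D'. crossing_param D' p \<longleftrightarrow> crossing_param D (\<Phi> p)" using cp by (simp add: params)
    show "\<forall>p q. crosses D' p q \<longrightarrow> crosses D (\<Phi> p) (\<Phi> q) \<and>
        turn D' p q = turn D (\<Phi> p) (\<Phi> q) \<and>
        (pt D' p \<in> sing D' \<longleftrightarrow> pt D (\<Phi> p) \<in> sing D) \<and> (p \<in> over D' \<longleftrightarrow> \<Phi> p \<in> over D)"
      using pq' crosses turn pt over' sing by metis
  qed
  moreover have "gauss_map D' D \<Psi>"
    unfolding gauss_map_def
  proof (intro conjI)
    have "inv (\<theta> i) (t + 1) = inv (\<theta> i) t + 1" if "i < ncomp D" for i t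
      using \<theta>inv(2)[OF that, of "inv (\<theta> i) t + 1"] \<theta>inv(1)[OF that] per[OF that] by simp
    then show "\<exists>\<pi> \<theta>. (\<forall>i<ncomp D. \<pi> i < ncomp D' \<and> strict_surj (\<theta> i) \<and> (\<forall>t. \<theta> i (t + 1) = \<theta> i t + 1)) \<and>
        (\<forall>i<ncomp D. \<forall>t. \<Psi> (i, t) = (\<pi> i, \<theta> i t))"
      by (intro exI[of _ \<rho>] exI[of _ "\<lambda>i. inv (\<theta> (\<rho> i))"])
        (use \<rho> \<theta> strict_surj_inv n in \<open>simp add: \<Psi>_def\<close>)
    show "\<forall>p\<in>params D. crossing_param D p \<longleftrightarrow> crossing_param D' (\<Psi> p)" using cp \<Phi>\<Psi> by simp
    show "\<forall>p q. crosses D p q \<longrightarrow> crosses D' (\<Psi> p) (\<Psi> q) \<and>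
        turn D p q = turn D' (\<Psi> p) (\<Psi> q) \<and>
        (pt D p \<in> sing D \<longleftrightarrow> pt D' (\<Psi> p) \<in> sing D') \<and> (p \<in> over D \<longleftrightarrow> \<Psi> p \<in> over D')"
    proof (intro allI impI)
      fix p q assume c: "crosses D p q"
      then have pq: "p \<in> params D" "q \<in> params D" using D.crosses_params by blast+
      note \<Psi> = \<Phi>\<Psi>[OF pq(1)] \<Phi>\<Psi>[OF pq(2)]
      show "crosses D' (\<Psi> p) (\<Psi> q) \<and> turn D p q = turn D' (\<Psi> p) (\<Psi> q) \<and>
        (pt D p \<in> sing D \<longleftrightarrow> pt D' (\<Psi> p) \<in> sing D') \<and> (p \<in> over D \<longleftrightarrow> \<Psi> p \<in> over D')"
        using c crosses[OF \<Psi>(2,4)] turn[OF \<Psi>(2,4)] pt[OF \<Psi>(2)] over'[OF \<Psi>(2)] sing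
        unfolding \<Psi> by simp
    qed
  qed
  ultimately show ?thesis
    by (rule gauss_equiv[OF D D' S]) (use \<Phi>\<Psi> \<Psi>\<Phi> in \<open>simp_all add: params\<close>)
qed

section \<open>Changes inside a disc\<close>

lemma shift_strict_surj: "strict_surj (\<lambda>t. t + d)"
  unfolding strict_surj_def by (auto simp: strict_mono_def surj_def intro: exI[of _ "_ - d"])

lemma eventually_at_left_shift:
  fixes g :: "nat \<times> real \<Rightarrow> 'a"
  assumes "\<And>t. g (i, t + of_int m) = g (i, t)"
  shows "(\<forall>\<^sub>F t in at_left (x + of_int m). g (i, t) = v) \<longleftrightarrow> (\<forall>\<^sub>F t in at_left x. g (i, t) = v)"
proof
  assume "\<forall>\<^sub>F t in at_left (x + of_int m). g (i, t) = v"
  from strict_surj_at_left[where \<theta> = "\<lambda>t. t + of_int m", OF shift_strict_surj this]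
  show "\<forall>\<^sub>F t in at_left x. g (i, t) = v" by (simp add: assms)
next
  assume "\<forall>\<^sub>F t in at_left x. g (i, t) = v"
  then have "\<forall>\<^sub>F t in at_left ((x + of_int m) + - of_int m). g (i, t + of_int m) = v" by (simp add: assms)
  from strict_surj_at_left[where \<theta> = "\<lambda>t. t + - of_int m", OF shift_strict_surj this] show "\<forall>\<^sub>F t in at_left (x + of_int m). g (i, t) = v"
    by simp
qed

lemma eventually_at_right_shift:
  fixes g :: "nat \<times> real \<Rightarrow> 'a"
  assumes "\<And>t. g (i, t + of_int m) = g (i, t)"
  shows "(\<forall>\<^sub>F t in at_right (x + of_int m). g (i, t) = v) \<longleftrightarrow> (\<forall>\<^sub>F t in at_right x. g (i, t) = v)"
proof
  assume "\<forall>\<^sub>F t in at_right (x + of_int m). g (i, t) = v"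
  from strict_surj_at_right[where \<theta> = "\<lambda>t. t + of_int m", OF shift_strict_surj this]
  show "\<forall>\<^sub>F t in at_right x. g (i, t) = v" by (simp add: assms)
next
  assume "\<forall>\<^sub>F t in at_right x. g (i, t) = v"
  then have "\<forall>\<^sub>F t in at_right ((x + of_int m) + - of_int m). g (i, t + of_int m) = v" by (simp add: assms)
  from strict_surj_at_right[where \<theta> = "\<lambda>t. t + - of_int m", OF shift_strict_surj this] show "\<forall>\<^sub>F t in at_right (x + of_int m). g (i, t) = v"
    by simp
qed

lemma limits_same_param:
  assumes per: "\<And>i t. g (i, t + 1) = g (i, t)" and "same_param p q"
  shows "left_limit g p = left_limit g q" "right_limit g p = right_limit g q"
proof -
  obtain m where p: "p = (fst q, snd q + of_int m)" using assms(2) by (rule same_paramE)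
  have sh: "g (fst q, t + of_int m) = g (fst q, t)" for t by (rule periodic_shift) (rule per)
  show "left_limit g p = left_limit g q" "right_limit g p = right_limit g q"
    unfolding left_limit_def right_limit_def p fst_conv snd_conv
    using eventually_at_left_shift[OF sh] eventually_at_right_shift[OF sh] by simp_all
qed

lemma (in diagram) rule_at_same_param:
  assumes per: "\<And>i t. g (i, t + 1) = g (i, t)" and c: "crosses D p q"
    and sp: "same_param p p'" "same_param q q'"
  shows "rule_at X D g p q \<longleftrightarrow> rule_at X D g p' q'"
  using strand_op_same_param[OF c sp, of X] strand_op_same_param[OF crosses_commute[OF c] sp(2,1), of X]
    turn_same_param[OF _ _ sp] crosses_params[OF c]
    limits_same_param[OF per sp(1)] limits_same_param[OF per sp(2)]
  by (simp add: rule_at_def)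

locale disc_arcs = diagram +
  fixes z :: complex and r :: real and k :: nat and c :: "nat \<Rightarrow> nat" and a b :: "nat \<Rightarrow> real"
  assumes meets: "meets_disc_in_arcs D z r k c a b"
begin

lemma arcs: "j < k \<Longrightarrow> c j < ncomp D" "j < k \<Longrightarrow> a j < b j"
  using meets by (auto simp: meets_disc_in_arcs_def)

lemma arcs_disjoint:
  assumes "j < k" "j' < k" "t \<in> {a j..b j}" "u \<in> {a j'..b j'}" "same_param (c j, t) (c j', u)"
  shows "j = j' \<and> t = u"
proof -
  obtain m :: int where m: "c j = c j'" "t = u + of_int m"
    using assms(5) by (rule same_paramE) auto
  then have "t \<in> {a j..b j} \<inter> {a j' + of_int m..b j' + of_int m}" using assms by auto
  then have "j = j' \<and> m = 0" using meets assms(1,2) m(1) unfolding meets_disc_in_arcs_def by blast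
  then show ?thesis using m by simp
qed

text \<open>An arc of at least a full period would contain two parameters that differ by 1.\<close>

lemma arc_short: "j < k \<Longrightarrow> b j < a j + 1"
proof (rule ccontr)
  assume j: "j < k" "\<not> b j < a j + 1"
  have "same_param (c j, a j) (c j, a j + 1)" using same_param_shift(2)[of "c j" "a j" 1] by simp
  from arcs_disjoint[OF j(1) j(1) _ _ this] show False using j arcs(2)[OF j(1)] by auto
qed

lemma in_ball_iff:
  "p \<in> params D \<Longrightarrow> pt D p \<in> ball z r \<longleftrightarrow> (\<exists>j<k. \<exists>t\<in>{a j<..<b j}. same_param p (c j, t))"
proof -
  assume p: "p \<in> params D"
  have "pt D p \<in> ball z r \<longleftrightarrow> (\<exists>j<k. \<exists>m::int. fst p = c j \<and> snd p + of_int m \<in> {a j<..<b j})"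
    using meets p unfolding meets_disc_in_arcs_def by blast
  also have "\<dots> \<longleftrightarrow> (\<exists>j<k. \<exists>t\<in>{a j<..<b j}. same_param p (c j, t))"
  proof safe
    fix j m assume "j < k" "fst p = c j" "snd p + of_int m \<in> {a j<..<b j}"
    then show "\<exists>j<k. \<exists>t\<in>{a j<..<b j}. same_param p (c j, t)"
      by (intro exI[of _ j] conjI bexI[of _ "snd p + of_int m"]) (simp_all add: same_param_def)
  next
    fix j t assume *: "j < k" "t \<in> {a j<..<b j}" "same_param p (c j, t)"
    obtain m :: int where "p = (c j, t + of_int m)" using *(3) by (rule same_paramE) simp
    then show "\<exists>j<k. \<exists>m::int. fst p = c j \<and> snd p + of_int m \<in> {a j<..<b j}"
      using * by (intro exI[of _ j] conjI exI[of _ "- m"]) simp_all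
  qed
  finally show ?thesis .
qed

lemma in_cball_iff:
  "p \<in> params D \<Longrightarrow> pt D p \<in> cball z r \<longleftrightarrow> (\<exists>j<k. \<exists>t\<in>{a j..b j}. same_param p (c j, t))"
proof -
  assume p: "p \<in> params D"
  have "pt D p \<in> cball z r \<longleftrightarrow> (\<exists>j<k. \<exists>m::int. fst p = c j \<and> snd p + of_int m \<in> {a j..b j})"
    using meets p unfolding meets_disc_in_arcs_def by blast
  also have "\<dots> \<longleftrightarrow> (\<exists>j<k. \<exists>t\<in>{a j..b j}. same_param p (c j, t))"
  proof safe
    fix j m assume "j < k" "fst p = c j" "snd p + of_int m \<in> {a j..b j}"
    then show "\<exists>j<k. \<exists>t\<in>{a j..b j}. same_param p (c j, t)"
      by (intro exI[of _ j] conjI bexI[of _ "snd p + of_int m"]) (simp_all add: same_param_def)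
  next
    fix j t assume *: "j < k" "t \<in> {a j..b j}" "same_param p (c j, t)"
    obtain m :: int where "p = (c j, t + of_int m)" using *(3) by (rule same_paramE) simp
    then show "\<exists>j<k. \<exists>m::int. fst p = c j \<and> snd p + of_int m \<in> {a j..b j}"
      using * by (intro exI[of _ j] conjI exI[of _ "- m"]) simp_all
  qed
  finally show ?thesis .
qed

lemma arc_in_params: "j < k \<Longrightarrow> (c j, t) \<in> params D"
  using arcs(1) by (simp add: params_iff)

lemma arc_in_ball: "j < k \<Longrightarrow> t \<in> {a j<..<b j} \<Longrightarrow> pt D (c j, t) \<in> ball z r"
  using in_ball_iff[OF arc_in_params, of j t] same_param_refl by blast

lemma arc_in_ball_iff:
  assumes "j < k" "t \<in> {a j..b j}"
  shows "pt D (c j, t) \<in> ball z r \<longleftrightarrow> t \<in> {a j<..<b j}"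
proof
  assume "pt D (c j, t) \<in> ball z r"
  then obtain j' u where u: "j' < k" "u \<in> {a j'<..<b j'}" "same_param (c j, t) (c j', u)"
    using in_ball_iff[OF arc_in_params[OF assms(1)]] by blast
  then have "j = j' \<and> t = u" using arcs_disjoint[OF assms(1) u(1) assms(2) _ u(3)] by simp
  then show "t \<in> {a j<..<b j}" using u by simp
qed (rule arc_in_ball[OF assms(1)])

lemma no_crossing_on_sphere:
  "p \<in> params D \<Longrightarrow> pt D p \<in> cball z r \<Longrightarrow> pt D p \<notin> ball z r \<Longrightarrow> \<not> crossing_param D p"
  using meets by (auto simp: crossing_param_iff meets_disc_in_arcs_def sphere_def ball_def cball_def)

lemma no_crossing_at_ends: "j < k \<Longrightarrow> \<not> crossing_param D (c j, a j)" "j < k \<Longrightarrow> \<not> crossing_param D (c j, b j)"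
proof -
  assume j: "j < k"
  have "\<not> crossing_param D (c j, e)" if "e = a j \<or> e = b j" for e
  proof -
    have e: "e \<in> {a j..b j}" "e \<notin> {a j<..<b j}" using arcs(2)[OF j] that by auto
    have "pt D (c j, e) \<in> cball z r"
      unfolding in_cball_iff[OF arc_in_params[OF j]] using j e(1) same_param_refl by blast
    moreover have "pt D (c j, e) \<notin> ball z r" using arc_in_ball_iff[OF j e(1)] e(2) by blast
    ultimately show ?thesis by (rule no_crossing_on_sphere[OF arc_in_params[OF j]])
  qed
  then show "\<not> crossing_param D (c j, a j)" "\<not> crossing_param D (c j, b j)" by blast+
qed

text \<open>Arcs are shorter than a period, so a parameter outside lies in an open gap between
  consecutive translates; \<open>m\<close> moves it into the period that starts at
  \<open>a j\<close>.\<close>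

lemma closed_arc_translates: "j < k \<Longrightarrow> closed {t. \<exists>m::int. t + of_int m \<in> {a j..b j}}"
  unfolding closed_def open_subopen[of "- _"]
proof
  fix t assume j: "j < k" and t: "t \<in> - {t. \<exists>m::int. t + of_int m \<in> {a j..b j}}"
  define m where "m = - \<lfloor>t - a j\<rfloor>"
  have "a j \<le> t + of_int m" "t + of_int m < a j + 1" unfolding m_def by linarith+
  moreover have "t + of_int m \<notin> {a j..b j}" using t by blast
  ultimately have m: "b j < t + of_int m" "t + of_int m < a j + 1" by auto
  have "u \<in> - {t. \<exists>m::int. t + of_int m \<in> {a j..b j}}" if u: "u \<in> {b j - of_int m<..<a j + 1 - of_int m}" for u
  proof
    assume "u \<in> {t. \<exists>m::int. t + of_int m \<in> {a j..b j}}"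
    then obtain n :: int where n: "a j \<le> u + of_int n" "u + of_int n \<le> b j" by auto
    then have "real_of_int n < of_int m" "real_of_int m < of_int (n + 1)" using u by auto
    then show False unfolding of_int_less_iff by linarith
  qed
  then show "\<exists>T. open T \<and> t \<in> T \<and> T \<subseteq> - {t. \<exists>m::int. t + of_int m \<in> {a j..b j}}"
    using m by (intro exI[of _ "{b j - of_int m<..<a j + 1 - of_int m}"]) auto
qed

lemma other_arcs_away:
  assumes j: "j < k" and e: "e = a j \<or> e = b j"
  shows "\<forall>\<^sub>F t in at e. \<forall>i\<in>{..<k} - {j}. c i = c j \<longrightarrow> \<not> (\<exists>m::int. t + of_int m \<in> {a i..b i})"
proof (rule eventually_ball_finite)
  show "\<forall>i\<in>{..<k} - {j}. \<forall>\<^sub>F t in at e. c i = c j \<longrightarrow> \<not> (\<exists>m::int. t + of_int m \<in> {a i..b i})"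
  proof
    fix i assume "i \<in> {..<k} - {j}"
    then have i: "i < k" "i \<noteq> j" by auto
    show "\<forall>\<^sub>F t in at e. c i = c j \<longrightarrow> \<not> (\<exists>m::int. t + of_int m \<in> {a i..b i})"
    proof (cases "c i = c j")
      case True
      have "e \<in> {a j..b j}" using e arcs(2)[OF j] by auto
      then have "e \<notin> {t. \<exists>m::int. t + of_int m \<in> {a i..b i}}"
        using arcs_disjoint[OF j i(1)] True i(2) same_param_shift(2)[of "c j" e] by fastforce
      then have "\<forall>\<^sub>F t in at e. t \<in> - {t. \<exists>m::int. t + of_int m \<in> {a i..b i}}"
        using closed_arc_translates[OF i(1)] by (intro eventually_at_in_open') (auto simp: closed_def)
      then show ?thesis by eventually_elim simp
    qed simp
  qed
qed simp

text \<open>Just beyond its ends a strand is outside the disc: the finitely many other arcs are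
  closed and stay away from the end, and the next translate of the same arc is a positive distance
  off. This lets labels be matched across the circle.\<close>

lemma outside_near_ends:
  assumes j: "j < k"
  shows "\<forall>\<^sub>F t in at_left (a j). pt D (c j, t) \<notin> ball z r"
    and "\<forall>\<^sub>F t in at_right (b j). pt D (c j, t) \<notin> ball z r"
proof -
  have out: "pt D (c j, t) \<notin> ball z r"
    if "\<forall>i\<in>{..<k} - {j}. c i = c j \<longrightarrow> \<not> (\<exists>m::int. t + of_int m \<in> {a i..b i})"
      "\<And>m::int. t + of_int m \<notin> {a j<..<b j}" for t
  proof
    assume "pt D (c j, t) \<in> ball z r"
    then obtain i u where u: "i < k" "u \<in> {a i<..<b i}" "same_param (c j, t) (c i, u)"
      using in_ball_iff[OF arc_in_params[OF j]] by blast
    obtain m :: int where "c j = c i" "u = t + of_int m"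
      using same_param_sym[OF u(3)] by (rule same_paramE) auto
    then have m: "t + of_int m \<in> {a i<..<b i}" "c i = c j" using u(2) by simp_all
    then have "\<exists>m::int. t + of_int m \<in> {a i..b i}" by (intro exI[of _ m]) simp
    then have "i = j" using that(1) u(1) m(2) by blast
    then show False using that(2)[of m] m(1) by simp
  qed
  have "\<forall>\<^sub>F t in at_left (a j). t \<in> {b j - 1<..<a j}"
    using arc_short[OF j] by (auto simp: eventually_at_left_field intro: exI[of _ "b j - 1"])
  moreover have "\<forall>\<^sub>F t in at_left (a j). \<forall>i\<in>{..<k} - {j}. c i = c j \<longrightarrow> \<not> (\<exists>m::int. t + of_int m \<in> {a i..b i})"
    using other_arcs_away[OF j, of "a j"] eventually_at_split by blast
  ultimately show "\<forall>\<^sub>F t in at_left (a j). pt D (c j, t) \<notin> ball z r"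
  proof eventually_elim
    case (elim t)
    have "t + of_int m \<notin> {a j<..<b j}" for m :: int
    proof
      assume "t + of_int m \<in> {a j<..<b j}"
      then have "0 < real_of_int m" "real_of_int m < 1" using elim(1) by auto
      then have "0 < m" "m < 1" by simp_all
      then show False by linarith
    qed
    then show ?case using out elim(2) by blast
  qed
  have "\<forall>\<^sub>F t in at_right (b j). t \<in> {b j<..<a j + 1}"
    using arc_short[OF j] by (auto simp: eventually_at_right_field intro: exI[of _ "a j + 1"])
  moreover have "\<forall>\<^sub>F t in at_right (b j). \<forall>i\<in>{..<k} - {j}. c i = c j \<longrightarrow> \<not> (\<exists>m::int. t + of_int m \<in> {a i..b i})"
    using other_arcs_away[OF j, of "b j"] eventually_at_split by blast
  ultimately show "\<forall>\<^sub>F t in at_right (b j). pt D (c j, t) \<notin> ball z r"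
  proof eventually_elim
    case (elim t)
    have "t + of_int m \<notin> {a j<..<b j}" for m :: int
    proof
      assume "t + of_int m \<in> {a j<..<b j}"
      then have "real_of_int (- 1) < real_of_int m" "real_of_int m < 0" using elim(1) by auto
      then have "- 1 < m" "m < 0" unfolding of_int_less_iff by simp_all
      then show False by linarith
    qed
    then show ?case using out elim(2) by blast
  qed
qed

end

text \<open>At a break the label of the piece to the right is taken. The convention is visible only
  at breaks that are not crossings, where a local coloring has equal labels on both sides.\<close>

definition step :: "real \<Rightarrow> real \<Rightarrow> 'a \<Rightarrow> 'a \<Rightarrow> 'a \<Rightarrow> real \<Rightarrow> 'a" where
  "step s s' x m w t = (if t < s then x else if t < s' then m else w)"

lemma step_left:
  assumes "s < s'"
  shows "\<forall>\<^sub>F u in at_left t. step s s' x m w u = (if t \<le> s then x else if t \<le> s' then m else w)"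
proof -
  define e where "e = (if t \<le> s then t - 1 else if t \<le> s' then s else s')"
  have "e < t" using assms by (auto simp: e_def)
  moreover have "step s s' x m w u = (if t \<le> s then x else if t \<le> s' then m else w)" if "e < u" "u < t" for u
    using that assms by (auto simp: e_def step_def split: if_splits)
  ultimately show ?thesis unfolding eventually_at_left_field by blast
qed

lemma step_right:
  assumes "s < s'"
  shows "\<forall>\<^sub>F u in at_right t. step s s' x m w u = step s s' x m w t"
proof -
  define e where "e = (if t < s then s else if t < s' then s' else t + 1)"
  have "t < e" using assms by (auto simp: e_def)
  moreover have "step s s' x m w u = step s s' x m w t" if "t < u" "u < e" for u
    using that assms by (auto simp: e_def step_def split: if_splits)
  ultimately show ?thesis unfolding eventually_at_right_field by blast
qed

text \<open>
  Every arc of a move passes through at most two crossings; \<open>s j\<close> and \<open>s' j\<close> are their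
  parameters. Where an arc has fewer crossings, the superfluous breaks are arbitrary and a local
  coloring takes the same value on both sides.
\<close>

locale broken_arcs = disc_arcs +
  fixes s s' :: "nat \<Rightarrow> real"
  assumes breaks: "j < k \<Longrightarrow> a j < s j" "j < k \<Longrightarrow> s j < s' j" "j < k \<Longrightarrow> s' j < b j"
    and crossings_at_breaks: "\<lbrakk>j < k; t \<in> {a j..b j}; crossing_param D (c j, t)\<rbrakk> \<Longrightarrow> t = s j \<or> t = s' j"
begin

definition local_coloring :: "('a, 'm) psyquandle_scheme \<Rightarrow> (nat \<Rightarrow> 'a) \<Rightarrow> (nat \<Rightarrow> 'a) \<Rightarrow> (nat \<Rightarrow> 'a) \<Rightarrow> bool" where
  "local_coloring X x m w \<longleftrightarrow>
     (\<forall>j<k. x j \<in> carrier X \<and> m j \<in> carrier X \<and> w j \<in> carrier X \<and>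
        (crossing_param D (c j, s j) \<or> x j = m j) \<and> (crossing_param D (c j, s' j) \<or> m j = w j)) \<and>
     (\<forall>i<k. \<forall>j<k. \<forall>t\<in>{s i, s' i}. \<forall>u\<in>{s j, s' j}. crosses D (c i, t) (c j, u) \<longrightarrow>
        oriented_rule (0 < turn D (c i, t) (c j, u))
          (strand_op X D (c i, t) (c j, u)) (strand_op X D (c j, u) (c i, t))
          (if t = s i then x i else m i) (if t = s i then m i else w i)
          (if u = s j then x j else m j) (if u = s j then m j else w j))"

lemma local_coloring_rule:
  assumes "local_coloring X x m w" "i < k" "j < k" "t \<in> {s i, s' i}" "u \<in> {s j, s' j}" "crosses D (c i, t) (c j, u)"
  shows "oriented_rule (0 < turn D (c i, t) (c j, u))
    (strand_op X D (c i, t) (c j, u)) (strand_op X D (c j, u) (c i, t))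
    (if t = s i then x i else m i) (if t = s i then m i else w i)
    (if u = s j then x j else m j) (if u = s j then m j else w j)"
  using assms unfolding local_coloring_def by blast

lemma local_coloring_cong:
  assumes l: "local_coloring X x m w" and eq: "\<forall>j<k. x j = x' j \<and> w j = w' j"
  shows "local_coloring X x' m w'"
proof -
  have e: "x' j = x j" "w' j = w j" if "j < k" for j using eq that by auto
  have "\<forall>j<k. x' j \<in> carrier X \<and> m j \<in> carrier X \<and> w' j \<in> carrier X \<and>
        (crossing_param D (c j, s j) \<or> x' j = m j) \<and> (crossing_param D (c j, s' j) \<or> m j = w' j)"
    using l e by (simp add: local_coloring_def)
  moreover have "oriented_rule (0 < turn D (c i, t) (c j, u))
    (strand_op X D (c i, t) (c j, u)) (strand_op X D (c j, u) (c i, t))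
    (if t = s i then x' i else m i) (if t = s i then m i else w' i)
    (if u = s j then x' j else m j) (if u = s j then m j else w' j)"
    if "i < k" "j < k" "t \<in> {s i, s' i}" "u \<in> {s j, s' j}" "crosses D (c i, t) (c j, u)" for i j t u
    using local_coloring_rule[OF l that] by (simp only: e[OF that(1)] e[OF that(2)])
  ultimately show ?thesis unfolding local_coloring_def by blast
qed

text \<open>The midpoint of the two breaks samples the middle label. No crossing lies strictly
  between breaks, so one sample for each piece suffices.\<close>

lemma restrict_values:
  assumes g: "g \<in> param_colorings X D" and j: "j < k" and t: "t \<in> {a j..b j}" "\<not> crossing_param D (c j, t)"
  shows "g (c j, t) = step (s j) (s' j) (g (c j, a j)) (g (c j, (s j + s' j) / 2)) (g (c j, b j)) t"
proof -
  have i: "c j < ncomp D" by (rule arcs(1)[OF j])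
  have nc: "\<not> crossing_param D (c j, u)" if "u \<in> {a j..b j}" "u \<noteq> s j" "u \<noteq> s' j" for u
    using crossings_at_breaks[OF j that(1)] that by blast
  note br = breaks(1)[OF j] breaks(2)[OF j] breaks(3)[OF j]
  have between: "g (c j, u) = g (c j, v)"
    if "u \<le> v" "a j \<le> u" "v \<le> b j" "\<And>y. u \<le> y \<Longrightarrow> y \<le> v \<Longrightarrow> \<not> crossing_param D (c j, y)" for u v
    by (rule constant_between[OF g i that(1,4)])
  consider "t < s j" | "t = s j" | "s j < t" "t < s' j" | "t = s' j" | "s' j < t" by linarith
  then show ?thesis
  proof cases
    case 1
    then have "g (c j, a j) = g (c j, t)" using br t by (intro between nc) auto
    then show ?thesis using 1 by (simp add: step_def)
  next
    case 2
    have "g (c j, t) = g (c j, (s j + s' j) / 2)"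
    proof (rule between)
      fix y assume "t \<le> y" "y \<le> (s j + s' j) / 2"
      then show "\<not> crossing_param D (c j, y)" using nc[of y] 2 t(2) br by (cases "y = t") auto
    qed (use 2 br in auto)
    then show ?thesis using 2 br by (simp add: step_def)
  next
    case 3
    have "g (c j, t) = g (c j, (s j + s' j) / 2)"
    proof (cases "t \<le> (s j + s' j) / 2")
      case True then show ?thesis using 3 br by (intro between nc) auto
    next
      case False
      then have "g (c j, (s j + s' j) / 2) = g (c j, t)" using 3 br by (intro between nc) auto
      then show ?thesis by simp
    qed
    then show ?thesis using 3 br by (simp add: step_def)
  next
    case 4
    have "g (c j, t) = g (c j, b j)"
    proof (rule between)
      fix y assume "t \<le> y" "y \<le> b j"
      then show "\<not> crossing_param D (c j, y)" using nc[of y] 4 t(2) br by (cases "y = t") auto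
    qed (use 4 br in auto)
    then show ?thesis using 4 br by (simp add: step_def)
  next
    case 5
    then have "g (c j, t) = g (c j, b j)" using br t by (intro between nc) auto
    then show ?thesis using 5 br by (simp add: step_def)
  qed
qed

lemma restrict_local_coloring:
  assumes g: "g \<in> param_colorings X D"
  shows "local_coloring X (\<lambda>j. g (c j, a j)) (\<lambda>j. g (c j, (s j + s' j) / 2)) (\<lambda>j. g (c j, b j))"
proof -
  let ?x = "\<lambda>j. g (c j, a j)" and ?m = "\<lambda>j. g (c j, (s j + s' j) / 2)" and ?w = "\<lambda>j. g (c j, b j)"
  have vals: "?x j \<in> carrier X \<and> ?m j \<in> carrier X \<and> ?w j \<in> carrier X \<and>
        (crossing_param D (c j, s j) \<or> ?x j = ?m j) \<and> (crossing_param D (c j, s' j) \<or> ?m j = ?w j) \<and>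
        left_limit g (c j, s j) = ?x j \<and> right_limit g (c j, s j) = ?m j \<and>
        left_limit g (c j, s' j) = ?m j \<and> right_limit g (c j, s' j) = ?w j" if j: "j < k" for j
  proof -
    have i: "c j < ncomp D" by (rule arcs(1)[OF j])
    note br = breaks(1)[OF j] breaks(2)[OF j] breaks(3)[OF j]
    have nc: "\<not> crossing_param D (c j, u)" if "a j \<le> u" "u \<le> b j" "u \<noteq> s j" "u \<noteq> s' j" for u
      using crossings_at_breaks[OF j, of u] that by auto
    have lims: "left_limit g (c j, s j) = ?x j" "right_limit g (c j, s j) = ?m j"
        "left_limit g (c j, s' j) = ?m j" "right_limit g (c j, s' j) = ?w j"
      using br by (intro left_limit_eq[OF g i] right_limit_eq[OF g i] nc; simp)+
    have lim_eq: "left_limit g (c j, t) = g (c j, t)" "right_limit g (c j, t) = g (c j, t)"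
      if "\<not> crossing_param D (c j, t)" for t
    proof -
      have "\<forall>\<^sub>F u in at (snd (c j, t)). g (fst (c j, t), u) = g (c j, t)"
        using g that arc_in_params[OF j] unfolding param_colorings_def by blast
      then show "left_limit g (c j, t) = g (c j, t)" "right_limit g (c j, t) = g (c j, t)"
        by (auto simp: eventually_at_split intro!: left_limitI right_limitI)
    qed
    have "?x j \<in> carrier X" "?m j \<in> carrier X" "?w j \<in> carrier X"
      using br by (intro value_in[OF g i] nc; simp)+
    then show ?thesis using lims lim_eq[of "s j"] lim_eq[of "s' j"] by argo
  qed
  have rules: "oriented_rule (0 < turn D (c i, t) (c j, u))
          (strand_op X D (c i, t) (c j, u)) (strand_op X D (c j, u) (c i, t))
          (if t = s i then ?x i else ?m i) (if t = s i then ?m i else ?w i)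
          (if u = s j then ?x j else ?m j) (if u = s j then ?m j else ?w j)"
    if ij: "i < k" "j < k" "t \<in> {s i, s' i}" "u \<in> {s j, s' j}" and c: "crosses D (c i, t) (c j, u)" for i j t u
  proof -
    have lims: "left_limit g (c i, t) = (if t = s i then ?x i else ?m i) \<and>
        right_limit g (c i, t) = (if t = s i then ?m i else ?w i)"
      if "i < k" "t \<in> {s i, s' i}" for i t
      using vals[OF that(1)] breaks(2)[OF that(1)] that(2) by (cases "t = s i") simp_all
    show ?thesis
      using param_colorings_rule[OF g c] unfolding rule_at_def
      by (simp only: lims[OF ij(1,3)] lims[OF ij(2,4)])
  qed
  show ?thesis unfolding local_coloring_def using vals rules by blast
qed

end

text \<open>The same parameter intervals describe the passages through the disc in both diagrams, so
  it does not matter for which diagram a point is said to be outside.\<close>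

lemma differ_in_disc_sym: "differ_in_disc D E z r k c a b \<Longrightarrow> differ_in_disc E D z r k c a b"
proof -
  assume d: "differ_in_disc D E z r k c a b"
  then have par: "params E = params D" by (simp add: differ_in_disc_def params_def)
  have "pt E p \<in> ball z r \<longleftrightarrow> pt D p \<in> ball z r" if "p \<in> params D" for p
    using d that par unfolding differ_in_disc_def meets_disc_in_arcs_def by metis
  then show ?thesis using d par unfolding differ_in_disc_def by metis
qed

section \<open>Gluing a new inside to an old outside\<close>

locale disc_change = D: diagram D + broken_arcs E z r k c a b s s'
  for D E z r k c a b s s' +
  assumes differ: "differ_in_disc D E z r k c a b"
begin

sublocale D: disc_arcs D z r k c a b
  using differ by unfold_locales (simp add: differ_in_disc_def)

lemma same_ncomp: "ncomp E = ncomp D"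
  using differ by (simp add: differ_in_disc_def)

lemma same_params: "params E = params D"
  by (simp add: params_def same_ncomp)

lemma in_ball_both: "p \<in> params D \<Longrightarrow> pt E p \<in> ball z r \<longleftrightarrow> pt D p \<in> ball z r"
  using in_ball_iff D.in_ball_iff same_params by simp

lemma outside:
  assumes "p \<in> params D" "pt E p \<notin> ball z r"
  shows "pt E p = pt D p" "p \<in> over E \<longleftrightarrow> p \<in> over D"
  using differ assms in_ball_both[OF assms(1)] unfolding differ_in_disc_def by blast+

lemma crosses_outside:
  assumes "p \<in> params D" "pt E p \<notin> ball z r"
  shows "crosses E p q \<longleftrightarrow> crosses D p q"
proof -
  have "pt E p = pt E q \<longleftrightarrow> pt D p = pt D q" if "q \<in> params D"
    using outside[OF assms] outside[OF that] in_ball_both[OF that] assms by metis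
  then show ?thesis unfolding crosses_def same_params by blast
qed

lemma crossing_param_outside:
  "p \<in> params D \<Longrightarrow> pt E p \<notin> ball z r \<Longrightarrow> crossing_param E p \<longleftrightarrow> crossing_param D p"
  unfolding crossing_param_def using crosses_outside by blast

lemma eventually_outside:
  assumes "i < ncomp D" "pt E (i, x) \<notin> cball z r"
  shows "\<forall>\<^sub>F t in nhds x. pt E (i, t) \<notin> cball z r"
proof -
  have "(curve E i \<longlongrightarrow> curve E i x) (nhds x)"
    using continuous[of i UNIV] assms(1) same_ncomp
    by (simp add: continuous_on_eq_continuous_at isCont_def tendsto_at_iff_tendsto_nhds)
  moreover have "open (- cball z r)" by (simp add: open_Compl)
  ultimately have "\<forall>\<^sub>F t in nhds x. curve E i t \<in> - cball z r"
    using assms(2) by (intro topological_tendstoD) (auto simp: pt_def)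
  then show ?thesis by (simp add: pt_def)
qed

text \<open>Off the closed disc the two curves agree on a neighbourhood of the parameter, and so do
  the derivatives. Tangents on the circle itself are never compared, since no crossing lies
  there.\<close>

lemma tangent_outside:
  assumes "p \<in> params D" "pt E p \<notin> cball z r"
  shows "tangent E p = tangent D p"
proof -
  have i: "fst p < ncomp D" using assms by (simp add: params_iff)
  have "\<forall>\<^sub>F t in nhds (snd p). pt E (fst p, t) \<notin> cball z r"
    by (rule eventually_outside[OF i]) (use assms(2) in simp)
  then have "\<forall>\<^sub>F t in nhds (snd p). t \<in> UNIV \<longrightarrow> curve E (fst p) t = curve D (fst p) t"
  proof (rule eventually_mono)
    fix t assume "pt E (fst p, t) \<notin> cball z r"
    then have "pt E (fst p, t) = pt D (fst p, t)" using outside(1)[of "(fst p, t)"] i by (simp add: params_iff)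
    then show "t \<in> UNIV \<longrightarrow> curve E (fst p) t = curve D (fst p) t" by (simp add: pt_def)
  qed
  then show ?thesis unfolding tangent_def by (rule vector_derivative_cong_eq) auto
qed

lemma rule_outside:
  assumes c: "crosses E p q" and out: "pt E p \<notin> cball z r"
  shows "turn E p q = turn D p q" "strand_op X E p q = strand_op X D p q" "strand_op X E q p = strand_op X D q p"
proof -
  have pq: "p \<in> params D" "q \<in> params D" "pt E q = pt E p" using c by (auto simp: crosses_def same_params)
  have out': "pt E p \<notin> ball z r" "pt E q \<notin> ball z r" "pt E q \<notin> cball z r" using out pq by auto
  have tan: "tangent E p = tangent D p" "tangent E q = tangent D q"
    using tangent_outside pq out out' by auto
  then show "turn E p q = turn D p q" by (simp add: turn_def)
  have "sing E - ball z r = sing D - ball z r" using differ by (simp add: differ_in_disc_def)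
  then have "pt E p \<in> sing E \<longleftrightarrow> pt D p \<in> sing D" "pt E q \<in> sing E \<longleftrightarrow> pt D q \<in> sing D"
    using outside(1)[OF pq(1) out'(1)] outside(1)[OF pq(2) out'(2)] out' by (metis Diff_iff)+
  then show "strand_op X E p q = strand_op X D p q" "strand_op X E q p = strand_op X D q p"
    using outside(2)[OF pq(1) out'(1)] outside(2)[OF pq(2) out'(2)] tan by (simp_all add: strand_op_def turn_def)
qed

lemma crossing_in_arc:
  assumes c: "crosses E p q" and p: "pt E p \<in> cball z r"
  obtains i t where "i < k" "t \<in> {s i, s' i}" "same_param p (c i, t)"
proof -
  have "p \<in> params E" using c by (simp add: crosses_def)
  then obtain i t where it: "i < k" "t \<in> {a i..b i}" "same_param p (c i, t)" using in_cball_iff p by blast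
  moreover have "crossing_param E (c i, t)"
    using crossing_param_same_param[OF it(3)] c unfolding crossing_param_def by blast
  ultimately show thesis using that crossings_at_breaks[OF it(1,2)] by blast
qed

lemma eventually_periodic:
  fixes g :: "nat \<times> real \<Rightarrow> 'a"
  assumes per: "\<And>i t. g (i, t + 1) = g (i, t)" and "same_param p q"
    and "\<forall>\<^sub>F t in at (snd q). g (fst q, t) = v"
  shows "\<forall>\<^sub>F t in at (snd p). g (fst p, t) = v"
proof -
  obtain n where p: "p = (fst q, snd q + of_int n)" using assms(2) by (rule same_paramE)
  have sh: "g (fst q, t + of_int n) = g (fst q, t)" for t by (rule periodic_shift) (rule per)
  show ?thesis
    unfolding p fst_conv snd_conv eventually_at_split[of _ "_ + _"] eventually_at_left_shift[OF sh]
      eventually_at_right_shift[OF sh]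
    using assms(3) unfolding eventually_at_split .
qed

text \<open>The new coloring is the old one outside and the step function of the local coloring on
  each arc. Since the end labels agree and the strand is outside beyond the ends, it is locally
  constant across the circle.\<close>

lemma glue:
  assumes g: "g \<in> param_colorings X D" and loc: "local_coloring X x m w"
    and ends: "\<And>j. j < k \<Longrightarrow> x j = g (c j, a j) \<and> w j = g (c j, b j)"
  shows "\<exists>g'\<in>param_colorings X E. \<forall>p\<in>params D. pt D p \<notin> ball z r \<longrightarrow> g' p = g p"
proof -
  let ?h = "\<lambda>j. step (s j) (s' j) (x j) (m j) (w j)"
  let ?L = "\<lambda>j t. if t \<le> s j then x j else if t \<le> s' j then m j else w j"
  \<comment> \<open>The arc and the parameter on it at which \<open>p\<close> passes through the
    disc; both are unique by \<open>arcs_disjoint\<close>.\<close>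
  define sel where "sel p = (SOME q. fst q < k \<and> snd q \<in> {a (fst q)<..<b (fst q)} \<and> same_param p (c (fst q), snd q))" for p
  define g' where "g' p = (if p \<in> params E \<and> \<not> crossing_param E p
      then (if pt E p \<in> ball z r then ?h (fst (sel p)) (snd (sel p)) else g p) else undefined)" for p
  have gper: "g p = g q" if "same_param p q" for p q by (rule param_colorings_shift[OF g that])
  have out: "g' p = g p" if "p \<in> params D" "pt E p \<notin> ball z r" for p
    using that crossing_param_outside[OF that] param_colorings_undefined[OF g, of p] same_params
    by (auto simp: g'_def)
  \<comment> \<open>This holds up to the ends of the arc, where \<open>ends\<close> makes the step
    function meet the old labels.\<close>
  have arc: "g' p = ?h j t"
    if j: "j < k" "t \<in> {a j..b j}" and sp: "same_param p (c j, t)" and nc: "\<not> crossing_param E p" for p j t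
  proof (cases "t \<in> {a j<..<b j}")
    case True
    have p: "p \<in> params E" using same_param_params[OF sp] arc_in_params[OF j(1)] by simp
    have "pt E p \<in> ball z r" using in_ball_iff[OF p] j(1) True sp by blast
    moreover have "fst (sel p) < k \<and> snd (sel p) \<in> {a (fst (sel p))<..<b (fst (sel p))} \<and>
        same_param p (c (fst (sel p)), snd (sel p))"
      unfolding sel_def by (rule someI[of _ "(j, t)"]) (use j(1) True sp in simp)
    then have "fst (sel p) = j \<and> snd (sel p) = t"
      using arcs_disjoint[of "fst (sel p)" j "snd (sel p)" t] j same_param_trans[OF same_param_sym sp] by auto
    ultimately show ?thesis using p nc by (simp add: g'_def)
  next
    case False
    then have t: "t = a j \<or> t = b j" using j(2) by auto
    have p: "p \<in> params D" using same_param_params[OF sp] arc_in_params[OF j(1)] same_params by simp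
    have "pt E p \<notin> ball z r"
      using pt_same_param[OF _ sp] arc_in_ball_iff[OF j] False p same_params by simp
    then have "g' p = g (c j, t)" using out[OF p] gper[OF sp] by simp
    moreover have "?h j (a j) = x j" "?h j (b j) = w j"
      using breaks(1)[OF j(1)] breaks(2)[OF j(1)] breaks(3)[OF j(1)] by (simp_all add: step_def)
    ultimately show ?thesis using t ends[OF j(1)] by auto
  qed
  have nc_ev: "\<forall>\<^sub>F u in at_left t. \<not> crossing_param E (c j, u)" "\<forall>\<^sub>F u in at_right t. \<not> crossing_param E (c j, u)"
    if "j < k" for j t using crossings_isolated[OF arcs(1)[OF that], of t] by (auto simp: eventually_at_split)
  have left: "\<forall>\<^sub>F u in at_left t. g' (c j, u) = ?L j t" if j: "j < k" and t: "a j < t" "t \<le> b j" for j t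
  proof -
    have "\<forall>\<^sub>F u in at_left t. u \<in> {a j<..<t}" using t(1) by (auto simp: eventually_at_left_field)
    from eventually_conj[OF this eventually_conj[OF nc_ev(1)[OF j] step_left[OF breaks(2)[OF j]]]]
    show ?thesis
    proof (rule eventually_mono)
      fix u assume u: "u \<in> {a j<..<t} \<and> \<not> crossing_param E (c j, u) \<and> ?h j u = ?L j t"
      then show "g' (c j, u) = ?L j t" using arc[OF j _ same_param_refl, of u] t by auto
    qed
  qed
  have right: "\<forall>\<^sub>F u in at_right t. g' (c j, u) = ?h j t" if j: "j < k" and t: "a j \<le> t" "t < b j" for j t
  proof -
    have "\<forall>\<^sub>F u in at_right t. u \<in> {t<..<b j}" using t(2) by (auto simp: eventually_at_right_field)
    from eventually_conj[OF this eventually_conj[OF nc_ev(2)[OF j] step_right[OF breaks(2)[OF j]]]]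
    show ?thesis
    proof (rule eventually_mono)
      fix u assume u: "u \<in> {t<..<b j} \<and> \<not> crossing_param E (c j, u) \<and> ?h j u = ?h j t"
      then show "g' (c j, u) = ?h j t" using arc[OF j _ same_param_refl, of u] t by auto
    qed
  qed
  have per: "g' (i, t + 1) = g' (i, t)" for i t
  proof (cases "(i, t) \<in> params E \<and> \<not> crossing_param E (i, t)")
    case True
    have sp: "same_param (i, t + 1) (i, t)" using same_param_shift(1)[of i t 1] by simp
    have p: "(i, t + 1) \<in> params E" "\<not> crossing_param E (i, t + 1)"
      using True same_param_params[OF sp] crossing_param_same_param[OF sp] by simp_all
    show ?thesis
    proof (cases "pt E (i, t) \<in> ball z r")
      case inside: True
      then obtain j u where ju: "j < k" "u \<in> {a j<..<b j}" "same_param (i, t) (c j, u)"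
        using in_ball_iff True by blast
      then have "u \<in> {a j..b j}" by simp
      then show ?thesis
        using arc[OF ju(1) _ ju(3)] arc[OF ju(1) _ same_param_trans[OF sp ju(3)]] True p(2) by simp
    next
      case False
      then have "pt E (i, t + 1) \<notin> ball z r" using pt_same_param[OF p(1) sp] by simp
      then show ?thesis using out[of "(i, t)"] out[of "(i, t + 1)"] False True p(1) same_params gper[OF sp] by simp
    qed
  next
    case False
    have sp: "same_param (i, t + 1) (i, t)" using same_param_shift(1)[of i t 1] by simp
    then have "\<not> ((i, t + 1) \<in> params E \<and> \<not> crossing_param E (i, t + 1))"
      using False same_param_params[OF sp] crossing_param_same_param[OF sp] by simp
    then show ?thesis using False unfolding g'_def by presburger
  qed
  have g_const: "\<forall>\<^sub>F t in at (snd p). g (fst p, t) = g p" if "p \<in> params D" "\<not> crossing_param D p" for p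
    using g that unfolding param_colorings_def by blast
  \<comment> \<open>No crossing lies on the circle, so the old label is locally constant at an end,
    and on the outer side the new coloring coincides with the old.\<close>
  have out_const: "\<forall>\<^sub>F u in F. g' (c j, u) = g (c j, t)"
    if j: "j < k" and F: "F \<le> at t" "\<forall>\<^sub>F u in F. pt E (c j, u) \<notin> ball z r"
      and t: "t = a j \<or> t = b j" for j t F
  proof -
    have "pt E (c j, t) \<notin> ball z r" using arc_in_ball_iff[OF j, of t] t arcs(2)[OF j] by auto
    then have "\<not> crossing_param D (c j, t)"
      using no_crossing_at_ends[OF j] t crossing_param_outside[of "(c j, t)"] arc_in_params[OF j] same_params by auto
    then have "\<forall>\<^sub>F u in F. g (c j, u) = g (c j, t)"
      using g_const[of "(c j, t)"] arc_in_params[OF j] same_params filter_leD[OF F(1)] by simp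
    with F(2) show ?thesis
    proof eventually_elim
      case (elim u)
      then show ?case using out[of "(c j, u)"] arc_in_params[OF j] same_params by simp
    qed
  qed
  have const: "\<forall>\<^sub>F u in at (snd p). g' (fst p, u) = g' p" if p: "p \<in> params E" "\<not> crossing_param E p" for p
  proof (cases "pt E p \<in> cball z r")
    case False
    have i: "fst p < ncomp D" using p same_ncomp by (simp add: params_iff)
    have "pt E p \<notin> ball z r" using False by auto
    then have pD: "p \<in> params D" "\<not> crossing_param D p" "g' p = g p"
      using crossing_param_outside[of p] out[of p] p same_params by auto
    have "\<forall>\<^sub>F u in at (snd p). pt E (fst p, u) \<notin> cball z r"
      using eventually_outside[OF i, of "snd p"] False by (simp add: eventually_nhds_conv_at)
    with g_const[OF pD(1,2)] show ?thesis
    proof eventually_elim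
      case (elim u)
      have "pt E (fst p, u) \<notin> ball z r" using elim(2) by auto
      then show ?case using out[of "(fst p, u)"] i elim(1) pD(3) by (simp add: params_iff)
    qed
  next
    case True
    then obtain j t where jt: "j < k" "t \<in> {a j..b j}" "same_param p (c j, t)" using in_cball_iff[OF p(1)] by blast
    have nc: "\<not> crossing_param E (c j, t)" using crossing_param_same_param[OF jt(3)] p(2) by simp
    have val: "g' p = ?h j t" by (rule arc[OF jt p(2)])
    \<comment> \<open>At a noncrossing break the label does not jump, so the value from the left is
      also the value of \<open>step\<close>.\<close>
    have L: "?L j t = ?h j t"
    proof -
      have "x j = m j" if "t = s j" using loc nc jt(1) that unfolding local_coloring_def by blast
      moreover have "m j = w j" if "t = s' j" using loc nc jt(1) that unfolding local_coloring_def by blast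
      ultimately show ?thesis using breaks(2)[OF jt(1)] by (auto simp: step_def)
    qed
    have h_ends: "?h j (a j) = g (c j, a j)" "?h j (b j) = g (c j, b j)"
      using breaks(1)[OF jt(1)] breaks(2)[OF jt(1)] breaks(3)[OF jt(1)] ends[OF jt(1)] by (simp_all add: step_def)
    have "\<forall>\<^sub>F u in at_left t. g' (c j, u) = ?h j t"
    proof (cases "t = a j")
      case True
      have "\<forall>\<^sub>F u in at_left t. g' (c j, u) = g (c j, t)"
        by (rule out_const[OF jt(1)]) (use True outside_near_ends(1)[OF jt(1)] in \<open>auto intro: at_le\<close>)
      then show ?thesis using h_ends(1) True by simp
    next
      case False
      then show ?thesis using left[OF jt(1), of t] jt(2) unfolding L by simp
    qed
    moreover have "\<forall>\<^sub>F u in at_right t. g' (c j, u) = ?h j t"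
    proof (cases "t = b j")
      case True
      have "\<forall>\<^sub>F u in at_right t. g' (c j, u) = g (c j, t)"
        by (rule out_const[OF jt(1)]) (use True outside_near_ends(2)[OF jt(1)] in \<open>auto intro: at_le\<close>)
      then show ?thesis using h_ends(2) True by simp
    next
      case False
      then show ?thesis using right[OF jt(1), of t] jt(2) by simp
    qed
    ultimately have "\<forall>\<^sub>F u in at (snd (c j, t)). g' (fst (c j, t), u) = ?h j t"
      by (simp add: eventually_at_split)
    from eventually_periodic[OF per jt(3) this] show ?thesis unfolding val .
  qed
  have inX: "g' p \<in> carrier X" if p: "p \<in> params E" "\<not> crossing_param E p" for p
  proof (cases "pt E p \<in> ball z r")
    case True
    then obtain j t where jt: "j < k" "t \<in> {a j<..<b j}" "same_param p (c j, t)" using in_ball_iff[OF p(1)] by blast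
    have "t \<in> {a j..b j}" using jt(2) by simp
    then have "g' p = ?h j t" by (rule arc[OF jt(1) _ jt(3) p(2)])
    then show ?thesis using loc jt(1) by (simp add: local_coloring_def step_def)
  next
    case False
    then show ?thesis
      using out[of p] crossing_param_outside[of p] p D.value_in[OF g, of "fst p" "snd p"] same_params
      by (simp add: params_iff)
  qed
  have rules: "rule_at X E g' p q" if cr: "crosses E p q" for p q
  proof (cases "pt E p \<in> cball z r")
    case False
    have pq: "p \<in> params D" "q \<in> params D" "pt E q = pt E p" using cr by (auto simp: crosses_def same_params)
    have crD: "crosses D p q" using crosses_outside[of p q] cr pq(1) False by auto
    have lims: "left_limit g' y = left_limit g y \<and> right_limit g' y = right_limit g y"
      if y: "y \<in> params D" "pt E y \<notin> cball z r" for y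
    proof -
      have i: "fst y < ncomp D" using y by (simp add: params_iff)
      have "\<forall>\<^sub>F u in nhds (snd y). pt E (fst y, u) \<notin> cball z r" by (rule eventually_outside[OF i]) (use y in simp)
      then have "\<forall>\<^sub>F u in nhds (snd y). g' (fst y, u) = g (fst y, u)"
        by (rule eventually_mono) (use out i in \<open>auto simp: params_iff\<close>)
      then have "\<forall>\<^sub>F u in at (snd y). g' (fst y, u) = g (fst y, u)" by (simp add: eventually_nhds_conv_at)
      then have e: "\<forall>\<^sub>F u in at_left (snd y). g' (fst y, u) = g (fst y, u)"
        "\<forall>\<^sub>F u in at_right (snd y). g' (fst y, u) = g (fst y, u)" by (simp_all add: eventually_at_split)
      have l: "\<forall>\<^sub>F u in at_left (snd y). g' (fst y, u) = left_limit g y"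
        using e(1) D.left_limit_attained(1)[OF g y(1)] by eventually_elim simp
      have r: "\<forall>\<^sub>F u in at_right (snd y). g' (fst y, u) = right_limit g y"
        using e(2) D.right_limit_attained(1)[OF g y(1)] by eventually_elim simp
      show ?thesis by (rule conjI[OF left_limitI[OF l] right_limitI[OF r]])
    qed
    have q: "pt E q \<notin> cball z r" using False pq(3) by simp
    show ?thesis
      using param_colorings_rule[OF g crD] unfolding rule_at_def
      by (simp only: rule_outside[OF cr False] lims[OF pq(1) False] lims[OF pq(2) q])
  next
    case True
    have pq: "pt E q = pt E p" using cr by (simp add: crosses_def)
    \<comment> \<open>In the disc both passages sit at breaks up to integers. The local rule holds
      for these representatives, and periodicity carries it back to \<open>p\<close> and
      \<open>q\<close>.\<close>
    obtain i t where it: "i < k" "t \<in> {s i, s' i}" "same_param p (c i, t)"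
      by (rule crossing_in_arc[OF cr True])
    obtain j u where ju: "j < k" "u \<in> {s j, s' j}" "same_param q (c j, u)"
      by (rule crossing_in_arc[OF crosses_commute[OF cr]]) (use True pq in simp)
    have c': "crosses E (c i, t) (c j, u)" using crosses_same_param[OF it(3) ju(3)] cr by simp
    have lims: "left_limit g' (c i, t) = (if t = s i then x i else m i) \<and>
        right_limit g' (c i, t) = (if t = s i then m i else w i)"
      if it: "i < k" "t \<in> {s i, s' i}" for i t
    proof -
      note br = breaks(1)[OF it(1)] breaks(2)[OF it(1)] breaks(3)[OF it(1)]
      have t: "a i < t" "t < b i" using it(2) br by auto
      have ev: "\<forall>\<^sub>F u in at_left (snd (c i, t)). g' (fst (c i, t), u) = ?L i t"
        "\<forall>\<^sub>F u in at_right (snd (c i, t)). g' (fst (c i, t), u) = ?h i t"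
        using left[OF it(1), of t] right[OF it(1), of t] t by simp_all
      have "left_limit g' (c i, t) = ?L i t \<and> right_limit g' (c i, t) = ?h i t"
        by (rule conjI[OF left_limitI[OF ev(1)] right_limitI[OF ev(2)]])
      then show ?thesis using it(2) br by (auto simp: step_def)
    qed
    have "rule_at X E g' (c i, t) (c j, u)"
      using local_coloring_rule[OF loc it(1) ju(1) it(2) ju(2) c'] unfolding rule_at_def
      by (simp only: lims[OF it(1,2)] lims[OF ju(1,2)])
    then show ?thesis using rule_at_same_param[OF per cr it(3) ju(3), of X] by simp
  qed
  have "g' p = undefined" if "\<not> (p \<in> params E \<and> \<not> crossing_param E p)" for p
    using that unfolding g'_def by presburger
  then have "g' \<in> param_colorings X E"
    unfolding param_colorings_def using inX per const rules by simp
  then show ?thesis using out in_ball_both by blast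
qed

lemma ends_outside: "j < k \<Longrightarrow> pt D (c j, a j) \<notin> ball z r" "j < k \<Longrightarrow> pt D (c j, b j) \<notin> ball z r"
  using D.arc_in_ball_iff[of j "a j"] D.arc_in_ball_iff[of j "b j"] arcs(2)[of j] by auto

text \<open>The ends of the arcs lie outside the open disc, so both colorings have the same end
  labels there. Uniqueness of the middle labels and \<open>restrict_values\<close> recover the
  rest.\<close>

lemma agree_inside:
  assumes g: "g\<^sub>1 \<in> param_colorings X E" "g\<^sub>2 \<in> param_colorings X E"
    and agree: "\<And>p. p \<in> params D \<Longrightarrow> pt D p \<notin> ball z r \<Longrightarrow> g\<^sub>1 p = g\<^sub>2 p"
    and unique: "\<And>x m m' w. local_coloring X x m w \<Longrightarrow> local_coloring X x m' w \<Longrightarrow> \<forall>j<k. m j = m' j"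
  shows "g\<^sub>1 = g\<^sub>2"
proof
  fix p
  have ends: "g\<^sub>1 (c j, a j) = g\<^sub>2 (c j, a j) \<and> g\<^sub>1 (c j, b j) = g\<^sub>2 (c j, b j)" if "j < k" for j
    using agree ends_outside[OF that] D.arc_in_params[OF that] by blast
  let ?m = "\<lambda>g j. g (c j, (s j + s' j) / 2)"
  have "local_coloring X (\<lambda>j. g\<^sub>1 (c j, a j)) (?m g\<^sub>2) (\<lambda>j. g\<^sub>1 (c j, b j))"
    by (rule local_coloring_cong[OF restrict_local_coloring[OF g(2)]]) (use ends in simp)
  then have m: "\<forall>j<k. ?m g\<^sub>1 j = ?m g\<^sub>2 j"
    using unique[OF restrict_local_coloring[OF g(1)]] by blast
  show "g\<^sub>1 p = g\<^sub>2 p"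
  proof (cases "p \<in> params E \<and> \<not> crossing_param E p")
    case True
    show ?thesis
    proof (cases "pt E p \<in> ball z r")
      case inside: True
      then obtain j t where jt: "j < k" "t \<in> {a j<..<b j}" "same_param p (c j, t)"
        using in_ball_iff True by blast
      have t: "t \<in> {a j..b j}" using jt(2) by simp
      have nc: "\<not> crossing_param E (c j, t)" using crossing_param_same_param[OF jt(3)] True by simp
      show ?thesis
        using restrict_values[OF g(1) jt(1) t nc] restrict_values[OF g(2) jt(1) t nc] ends[OF jt(1)] m jt(1)
          param_colorings_shift[OF g(1) jt(3)] param_colorings_shift[OF g(2) jt(3)] by simp
    next
      case False
      then show ?thesis using agree[of p] in_ball_both[of p] True same_params by simp
    qed
  next
    case False
    then show ?thesis using param_colorings_undefined[OF g(1)] param_colorings_undefined[OF g(2)] by simp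
  qed
qed

end

text \<open>Reduces a move to four facts about labels in the disc with the end labels
  \<open>x\<close> and \<open>w\<close> kept: a passage in each direction, and uniqueness of the
  middle labels in each diagram.\<close>

lemma disc_change_equiv:
  assumes S: "S \<subseteq> psyquandle_hom X X" and differ: "differ_in_disc D E z r k c a b"
    and D: "broken_arcs D z r k c a b t t'" and E: "broken_arcs E z r k c a b s s'"
    and fwd: "\<And>x m w. broken_arcs.local_coloring D k c t t' X x m w \<Longrightarrow>
      \<exists>m'. broken_arcs.local_coloring E k c s s' X x m' w"
    and bwd: "\<And>x m w. broken_arcs.local_coloring E k c s s' X x m w \<Longrightarrow>
      \<exists>m'. broken_arcs.local_coloring D k c t t' X x m' w"
    and uD: "\<And>x m m' w. broken_arcs.local_coloring D k c t t' X x m w \<Longrightarrow>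
      broken_arcs.local_coloring D k c t t' X x m' w \<Longrightarrow> \<forall>j<k. m j = m' j"
    and uE: "\<And>x m m' w. broken_arcs.local_coloring E k c s s' X x m w \<Longrightarrow>
      broken_arcs.local_coloring E k c s s' X x m' w \<Longrightarrow> \<forall>j<k. m j = m' j"
  shows "coloring_equiv X S D E"
proof -
  interpret D: broken_arcs D z r k c a b t t' by (rule D)
  interpret E: broken_arcs E z r k c a b s s' by (rule E)
  interpret DE: disc_change D E z r k c a b s s' by unfold_locales (rule differ)
  interpret ED: disc_change E D z r k c a b t t' by unfold_locales (rule differ_in_disc_sym[OF differ])
  have par: "params E = params D" by (rule DE.same_params)
  define R where "R g g' \<longleftrightarrow> (\<forall>p\<in>params D. pt D p \<notin> ball z r \<longrightarrow> g' p = g p)" for g g' :: "nat \<times> real \<Rightarrow> 'a"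
  have ball: "pt E p \<in> ball z r \<longleftrightarrow> pt D p \<in> ball z r" if "p \<in> params D" for p
    by (rule DE.in_ball_both[OF that])
  show ?thesis
  proof (rule coloring_equivI[where R = R, OF E.diagram S _ _ _ _ _ D.diagram])
    fix g assume g: "g \<in> param_colorings X D"
    obtain m' where "E.local_coloring X (\<lambda>j. g (c j, a j)) m' (\<lambda>j. g (c j, b j))"
      using fwd[OF D.restrict_local_coloring[OF g]] by blast
    from DE.glue[OF g this] show "\<exists>g'\<in>param_colorings X E. R g g'" unfolding R_def by simp
  next
    fix g' assume g': "g' \<in> param_colorings X E"
    obtain m' where "D.local_coloring X (\<lambda>j. g' (c j, a j)) m' (\<lambda>j. g' (c j, b j))"
      using bwd[OF E.restrict_local_coloring[OF g']] by blast
    from ED.glue[OF g' this] obtain g where "g \<in> param_colorings X D"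
      "\<forall>p\<in>params E. pt E p \<notin> ball z r \<longrightarrow> g p = g' p" by auto
    then show "\<exists>g\<in>param_colorings X D. R g g'" unfolding R_def par using ball by (intro bexI[of _ g]) auto
  next
    fix g g\<^sub>1 g\<^sub>2 assume "g\<^sub>1 \<in> param_colorings X E" "g\<^sub>2 \<in> param_colorings X E" "R g g\<^sub>1" "R g g\<^sub>2"
    then show "g\<^sub>1 = g\<^sub>2" by (intro DE.agree_inside[OF _ _ _ uE]) (auto simp: R_def)
  next
    fix g g\<^sub>1 g\<^sub>2 assume g: "g\<^sub>1 \<in> param_colorings X D" "g\<^sub>2 \<in> param_colorings X D" and R: "R g\<^sub>1 g" "R g\<^sub>2 g"
    show "g\<^sub>1 = g\<^sub>2"
    proof (rule ED.agree_inside[OF g _ uD])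
      fix p assume "p \<in> params E" "pt E p \<notin> ball z r"
      then have "p \<in> params D" "pt D p \<notin> ball z r" using ball[of p] par by simp_all
      then show "g\<^sub>1 p = g\<^sub>2 p" using R unfolding R_def by metis
    qed
  next
    fix g g' \<phi> assume R: "R g g'"
    show "R (push D \<phi> g) (push E \<phi> g')"
      unfolding R_def
    proof (intro ballI impI)
      fix p assume p: "p \<in> params D" "pt D p \<notin> ball z r"
      then have "crossing_param E p \<longleftrightarrow> crossing_param D p" "g' p = g p"
        using DE.crossing_param_outside[of p] ball[of p] R unfolding R_def by auto
      then show "push E \<phi> g' p = push D \<phi> g p" by (simp add: push_def par)
    qed
  qed
qed

section \<open>Invariance under the moves\<close>

context disc_arcs begin

lemma crossing_in_disc:
  assumes "crosses D (c i, t) (c j, u)" "i < k" "j < k" "t \<in> {a i..b i}" "u \<in> {a j..b j}"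
    and "l < k" "v \<in> {a l..b l}" "pt D (c l, v) = pt D (c i, t)"
  shows "(l, v) = (i, t) \<or> (l, v) = (j, u)"
proof (cases "same_param (c l, v) (c i, t)")
  case True
  then show ?thesis using arcs_disjoint[of l i v t] assms by simp
next
  case False
  then have "\<not> same_param (c i, t) (c l, v)" using same_param_sym by blast
  then have "crosses D (c i, t) (c l, v)"
    using assms arc_in_params by (simp add: crosses_def)
  then have "same_param (c l, v) (c j, u)" using crosses_unique assms(1) by blast
  then show ?thesis using arcs_disjoint[of l j v u] assms by simp
qed

lemma crossing_arc_interior:
  assumes "j < k" "t \<in> {a j..b j}" "crossing_param D (c j, t)"
  shows "t \<in> {a j<..<b j}" "pt D (c j, t) \<in> crossings D \<inter> ball z r"
proof -
  have "t \<noteq> a j" "t \<noteq> b j" using no_crossing_at_ends[OF assms(1)] assms(3) by auto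
  then show t: "t \<in> {a j<..<b j}" using assms(2) by auto
  show "pt D (c j, t) \<in> crossings D \<inter> ball z r"
    using arc_in_ball[OF assms(1) t] assms(3) by (simp add: crossing_param_iff)
qed

text \<open>Serves \<open>move_I\<close>, whose definition names the crossing point but not its two
  parameters.\<close>

lemma ball_crossing_in_arcs:
  assumes "crosses D p q" "pt D p \<in> ball z r"
  obtains i t j u where "i < k" "t \<in> {a i<..<b i}" "j < k" "u \<in> {a j<..<b j}"
    "pt D (c i, t) = pt D p" "crosses D (c i, t) (c j, u)"
proof -
  have pq: "p \<in> params D" "q \<in> params D" "pt D q = pt D p" using assms(1) by (auto simp: crosses_def)
  obtain i t where it: "i < k" "t \<in> {a i<..<b i}" "same_param p (c i, t)"
    using in_ball_iff[OF pq(1)] assms(2) by blast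
  obtain j u where ju: "j < k" "u \<in> {a j<..<b j}" "same_param q (c j, u)"
    using in_ball_iff[OF pq(2)] assms(2) pq(3) by auto
  have "crosses D (c i, t) (c j, u)" using crosses_same_param[OF it(3) ju(3)] assms(1) by simp
  moreover have "pt D (c i, t) = pt D p" using pt_same_param[OF pq(1) it(3)] by simp
  ultimately show thesis using that it(1,2) ju(1,2) by blast
qed

lemma no_crossing_arcs:
  assumes none: "crossings D \<inter> ball z r = {}"
    and s: "\<forall>j<k. a j < s j \<and> s j < s' j \<and> s' j < b j"
  shows "broken_arcs D z r k c a b s s'"
    "broken_arcs.local_coloring D k c s s' X x m w \<longleftrightarrow> (\<forall>j<k. x j \<in> carrier X \<and> m j = x j \<and> w j = x j)"
proof -
  have nc: "\<not> crossing_param D (c j, t)" if "j < k" "t \<in> {a j..b j}" for j t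
    using crossing_arc_interior(2)[OF that] none by blast
  show "broken_arcs D z r k c a b s s'"
    by unfold_locales (use s nc in auto)
  then interpret broken_arcs D z r k c a b s s' .
  have no: "\<not> crossing_param D (c j, s j)" "\<not> crossing_param D (c j, s' j)" if "j < k" for j
    using nc[OF that, of "s j"] nc[OF that, of "s' j"] s that by force+
  have "\<not> crosses D (c i, t) p" if "i < k" "t \<in> {s i, s' i}" for i t p
    using no[OF that(1)] that(2) unfolding crossing_param_def by blast
  then have "\<not> crosses D (c i, s i) p" "\<not> crosses D (c i, s' i) p" if "i < k" for i p
    using that by blast+
  then show "local_coloring X x m w \<longleftrightarrow> (\<forall>j<k. x j \<in> carrier X \<and> m j = x j \<and> w j = x j)"
    unfolding local_coloring_def using no by auto
qed

end

context broken_arcs begin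

definition arc_rule :: "('a, 'm) psyquandle_scheme \<Rightarrow> (nat \<Rightarrow> 'a) \<Rightarrow> (nat \<Rightarrow> 'a) \<Rightarrow> (nat \<Rightarrow> 'a) \<Rightarrow>
    nat \<times> real \<Rightarrow> nat \<times> real \<Rightarrow> bool" where
  "arc_rule X x m w p q \<longleftrightarrow>
     (case (p, q) of ((i, t), (j, u)) \<Rightarrow>
        oriented_rule (0 < turn D (c i, t) (c j, u))
          (strand_op X D (c i, t) (c j, u)) (strand_op X D (c j, u) (c i, t))
          (if t = s i then x i else m i) (if t = s i then m i else w i)
          (if u = s j then x j else m j) (if u = s j then m j else w j))"

lemma arc_rule_commute:
  assumes "crosses D (c i, t) (c j, u)"
  shows "arc_rule X x m w (i, t) (j, u) \<longleftrightarrow> arc_rule X x m w (j, u) (i, t)"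
  unfolding arc_rule_def prod.case turn_pos_iff[OF assms]
  by (rule oriented_rule_commute)

text \<open>\<open>C\<close> lists crossings in one order of their strands and touches every break.
  A passage has only one partner, so every rule of a local coloring comes from \<open>C\<close>,
  possibly with the strands exchanged; and as every break is a crossing, no equality of adjacent
  labels remains.\<close>

lemma local_coloring_iff:
  assumes crs: "\<And>i t j u. ((i, t), (j, u)) \<in> C \<Longrightarrow>
      i < k \<and> j < k \<and> t \<in> {s i, s' i} \<and> u \<in> {s j, s' j} \<and> crosses D (c i, t) (c j, u)"
    and cover: "\<And>i t. i < k \<Longrightarrow> t \<in> {s i, s' i} \<Longrightarrow> \<exists>q. ((i, t), q) \<in> C \<or> (q, (i, t)) \<in> C"
  shows "local_coloring X x m w \<longleftrightarrow>
    (\<forall>j<k. x j \<in> carrier X \<and> m j \<in> carrier X \<and> w j \<in> carrier X) \<and> (\<forall>(p, q)\<in>C. arc_rule X x m w p q)"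
proof -
  have break_crossing: "crossing_param D (c i, t)" if it: "i < k" "t \<in> {s i, s' i}" for i t
  proof -
    obtain q where "((i, t), q) \<in> C \<or> (q, (i, t)) \<in> C" using cover[OF it] by blast
    then obtain j u where "((i, t), (j, u)) \<in> C \<or> ((j, u), (i, t)) \<in> C" by (cases q) blast
    then have "crosses D (c i, t) (c j, u)" using crs crosses_commute by blast
    then show ?thesis unfolding crossing_param_def by blast
  qed
  have brk: "t \<in> {a i..b i}" if "i < k" "t \<in> {s i, s' i}" for i t
    using that breaks[OF that(1)] by auto
  have rule: "arc_rule X x m w (i, t) (j, u)"
    if all: "\<forall>(p, q)\<in>C. arc_rule X x m w p q"
      and ij: "i < k" "j < k" "t \<in> {s i, s' i}" "u \<in> {s j, s' j}" and c: "crosses D (c i, t) (c j, u)" for i t j u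
  proof -
    obtain y where "((i, t), y) \<in> C \<or> (y, (i, t)) \<in> C" using cover[OF ij(1,3)] by blast
    then obtain l v where lv: "((i, t), (l, v)) \<in> C \<or> ((l, v), (i, t)) \<in> C" by (cases y) blast
    then have *: "l < k" "v \<in> {s l, s' l}" "crosses D (c i, t) (c l, v)" using crs crosses_commute by blast+
    have "(l, v) = (j, u)"
      using arcs_disjoint[OF *(1) ij(2) brk[OF *(1,2)] brk[OF ij(2,4)] crosses_unique[OF *(3) c]] by simp
    then show ?thesis using all lv arc_rule_commute[OF c] by blast
  qed
  show ?thesis
  proof
    assume l: "local_coloring X x m w"
    have "arc_rule X x m w p q" if pq: "(p, q) \<in> C" for p q
    proof -
      obtain i t j u where e: "p = (i, t)" "q = (j, u)" by (cases p, cases q)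
      show ?thesis using local_coloring_rule[OF l, of i j t u] crs[of i t j u] pq unfolding e arc_rule_def by simp
    qed
    then show "(\<forall>j<k. x j \<in> carrier X \<and> m j \<in> carrier X \<and> w j \<in> carrier X) \<and> (\<forall>(p, q)\<in>C. arc_rule X x m w p q)"
      using l unfolding local_coloring_def by blast
  next
    assume r: "(\<forall>j<k. x j \<in> carrier X \<and> m j \<in> carrier X \<and> w j \<in> carrier X) \<and> (\<forall>(p, q)\<in>C. arc_rule X x m w p q)"
    then have "\<forall>j<k. x j \<in> carrier X \<and> m j \<in> carrier X \<and> w j \<in> carrier X \<and>
        (crossing_param D (c j, s j) \<or> x j = m j) \<and> (crossing_param D (c j, s' j) \<or> m j = w j)"
      using break_crossing by blast
    moreover note rule[OF conjunct2[OF r], unfolded arc_rule_def prod.case]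
    ultimately show "local_coloring X x m w" unfolding local_coloring_def by blast
  qed
qed

end

section \<open>Moves on one or two arcs\<close>

lemma crosses_over_ops:
  assumes "diagram D" "crosses_over D p q"
  shows "strand_op X D p q = tri_o X" "strand_op X D q p = tri_u X"
proof -
  interpret diagram D by (rule assms)
  have "crosses D p q" "pt D p \<notin> sing D" "p \<in> over D" "pt D q = pt D p" "q \<notin> over D"
    using assms(2) over_iff[of p q] by (auto simp: crosses_over_def crosses_def)
  then show "strand_op X D p q = tri_o X" "strand_op X D q p = tri_u X" by (simp_all add: strand_op_def)
qed

lemma crosses_singularly_ops:
  assumes "diagram D" "crosses_singularly D p q"
  shows "strand_op X D p q = (if 0 < turn D p q then dot_u X else dot_o X)"
    "strand_op X D q p = (if 0 < turn D p q then dot_o X else dot_u X)"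
proof -
  interpret diagram D by (rule assms)
  have "crosses D p q" "pt D p \<in> sing D" "pt D q = pt D p"
    using assms(2) by (auto simp: crosses_singularly_def crosses_def)
  then show "strand_op X D p q = (if 0 < turn D p q then dot_u X else dot_o X)"
    "strand_op X D q p = (if 0 < turn D p q then dot_o X else dot_u X)"
    using turn_pos_iff[of p q] by (simp_all add: strand_op_def)
qed

text \<open>Arc 1 may meet the two crossings in either order, so its breaks are the minimum and the
  maximum of \<open>t\<^sub>1\<close>, \<open>t\<^sub>2\<close>, and
  \<open>t\<^sub>1 < t\<^sub>2\<close> is the parameter \<open>par\<close> of
  \<open>clasp\<close>.\<close>

lemma (in disc_arcs) clasp_arcs:
  fixes X :: "('a, 'm) psyquandle_scheme"
  assumes k: "k = 2" and s: "{s\<^sub>1, s\<^sub>2} \<subseteq> {a 0<..<b 0}" "s\<^sub>1 < s\<^sub>2" and t: "{t\<^sub>1, t\<^sub>2} \<subseteq> {a 1<..<b 1}" "t\<^sub>1 \<noteq> t\<^sub>2"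
    and pts: "crossings D \<inter> ball z r = {pt D (c 0, s\<^sub>1), pt D (c 0, s\<^sub>2)}"
    and c1: "crosses D (c 0, s\<^sub>1) (c 1, t\<^sub>1)" and c2: "crosses D (c 0, s\<^sub>2) (c 1, t\<^sub>2)"
    and turns: "turn D (c 0, s\<^sub>1) (c 1, t\<^sub>1) = - turn D (c 0, s\<^sub>2) (c 1, t\<^sub>2)"
  defines "S \<equiv> (\<lambda>j::nat. if j = 0 then s\<^sub>1 else min t\<^sub>1 t\<^sub>2)"
    and "S' \<equiv> (\<lambda>j::nat. if j = 0 then s\<^sub>2 else max t\<^sub>1 t\<^sub>2)"
  shows "broken_arcs D z r k c a b S S'"
    "broken_arcs.local_coloring D k c S S' X x m w \<longleftrightarrow>
      (\<forall>j<k. x j \<in> carrier X \<and> m j \<in> carrier X \<and> w j \<in> carrier X) \<and>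
      clasp (t\<^sub>1 < t\<^sub>2) (0 < turn D (c 0, s\<^sub>1) (c 1, t\<^sub>1))
        (strand_op X D (c 0, s\<^sub>1) (c 1, t\<^sub>1)) (strand_op X D (c 1, t\<^sub>1) (c 0, s\<^sub>1))
        (strand_op X D (c 0, s\<^sub>2) (c 1, t\<^sub>2)) (strand_op X D (c 1, t\<^sub>2) (c 0, s\<^sub>2))
        (x 0) (m 0) (w 0) (x 1) (m 1) (w 1)"
proof -
  have less2: "j < k \<longleftrightarrow> j = 0 \<or> j = 1" for j using k by auto
  have at: "v = S l \<or> v = S' l" if l: "l < k" "v \<in> {a l..b l}" "crossing_param D (c l, v)" for l v
  proof -
    have "pt D (c l, v) = pt D (c 0, s\<^sub>1) \<or> pt D (c l, v) = pt D (c 0, s\<^sub>2)"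
      using crossing_arc_interior(2)[OF l] pts by blast
    then have "(l, v) \<in> {(0, s\<^sub>1), (1, t\<^sub>1), (0, s\<^sub>2), (1, t\<^sub>2)}"
      using crossing_in_disc[OF c1 _ _ _ _ l(1,2)] crossing_in_disc[OF c2 _ _ _ _ l(1,2)] s t less2 by auto
    then show ?thesis by (auto simp: S_def S'_def min_def max_def)
  qed
  show "broken_arcs D z r k c a b S S'"
  proof unfold_locales
    fix j assume "j < k"
    then show "a j < S j" "S j < S' j" "S' j < b j"
      using s t unfolding less2 S_def S'_def by (auto simp: min_def max_def)
  qed (rule at)
  then interpret broken_arcs D z r k c a b S S' .
  let ?C = "{((0, s\<^sub>1), (1, t\<^sub>1)), ((0::nat, s\<^sub>2), (1::nat, t\<^sub>2))}"
  have "local_coloring X x m w \<longleftrightarrow>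
    (\<forall>j<k. x j \<in> carrier X \<and> m j \<in> carrier X \<and> w j \<in> carrier X) \<and> (\<forall>(p, q)\<in>?C. arc_rule X x m w p q)"
  proof (rule local_coloring_iff)
    fix i t j u assume "((i, t), (j, u)) \<in> ?C"
    then show "i < k \<and> j < k \<and> t \<in> {S i, S' i} \<and> u \<in> {S j, S' j} \<and> crosses D (c i, t) (c j, u)"
      using c1 c2 k by (auto simp: S_def S'_def min_def max_def)
  next
    fix i t assume "i < k" "t \<in> {S i, S' i}"
    then have "(i, t) \<in> {(0, s\<^sub>1), (1, t\<^sub>1), (0, s\<^sub>2), (1, t\<^sub>2)}"
      unfolding less2 by (auto simp: S_def S'_def min_def max_def split: if_splits)
    then show "\<exists>q. ((i, t), q) \<in> ?C \<or> (q, (i, t)) \<in> ?C" by auto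
  qed
  moreover have "(\<forall>(p, q)\<in>?C. arc_rule X x m w p q) \<longleftrightarrow>
      clasp (t\<^sub>1 < t\<^sub>2) (0 < turn D (c 0, s\<^sub>1) (c 1, t\<^sub>1))
        (strand_op X D (c 0, s\<^sub>1) (c 1, t\<^sub>1)) (strand_op X D (c 1, t\<^sub>1) (c 0, s\<^sub>1))
        (strand_op X D (c 0, s\<^sub>2) (c 1, t\<^sub>2)) (strand_op X D (c 1, t\<^sub>2) (c 0, s\<^sub>2))
        (x 0) (m 0) (w 0) (x 1) (m 1) (w 1)"
  proof -
    have e: "(0 < turn D (c 0, s\<^sub>2) (c 1, t\<^sub>2)) = (\<not> 0 < turn D (c 0, s\<^sub>1) (c 1, t\<^sub>1))"
      using turns turn_nonzero[OF c2] by linarith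
    have S: "s\<^sub>1 = S 0" "(s\<^sub>2 = S 0) = False" "(t\<^sub>1 = S 1) = (t\<^sub>1 < t\<^sub>2)" "(t\<^sub>2 = S 1) = (\<not> t\<^sub>1 < t\<^sub>2)"
      using s(2) t(2) by (auto simp: S_def min_def)
    have "(\<forall>(p, q)\<in>?C. arc_rule X x m w p q) \<longleftrightarrow>
        arc_rule X x m w (0, s\<^sub>1) (1, t\<^sub>1) \<and> arc_rule X x m w (0, s\<^sub>2) (1, t\<^sub>2)" by simp
    also have "\<dots> \<longleftrightarrow> clasp (t\<^sub>1 < t\<^sub>2) (0 < turn D (c 0, s\<^sub>1) (c 1, t\<^sub>1))
        (strand_op X D (c 0, s\<^sub>1) (c 1, t\<^sub>1)) (strand_op X D (c 1, t\<^sub>1) (c 0, s\<^sub>1))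
        (strand_op X D (c 0, s\<^sub>2) (c 1, t\<^sub>2)) (strand_op X D (c 1, t\<^sub>2) (c 0, s\<^sub>2))
        (x 0) (m 0) (w 0) (x 1) (m 1) (w 1)"
      unfolding arc_rule_def prod.case clasp_def e S(2-4) by (cases "t\<^sub>1 < t\<^sub>2") (simp_all only: S(1)[symmetric] if_True if_False simp_thms)
    finally show ?thesis .
  qed
  ultimately show "local_coloring X x m w \<longleftrightarrow>
      (\<forall>j<k. x j \<in> carrier X \<and> m j \<in> carrier X \<and> w j \<in> carrier X) \<and>
      clasp (t\<^sub>1 < t\<^sub>2) (0 < turn D (c 0, s\<^sub>1) (c 1, t\<^sub>1))
        (strand_op X D (c 0, s\<^sub>1) (c 1, t\<^sub>1)) (strand_op X D (c 1, t\<^sub>1) (c 0, s\<^sub>1))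
        (strand_op X D (c 0, s\<^sub>2) (c 1, t\<^sub>2)) (strand_op X D (c 1, t\<^sub>2) (c 0, s\<^sub>2))
        (x 0) (m 0) (w 0) (x 1) (m 1) (w 1)" by simp
qed

context
  fixes X :: "('a, 'm) psyquandle_scheme" and S :: "('a \<Rightarrow> 'a) set"
  assumes X: "psyquandle X" and fin: "finite (carrier X)" and S: "S \<subseteq> psyquandle_hom X X"
begin

interpretation psyquandle X by (rule X)

lemma All_less_2: "(\<forall>j<2. P j) \<longleftrightarrow> P 0 \<and> P (1::nat)"
  by (auto simp: less_2_cases_iff)

lemma two_arcs_map:
  assumes "\<exists>m0\<in>carrier X. \<exists>m1\<in>carrier X. P m0 m1"
  shows "\<exists>m. (\<forall>j<(2::nat). m j \<in> carrier X) \<and> P (m 0) (m 1)"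
proof -
  obtain m0 m1 where "m0 \<in> carrier X" "m1 \<in> carrier X" "P m0 m1" using assms by blast
  then show ?thesis by (intro exI[of _ "\<lambda>j. if j = 0 then m0 else m1"]) simp
qed

text \<open>Arc 0 is over at both crossings, so these carry the same operations, and the opposite
  turns make them a cancelling clasp. It forces equal labels at the two ends of each arc, as on arcs
  without crossings.\<close>

lemma move_II_equiv:
  assumes D: "is_singular_diagram D" and D': "is_singular_diagram D'" and mv: "move_II D D'"
  shows "coloring_equiv X S D D'"
proof -
  obtain z r c a b s\<^sub>1 s\<^sub>2 t\<^sub>1 t\<^sub>2 where diff: "differ_in_disc D D' z r 2 c a b"
    and none: "crossings D \<inter> ball z r = {}"
    and st: "{s\<^sub>1, s\<^sub>2} \<subseteq> {a 0<..<b 0}" "{t\<^sub>1, t\<^sub>2} \<subseteq> {a 1<..<b 1}" "s\<^sub>1 < s\<^sub>2" "t\<^sub>1 \<noteq> t\<^sub>2"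
    and pts: "crossings D' \<inter> ball z r = {pt D' (c 0, s\<^sub>1), pt D' (c 0, s\<^sub>2)}"
    and o: "crosses_over D' (c 0, s\<^sub>1) (c 1, t\<^sub>1)" "crosses_over D' (c 0, s\<^sub>2) (c 1, t\<^sub>2)"
    and turns: "turn D' (c 0, s\<^sub>1) (c 1, t\<^sub>1) = - turn D' (c 0, s\<^sub>2) (c 1, t\<^sub>2)"
    using mv unfolding move_II_def by (elim exE conjE) (rule that)
  have meets: "meets_disc_in_arcs D z r 2 c a b" "meets_disc_in_arcs D' z r 2 c a b"
    using diff by (auto simp: differ_in_disc_def)
  have dg': "diagram D'" by unfold_locales (rule D')
  interpret D: disc_arcs D z r 2 c a b by unfold_locales (rule D, rule meets)
  interpret E: disc_arcs D' z r 2 c a b by unfold_locales (rule D', rule meets)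
  define s s' where "s = (\<lambda>j::nat. if j = 0 then s\<^sub>1 else min t\<^sub>1 t\<^sub>2)" "s' = (\<lambda>j::nat. if j = 0 then s\<^sub>2 else max t\<^sub>1 t\<^sub>2)"
  have crs: "crosses D' (c 0, s\<^sub>1) (c 1, t\<^sub>1)" "crosses D' (c 0, s\<^sub>2) (c 1, t\<^sub>2)"
    using o by (auto simp: crosses_over_def)
  let ?e = "0 < turn D' (c 0, s\<^sub>1) (c 1, t\<^sub>1)"
  note E = E.clasp_arcs[OF refl st(1,3,2,4) pts crs turns, folded s_s'_def,
      unfolded crosses_over_ops[OF dg' o(1)] crosses_over_ops[OF dg' o(2)]]
  have brk: "\<forall>j<2. a j < s j \<and> s j < s' j \<and> s' j < b j"
    using broken_arcs.breaks[OF E(1)] by blast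
  note Dl = D.no_crossing_arcs[OF none brk]
  show ?thesis
  proof (rule disc_change_equiv[OF S diff Dl(1) E(1)])
    fix x m w assume "broken_arcs.local_coloring D 2 c s s' X x m w"
    then have x: "\<forall>j<2. x j \<in> carrier X \<and> m j = x j \<and> w j = x j" unfolding Dl(2) .
    have xC: "x 0 \<in> carrier X" "x 1 \<in> carrier X" and w: "w 0 = x 0" "w 1 = x 1" using x by simp_all
    obtain m0 m1 where "m0 \<in> carrier X" "m1 \<in> carrier X"
      "clasp (t\<^sub>1 < t\<^sub>2) ?e (tri_o X) (tri_u X) (tri_o X) (tri_u X) (x 0) m0 (x 0) (x 1) m1 (x 1)"
      using cancelling_clasp_exists[OF cl.flipped xC, of "t\<^sub>1 < t\<^sub>2" ?e] by blast
    moreover have "\<forall>j<2. x j \<in> carrier X \<and> w j \<in> carrier X" using x by simp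
    ultimately show "\<exists>m'. broken_arcs.local_coloring D' 2 c s s' X x m' w"
      unfolding E(2) w by (intro exI[of _ "\<lambda>j. if j = 0 then m0 else m1"]) simp
  next
    fix x m w assume "broken_arcs.local_coloring D' 2 c s s' X x m w"
    then have x: "\<forall>j<2. x j \<in> carrier X \<and> m j \<in> carrier X \<and> w j \<in> carrier X"
      and cl: "clasp (t\<^sub>1 < t\<^sub>2) ?e (tri_o X) (tri_u X) (tri_o X) (tri_u X) (x 0) (m 0) (w 0) (x 1) (m 1) (w 1)"
      unfolding E(2) by simp_all
    have "x 0 = w 0 \<and> x 1 = w 1" by (rule cancelling_clasp[OF cl.flipped _ cl]) (use x in simp)
    then have "\<forall>j<2. w j = x j" by (simp add: All_less_2)
    then show "\<exists>m'. broken_arcs.local_coloring D 2 c s s' X x m' w"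
      unfolding Dl(2) using x by blast
  next
    fix x m m' w assume "broken_arcs.local_coloring D 2 c s s' X x m w" "broken_arcs.local_coloring D 2 c s s' X x m' w"
    then show "\<forall>j<2. m j = m' j" unfolding Dl(2) by simp
  next
    fix x m m' w assume "broken_arcs.local_coloring D' 2 c s s' X x m w" "broken_arcs.local_coloring D' 2 c s s' X x m' w"
    then have x: "\<forall>j<2. x j \<in> carrier X \<and> m j \<in> carrier X \<and> w j \<in> carrier X" "\<forall>j<2. m' j \<in> carrier X"
      and cl: "clasp (t\<^sub>1 < t\<^sub>2) ?e (tri_o X) (tri_u X) (tri_o X) (tri_u X) (x 0) (m 0) (w 0) (x 1) (m 1) (w 1)"
        "clasp (t\<^sub>1 < t\<^sub>2) ?e (tri_o X) (tri_u X) (tri_o X) (tri_u X) (x 0) (m' 0) (w 0) (x 1) (m' 1) (w 1)"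
      unfolding E(2) by simp_all
    have "m 0 = m' 0 \<and> w 0 = w 0 \<and> x 1 = x 1 \<and> m 1 = m' 1 \<and> w 1 = w 1"
      by (rule clasp_unique[OF cl.flipped cl.flipped _ _ cl]) (use x in auto)
    then show "\<forall>j<2. m j = m' j" by (simp add: All_less_2)
  qed
qed

text \<open>The move reverses the turn at either kind of crossing. At the singular one this
  interchanges the operations of the two arcs; at the classical one the sign is kept, so over and
  under are interchanged, with the same effect. Both pairs are therefore flipped as in
  \<open>exchange_forward\<close>.\<close>

lemma move_exchange_equiv:
  assumes D: "is_singular_diagram D" and D': "is_singular_diagram D'" and mv: "move_exchange D D'"
  shows "coloring_equiv X S D D'"
proof -
  obtain z r c a b s\<^sub>1 s\<^sub>2 t\<^sub>1 t\<^sub>2 u\<^sub>1 u\<^sub>2 v\<^sub>1 v\<^sub>2 d e where diff: "differ_in_disc D D' z r 2 c a b"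
    and arcs: "{s\<^sub>1, s\<^sub>2, u\<^sub>1, u\<^sub>2} \<subseteq> {a 0<..<b 0}" "{t\<^sub>1, t\<^sub>2, v\<^sub>1, v\<^sub>2} \<subseteq> {a 1<..<b 1}"
    and ord: "s\<^sub>1 < s\<^sub>2" "u\<^sub>1 < u\<^sub>2" "t\<^sub>1 \<noteq> t\<^sub>2" "v\<^sub>1 \<noteq> v\<^sub>2" "(t\<^sub>1 < t\<^sub>2) = (v\<^sub>1 < v\<^sub>2)"
    and pts: "crossings D \<inter> ball z r = {pt D (c 0, s\<^sub>1), pt D (c 0, s\<^sub>2)}"
      "crossings D' \<inter> ball z r = {pt D' (c 0, u\<^sub>1), pt D' (c 0, u\<^sub>2)}"
    and types: "crosses_singularly D (c 0, s\<^sub>1) (c 1, t\<^sub>1)" "crossing_sign D (c 0, s\<^sub>2) (c 1, t\<^sub>2) e"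
      "crossing_sign D' (c 0, u\<^sub>1) (c 1, v\<^sub>1) e" "crosses_singularly D' (c 0, u\<^sub>2) (c 1, v\<^sub>2)"
    and turns: "turn D (c 0, s\<^sub>1) (c 1, t\<^sub>1) = d" "turn D (c 0, s\<^sub>2) (c 1, t\<^sub>2) = - d"
      "turn D' (c 0, u\<^sub>1) (c 1, v\<^sub>1) = d" "turn D' (c 0, u\<^sub>2) (c 1, v\<^sub>2) = - d"
    using mv unfolding move_exchange_def by (elim exE conjE) (rule that)
  have meets: "meets_disc_in_arcs D z r 2 c a b" "meets_disc_in_arcs D' z r 2 c a b"
    using diff by (auto simp: differ_in_disc_def)
  have dg: "diagram D" "diagram D'" by unfold_locales (rule D D')+
  interpret D: disc_arcs D z r 2 c a b by unfold_locales (rule D, rule meets)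
  interpret E: disc_arcs D' z r 2 c a b by unfold_locales (rule D', rule meets)
  have crs: "crosses D (c 0, s\<^sub>1) (c 1, t\<^sub>1)" "crosses D (c 0, s\<^sub>2) (c 1, t\<^sub>2)"
    "crosses D' (c 0, u\<^sub>1) (c 1, v\<^sub>1)" "crosses D' (c 0, u\<^sub>2) (c 1, v\<^sub>2)"
    using types crosses_commute by (auto simp: crosses_singularly_def crosses_over_def crossing_sign_def)
  have d: "d \<noteq> 0" using D.turn_nonzero[OF crs(1)] turns(1) by simp
  define fs hs where "fs = strand_op X D (c 0, s\<^sub>1) (c 1, t\<^sub>1)" "hs = strand_op X D (c 1, t\<^sub>1) (c 0, s\<^sub>1)"
  define fc hc where "fc = strand_op X D (c 0, s\<^sub>2) (c 1, t\<^sub>2)" "hc = strand_op X D (c 1, t\<^sub>2) (c 0, s\<^sub>2)"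
  have dots: "(fs, hs) = (if 0 < d then (dot_u X, dot_o X) else (dot_o X, dot_u X))"
    using crosses_singularly_ops[OF dg(1) types(1), of X] turns(1) by (simp add: fs_hs_def)
  have dots': "strand_op X D' (c 0, u\<^sub>2) (c 1, v\<^sub>2) = hs" "strand_op X D' (c 1, v\<^sub>2) (c 0, u\<^sub>2) = fs"
    using crosses_singularly_ops[OF dg(2) types(4), of X] turns(4) dots d by (auto split: if_splits)
  have tris: "(fc, hc) \<in> {(tri_u X, tri_o X), (tri_o X, tri_u X)} \<and>
      strand_op X D' (c 0, u\<^sub>1) (c 1, v\<^sub>1) = hc \<and> strand_op X D' (c 1, v\<^sub>1) (c 0, u\<^sub>1) = fc"
  \<comment> \<open>The sign is the turn taken from the over-strand, so \<open>e = - d\<close> means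
    that arc 0 is over in \<open>D\<close> and under in \<open>D'\<close>.\<close>
  proof (cases "e = - d")
    case True
    then have "crosses_over D (c 0, s\<^sub>2) (c 1, t\<^sub>2)" "crosses_over D' (c 1, v\<^sub>1) (c 0, u\<^sub>1)"
      using types(2,3) turns(2,3) d turn_commute[of D "(c 1, t\<^sub>2)" "(c 0, s\<^sub>2)"] by (auto simp: crossing_sign_def)
    from crosses_over_ops[OF dg(1) this(1), of X] crosses_over_ops[OF dg(2) this(2), of X]
    show ?thesis by (simp add: fc_hc_def)
  next
    case False
    then have "crosses_over D (c 1, t\<^sub>2) (c 0, s\<^sub>2)" "crosses_over D' (c 0, u\<^sub>1) (c 1, v\<^sub>1)"
      using types(2,3) turns(2,3) d turn_commute[of D' "(c 1, v\<^sub>1)" "(c 0, u\<^sub>1)"] by (auto simp: crossing_sign_def)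
    from crosses_over_ops[OF dg(1) this(1), of X] crosses_over_ops[OF dg(2) this(2), of X]
    show ?thesis by (simp add: fc_hc_def)
  qed
  define s s' where "s = (\<lambda>j::nat. if j = 0 then s\<^sub>1 else min t\<^sub>1 t\<^sub>2)" "s' = (\<lambda>j::nat. if j = 0 then s\<^sub>2 else max t\<^sub>1 t\<^sub>2)"
  define q q' where "q = (\<lambda>j::nat. if j = 0 then u\<^sub>1 else min v\<^sub>1 v\<^sub>2)" "q' = (\<lambda>j::nat. if j = 0 then u\<^sub>2 else max v\<^sub>1 v\<^sub>2)"
  let ?par = "t\<^sub>1 < t\<^sub>2"
  have sub: "{s\<^sub>1, s\<^sub>2} \<subseteq> {a 0<..<b 0}" "{t\<^sub>1, t\<^sub>2} \<subseteq> {a 1<..<b 1}" "{u\<^sub>1, u\<^sub>2} \<subseteq> {a 0<..<b 0}" "{v\<^sub>1, v\<^sub>2} \<subseteq> {a 1<..<b 1}"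
    using arcs by auto
  have tt: "turn D (c 0, s\<^sub>1) (c 1, t\<^sub>1) = - turn D (c 0, s\<^sub>2) (c 1, t\<^sub>2)"
    "turn D' (c 0, u\<^sub>1) (c 1, v\<^sub>1) = - turn D' (c 0, u\<^sub>2) (c 1, v\<^sub>2)" using turns by simp_all
  note L1 = D.clasp_arcs(1)[OF refl sub(1) ord(1) sub(2) ord(3) pts(1) crs(1,2) tt(1), folded s_s'_def]
  note L2 = D.clasp_arcs(2)[OF refl sub(1) ord(1) sub(2) ord(3) pts(1) crs(1,2) tt(1), folded s_s'_def,
      where X = X, folded fs_hs_def fc_hc_def, unfolded turns(1)]
  note L = L1 L2
  note L1' = E.clasp_arcs(1)[OF refl sub(3) ord(2) sub(4) ord(4) pts(2) crs(3,4) tt(2), folded q_q'_def]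
  note L2' = E.clasp_arcs(2)[OF refl sub(3) ord(2) sub(4) ord(4) pts(2) crs(3,4) tt(2), folded q_q'_def,
      where X = X, unfolded dots' conjunct1[OF conjunct2[OF tris]] conjunct2[OF conjunct2[OF tris]] turns(3) ord(5)[symmetric]]
  note L' = L1' L2'
  have ops: "crossing_ops (carrier X) fs hs" "crossing_ops (carrier X) hs fs"
    "crossing_ops (carrier X) fc hc" "crossing_ops (carrier X) hc fc"
    using dots tris classical_ops singular_ops cl.flipped si.flipped by (auto split: if_splits)
  show ?thesis
  proof (rule disc_change_equiv[OF S diff L(1) L'(1)])
    fix x m w assume "broken_arcs.local_coloring D 2 c s s' X x m w"
    then have x: "\<forall>j<2. x j \<in> carrier X \<and> m j \<in> carrier X \<and> w j \<in> carrier X"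
      and cl: "clasp ?par (0 < d) fs hs fc hc (x 0) (m 0) (w 0) (x 1) (m 1) (w 1)"
      unfolding L(2) by simp_all
    have xC: "{x 0, m 0, w 0, x 1, m 1, w 1} \<subseteq> carrier X" using x by simp
    show "\<exists>m'. broken_arcs.local_coloring D' 2 c q q' X x m' w"
      unfolding L'(2) using two_arcs_map[OF exchange_forward[OF fin xC dots conjunct1[OF tris] cl]] x by auto
  next
    fix x m w assume "broken_arcs.local_coloring D' 2 c q q' X x m w"
    then have x: "\<forall>j<2. x j \<in> carrier X \<and> m j \<in> carrier X \<and> w j \<in> carrier X"
      and cl: "clasp ?par (0 < d) hc fc hs fs (x 0) (m 0) (w 0) (x 1) (m 1) (w 1)"
      unfolding L'(2) by simp_all
    have xC: "{x 0, m 0, w 0, x 1, m 1, w 1} \<subseteq> carrier X" using x by simp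
    show "\<exists>m'. broken_arcs.local_coloring D 2 c s s' X x m' w"
      unfolding L(2) using two_arcs_map[OF exchange_backward[OF fin xC dots conjunct1[OF tris] cl]] x by auto
  next
    fix x m m' w assume "broken_arcs.local_coloring D 2 c s s' X x m w" "broken_arcs.local_coloring D 2 c s s' X x m' w"
    then have x: "\<forall>j<2. x j \<in> carrier X \<and> m j \<in> carrier X \<and> w j \<in> carrier X" "\<forall>j<2. m' j \<in> carrier X"
      and cl: "clasp ?par (0 < d) fs hs fc hc (x 0) (m 0) (w 0) (x 1) (m 1) (w 1)"
        "clasp ?par (0 < d) fs hs fc hc (x 0) (m' 0) (w 0) (x 1) (m' 1) (w 1)"
      unfolding L(2) by simp_all
    have "m 0 = m' 0 \<and> w 0 = w 0 \<and> x 1 = x 1 \<and> m 1 = m' 1 \<and> w 1 = w 1"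
      by (rule clasp_unique[OF ops(1,3) _ _ cl]) (use x in auto)
    then show "\<forall>j<2. m j = m' j" by (simp add: All_less_2)
  next
    fix x m m' w assume "broken_arcs.local_coloring D' 2 c q q' X x m w" "broken_arcs.local_coloring D' 2 c q q' X x m' w"
    then have x: "\<forall>j<2. x j \<in> carrier X \<and> m j \<in> carrier X \<and> w j \<in> carrier X" "\<forall>j<2. m' j \<in> carrier X"
      and cl: "clasp ?par (0 < d) hc fc hs fs (x 0) (m 0) (w 0) (x 1) (m 1) (w 1)"
        "clasp ?par (0 < d) hc fc hs fs (x 0) (m' 0) (w 0) (x 1) (m' 1) (w 1)"
      unfolding L'(2) by simp_all
    have "m 0 = m' 0 \<and> w 0 = w 0 \<and> x 1 = x 1 \<and> m 1 = m' 1 \<and> w 1 = w 1"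
      by (rule clasp_unique[OF ops(4,2) _ _ cl]) (use x in auto)
    then show "\<forall>j<2. m j = m' j" by (simp add: All_less_2)
  qed
qed

lemma move_I_equiv:
  assumes D: "is_singular_diagram D" and D': "is_singular_diagram D'" and mv: "move_I D D'"
  shows "coloring_equiv X S D D'"
proof -
  obtain z r c a b v where diff: "differ_in_disc D D' z r 1 c a b"
    and none: "crossings D \<inter> ball z r = {}"
    and v: "crossings D' \<inter> ball z r = {v}" "v \<notin> sing D'"
    using mv unfolding move_I_def by (elim exE conjE) (rule that)
  have meets: "meets_disc_in_arcs D z r 1 c a b" "meets_disc_in_arcs D' z r 1 c a b"
    using diff by (auto simp: differ_in_disc_def)
  interpret D: disc_arcs D z r 1 c a b by unfold_locales (rule D, rule meets)
  interpret E: disc_arcs D' z r 1 c a b by unfold_locales (rule D', rule meets)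
  have "v \<in> crossings D'" using v(1) by blast
  then obtain p q where pq: "crosses D' p q" "pt D' p = v" unfolding crossings_def by blast
  have "pt D' p \<in> ball z r" using v(1) pq(2) by blast
  from E.ball_crossing_in_arcs[OF pq(1) this]
  \<comment> \<open>With a single arc in the disc, both passages lie on arc 0.\<close>
  obtain t u where tu: "t \<in> {a 0<..<b 0}" "u \<in> {a 0<..<b 0}" "pt D' (c 0, t) = v" "crosses D' (c 0, t) (c 0, u)"
    using pq(2) by (metis less_one)
  then have tu': "crosses D' (c 0, u) (c 0, t)" "pt D' (c 0, u) = v" "t \<noteq> u"
    using crosses_commute by (auto simp: crosses_def)
  \<comment> \<open>In increasing order the passages are the two breaks. The piece between them is
    the loop of the kink, whose label therefore occurs twice in the rule.\<close>
  define y y' where "y = min t u" "y' = max t u"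
  have y: "y \<in> {a 0<..<b 0}" "y' \<in> {a 0<..<b 0}" "y < y'" "pt D' (c 0, y) = v" "crosses D' (c 0, y) (c 0, y')"
    using tu tu' by (auto simp: y_y'_def min_def max_def)
  define s s' where "s = (\<lambda>j::nat. y)" "s' = (\<lambda>j::nat. y')"
  have at: "t = s l \<or> t = s' l" if l: "l < 1" "t \<in> {a l..b l}" "crossing_param D' (c l, t)" for l t
  proof -
    have "pt D' (c l, t) = pt D' (c 0, y)" using E.crossing_arc_interior(2)[OF l] v(1) y(4) by blast
    then have "(l, t) = (0, y) \<or> (l, t) = (0, y')"
      using E.crossing_in_disc[OF y(5) _ _ _ _ l(1,2)] y by simp
    then show ?thesis by (auto simp: s_s'_def)
  qed
  have brk: "\<forall>j<1. a j < s j \<and> s j < s' j \<and> s' j < b j" using y by (simp add: s_s'_def)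
  have E1: "broken_arcs D' z r 1 c a b s s'" by unfold_locales (use brk at in auto)
  interpret E: broken_arcs D' z r 1 c a b s s' by (rule E1)
  let ?e = "0 < turn D' (c 0, y) (c 0, y')"
  define f h where "f = strand_op X D' (c 0, y) (c 0, y')" "h = strand_op X D' (c 0, y') (c 0, y)"
  have "pt D' (c 0, y') = v" using y(4,5) by (simp add: crosses_def)
  then have tris: "(f, h) \<in> {(tri_u X, tri_o X), (tri_o X, tri_u X)}"
    using E.over_iff[OF y(5)] v(2) y(4) by (simp add: f_h_def strand_op_def)
  have ops: "crossing_ops (carrier X) f h" using tris classical_ops cl.flipped by auto
  have E2: "E.local_coloring X x m w \<longleftrightarrow>
      x 0 \<in> carrier X \<and> m 0 \<in> carrier X \<and> w 0 \<in> carrier X \<and> oriented_rule ?e f h (x 0) (m 0) (m 0) (w 0)" for x m w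
  proof -
    have "E.local_coloring X x m w \<longleftrightarrow> (\<forall>j<1. x j \<in> carrier X \<and> m j \<in> carrier X \<and> w j \<in> carrier X) \<and>
        (\<forall>(p, q)\<in>{((0, y), (0, y'))}. E.arc_rule X x m w p q)"
      by (rule E.local_coloring_iff) (use y(5) in \<open>auto simp: s_s'_def\<close>)
    moreover have "E.arc_rule X x m w (0, y) (0, y') \<longleftrightarrow> oriented_rule ?e f h (x 0) (m 0) (m 0) (w 0)"
      using y(3) unfolding E.arc_rule_def by (simp add: s_s'_def f_h_def)
    ultimately show ?thesis by simp
  qed
  note Dl = D.no_crossing_arcs[OF none brk]
  show ?thesis
  proof (rule disc_change_equiv[OF S diff Dl(1) E1])
    fix x m w assume "broken_arcs.local_coloring D 1 c s s' X x m w"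
    then have x: "x 0 \<in> carrier X" "w 0 = x 0" unfolding Dl(2) by simp_all
    obtain n where "n \<in> carrier X" "oriented_rule ?e f h (x 0) n n (x 0)"
      using kink_exists[OF fin x(1) tris] by blast
    then show "\<exists>m'. E.local_coloring X x m' w"
      unfolding E2 x(2) using x(1) by (intro exI[of _ "\<lambda>_. n"]) simp
  next
    fix x m w assume "E.local_coloring X x m w"
    then have x: "x 0 \<in> carrier X" "m 0 \<in> carrier X" "w 0 \<in> carrier X" "oriented_rule ?e f h (x 0) (m 0) (m 0) (w 0)"
      unfolding E2 by simp_all
    have "x 0 = w 0" by (rule kink[OF fin _ tris x(4)]) (use x in simp)
    then have "\<forall>j<1. x j \<in> carrier X \<and> x j = x j \<and> w j = x j" using x(1) by simp
    then show "\<exists>m'. broken_arcs.local_coloring D 1 c s s' X x m' w" unfolding Dl(2) by blast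
  next
    fix x m m' w assume "broken_arcs.local_coloring D 1 c s s' X x m w" "broken_arcs.local_coloring D 1 c s s' X x m' w"
    then show "\<forall>j<1. m j = m' j" unfolding Dl(2) by simp
  next
    fix x m m' w assume "E.local_coloring X x m w" "E.local_coloring X x m' w"
    then have x: "x 0 \<in> carrier X" "m 0 \<in> carrier X" "w 0 \<in> carrier X" "m' 0 \<in> carrier X"
        "oriented_rule ?e f h (x 0) (m 0) (m 0) (w 0)" "oriented_rule ?e f h (x 0) (m' 0) (m' 0) (w 0)"
      unfolding E2 by simp_all
    have "m 0 = m' 0 \<and> x 0 = x 0 \<and> w 0 = w 0 \<and> m 0 = m' 0"
      by (rule crossing_ops.rule_unique[OF ops x(5,6)]) (use x in simp_all)
    then show "\<forall>j<1. m j = m' j" by simp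
  qed
qed

end

section \<open>Moves on three arcs\<close>

definition next_arc :: "nat \<Rightarrow> nat" where
  "next_arc i = (if i = 0 then 1 else if i = 1 then 2 else 0)"

definition prev_arc :: "nat \<Rightarrow> nat" where
  "prev_arc i = (if i = 0 then 2 else if i = 1 then 0 else 1)"

definition tri_break :: "(nat \<Rightarrow> nat \<Rightarrow> real) \<Rightarrow> nat \<Rightarrow> real" where
  "tri_break T i = min (T i (next_arc i)) (T i (prev_arc i))"

definition tri_break' :: "(nat \<Rightarrow> nat \<Rightarrow> real) \<Rightarrow> nat \<Rightarrow> real" where
  "tri_break' T i = max (T i (next_arc i)) (T i (prev_arc i))"

lemma less_3_iff: "i < 3 \<longleftrightarrow> i = 0 \<or> i = 1 \<or> i = (2::nat)"
  by auto

text \<open>The third conclusion turns the order condition in \<open>triangle\<close> into one on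
  \<open>F\<close> and \<open>e\<close>, from which coherence of the sides is derived later.\<close>

lemma (in disc_arcs) triangle_arcs:
  fixes X :: "('a, 'm) psyquandle_scheme"
  assumes k: "k = 3" and tri: "triangle D z r c a b T \<tau>"
    and ops: "\<forall>i<3. \<forall>j<3. i \<noteq> j \<longrightarrow> strand_op X D (c i, T i j) (c j, T j i) = f i j"
    and f: "triangle_ops (carrier X) f"
  defines "e \<equiv> (\<lambda>i j. 0 < turn D (c i, T i j) (c j, T j i))"
    and "F \<equiv> (\<lambda>i j. T i j = tri_break T i)"
  shows "broken_arcs D z r k c a b (tri_break T) (tri_break' T)"
    "broken_arcs.local_coloring D k c (tri_break T) (tri_break' T) X x m w \<longleftrightarrow>
      (\<forall>j<3. x j \<in> carrier X \<and> m j \<in> carrier X \<and> w j \<in> carrier X) \<and> triangle_ops.triangle_rules f e F x m w"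
    "\<And>i j l. (i, j, l) \<in> {(0, 1, 2), (1, 2, 0), (2, 0, 1)} \<Longrightarrow> F i j = (e j l = \<tau>) \<and> F i l = (\<not> F i j)"
proof -
  have T: "T i j \<in> {a i<..<b i}" "crosses D (c i, T i j) (c j, T j i)" if "i < 3" "j < 3" "i \<noteq> j" for i j
    using tri that unfolding triangle_def by blast+
  have Tc: "T i j \<in> {a i..b i}" if "i < 3" "j < 3" "i \<noteq> j" for i j using T(1)[OF that] by simp
  have pts: "crossings D \<inter> ball z r = {pt D (c i, T i j) | i j. i < 3 \<and> j < 3 \<and> i \<noteq> j}"
    using tri unfolding triangle_def by (elim conjE)
  have "\<forall>(i, j, l) \<in> {(0, 1, 2), (1, 2, 0), (2, 0, 1)}.
      ((T i j < T i l) = (0 < turn D (c j, T j l) (c l, T l j))) = \<tau>"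
    using tri unfolding triangle_def by (elim conjE)
  then have order: "((T i j < T i l) = e j l) = \<tau>" if "(i, j, l) \<in> {(0, 1, 2), (1, 2, 0), (2, 0, 1)}" for i j l
    using that unfolding e_def by fast
  \<comment> \<open>Equal parameters would give one passage two partners lying on different
    arcs.\<close>
  have ne: "T i j \<noteq> T i l" if "i < 3" "j < 3" "l < 3" "distinct [i, j, l]" for i j l
  proof
    assume eq: "T i j = T i l"
    have "same_param (c j, T j i) (c l, T l i)"
      using crosses_unique[OF T(2)[of i j], of "(c l, T l i)"] T(2)[of i l] that eq by simp
    then show False using arcs_disjoint[of j l "T j i" "T l i"] Tc[of j i] Tc[of l i] that k by simp
  qed
  have at: "v = tri_break T l \<or> v = tri_break' T l"
    if l: "l < k" "v \<in> {a l..b l}" "crossing_param D (c l, v)" for l v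
  proof -
    obtain i j where ij: "i < 3" "j < 3" "i \<noteq> j" "pt D (c l, v) = pt D (c i, T i j)"
      using crossing_arc_interior(2)[OF l] unfolding pts by blast
    have "(l, v) = (i, T i j) \<or> (l, v) = (j, T j i)"
      by (rule crossing_in_disc[OF T(2)[OF ij(1-3)] _ _ _ _ l(1,2) ij(4)]) (use ij Tc k in auto)
    then obtain j' where "j' < 3" "l \<noteq> j'" "v = T l j'" using ij by auto
    moreover from this have "j' = next_arc l \<or> j' = prev_arc l"
      using l(1) unfolding k less_3_iff by (auto simp: next_arc_def prev_arc_def)
    ultimately show ?thesis by (auto simp: tri_break_def tri_break'_def min_def max_def)
  qed
  have mods: "next_arc i < 3 \<and> prev_arc i < 3 \<and> distinct [i, next_arc i, prev_arc i]" if "i < 3" for i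
    using that unfolding less_3_iff by (auto simp: next_arc_def prev_arc_def)
  show 1: "broken_arcs D z r k c a b (tri_break T) (tri_break' T)"
  proof unfold_locales
    fix j assume "j < k"
    then have j: "j < 3" using k by simp
    note m = mods[OF j]
    have "T j (next_arc j) \<in> {a j<..<b j}" "T j (prev_arc j) \<in> {a j<..<b j}" "T j (next_arc j) \<noteq> T j (prev_arc j)"
      using T(1)[OF j] ne[OF j] m by auto
    then show "a j < tri_break T j" "tri_break T j < tri_break' T j" "tri_break' T j < b j"
      by (auto simp: tri_break_def tri_break'_def min_def max_def)
  qed (rule at)
  interpret broken_arcs D z r k c a b "tri_break T" "tri_break' T" by (rule 1)
  interpret t: triangle_ops "carrier X" f by (rule f)
  have F: "F i j = (T i j < T i l)" if ijl: "i < 3" "j < 3" "l < 3" "distinct [i, j, l]" for i j l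
  proof -
    have "tri_break T i = min (T i j) (T i l)"
      using ijl unfolding less_3_iff tri_break_def by (auto simp: next_arc_def prev_arc_def min.commute)
    then show ?thesis using ne[OF ijl] by (auto simp: F_def min_def)
  qed
  show "F i j = (e j l = \<tau>) \<and> F i l = (\<not> F i j)" if ijl: "(i, j, l) \<in> {(0, 1, 2), (1, 2, 0), (2, 0, 1)}" for i j l
  proof -
    have d: "i < 3" "j < 3" "l < 3" "distinct [i, j, l]" using ijl by auto
    then have d': "distinct [i, l, j]" by auto
    have "F i l = (\<not> F i j)" using ne[OF d] unfolding F[OF d] F[OF d(1,3,2) d'] by auto
    moreover have "F i j = (e j l = \<tau>)" using order[OF ijl] unfolding F[OF d] by blast
    ultimately show ?thesis by blast
  qed
  let ?C = "{((0, T 0 1), (1, T 1 0)), ((0, T 0 2), (2, T 2 0)), ((1, T 1 2), (2::nat, T 2 1))} :: ((nat \<times> real) \<times> (nat \<times> real)) set"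
  have brk: "T i j \<in> {tri_break T i, tri_break' T i}" if "i < 3" "j < 3" "i \<noteq> j" for i j
    using that unfolding less_3_iff by (auto simp: tri_break_def tri_break'_def next_arc_def prev_arc_def min_def max_def)
  have "local_coloring X x m w \<longleftrightarrow>
    (\<forall>j<k. x j \<in> carrier X \<and> m j \<in> carrier X \<and> w j \<in> carrier X) \<and> (\<forall>(p, q)\<in>?C. arc_rule X x m w p q)"
  proof (rule local_coloring_iff)
    fix i t j u assume "((i, t), (j, u)) \<in> ?C"
    then have "i < 3 \<and> j < 3 \<and> i \<noteq> j \<and> t = T i j \<and> u = T j i" by auto
    then show "i < k \<and> j < k \<and> t \<in> {tri_break T i, tri_break' T i} \<and> u \<in> {tri_break T j, tri_break' T j} \<and>
        crosses D (c i, t) (c j, u)"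
      using brk T(2) k by simp
  next
    fix i t assume "i < k" "t \<in> {tri_break T i, tri_break' T i}"
    moreover from this have "t = T i (next_arc i) \<or> t = T i (prev_arc i)"
      by (cases "T i (next_arc i) \<le> T i (prev_arc i)") (auto simp: tri_break_def tri_break'_def)
    ultimately have "t = T i (next_arc i) \<or> t = T i (prev_arc i)" "i = 0 \<or> i = 1 \<or> i = 2"
      unfolding k less_3_iff by blast+
    then have "(i, t) \<in> {(0, T 0 1), (0, T 0 2), (1, T 1 0), (1, T 1 2), (2, T 2 0), (2, T 2 1)}"
      by (elim disjE) (simp_all add: next_arc_def prev_arc_def)
    then show "\<exists>q. ((i, t), q) \<in> ?C \<or> (q, (i, t)) \<in> ?C" by blast
  qed
  moreover have "(\<forall>(p, q)\<in>?C. arc_rule X x m w p q) \<longleftrightarrow> t.triangle_rules e F x m w"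
  proof -
    have "(\<forall>(p, q)\<in>?C. arc_rule X x m w p q) \<longleftrightarrow> arc_rule X x m w (0, T 0 1) (1, T 1 0) \<and>
        arc_rule X x m w (0, T 0 2) (2, T 2 0) \<and> arc_rule X x m w (1, T 1 2) (2, T 2 1)" by simp
    moreover have "arc_rule X x m w (i, T i j) (j, T j i) \<longleftrightarrow> oriented_rule (e i j) (f i j) (f j i)
       (if F i j then x i else m i) (if F i j then m i else w i)
       (if F j i then x j else m j) (if F j i then m j else w j)" if "i < 3" "j < 3" "i \<noteq> j" for i j
      using ops that unfolding arc_rule_def prod.case F_def e_def by simp
    ultimately show ?thesis unfolding t.triangle_rules_unfold by simp
  qed
  ultimately show "local_coloring X x m w \<longleftrightarrow>
      (\<forall>j<3. x j \<in> carrier X \<and> m j \<in> carrier X \<and> w j \<in> carrier X) \<and> t.triangle_rules e F x m w"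
    unfolding k by simp
qed

text \<open>The order condition and antisymmetry of \<open>e\<close> make the crossings agree about
  the sides of the triangle, as \<open>t.triangle_move\<close> requires. Turns are kept while
  \<open>\<tau>\<close> is negated, so the new order is the negation of the old one, and the way
  back is the same lemma applied to the negated order.\<close>

lemma triangle_move_equiv:
  fixes X :: "('a, 'm) psyquandle_scheme"
  assumes S: "S \<subseteq> psyquandle_hom X X"
    and D: "is_singular_diagram D" and D': "is_singular_diagram D'" and mv: "triangle_move D D' c T T'"
    and ops: "\<forall>i<3. \<forall>j<3. i \<noteq> j \<longrightarrow> strand_op X D (c i, T i j) (c j, T j i) = f i j"
      "\<forall>i<3. \<forall>j<3. i \<noteq> j \<longrightarrow> strand_op X D' (c i, T' i j) (c j, T' j i) = f i j"
    and f: "triangle_ops (carrier X) f"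
  shows "coloring_equiv X S D D'"
proof -
  obtain z r a b \<tau> where diff: "differ_in_disc D D' z r 3 c a b"
    and tri: "triangle D z r c a b T \<tau>" "triangle D' z r c a b T' (\<not> \<tau>)"
    and turns: "\<And>i j. i < 3 \<Longrightarrow> j < 3 \<Longrightarrow> i \<noteq> j \<Longrightarrow>
      turn D' (c i, T' i j) (c j, T' j i) = turn D (c i, T i j) (c j, T j i)"
    using mv unfolding triangle_move_def by blast
  have meets: "meets_disc_in_arcs D z r 3 c a b" "meets_disc_in_arcs D' z r 3 c a b"
    using diff by (auto simp: differ_in_disc_def)
  interpret D: disc_arcs D z r 3 c a b by unfold_locales (rule D, rule meets)
  interpret E: disc_arcs D' z r 3 c a b by unfold_locales (rule D', rule meets)
  interpret t: triangle_ops "carrier X" f by (rule f)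
  define e where "e = (\<lambda>i j. 0 < turn D (c i, T i j) (c j, T j i))"
  define F where "F = (\<lambda>i j. T i j = tri_break T i)"
  define e' where "e' = (\<lambda>i j. 0 < turn D' (c i, T' i j) (c j, T' j i))"
  define F' where "F' = (\<lambda>i j. T' i j = tri_break T' i)"
  note L = D.triangle_arcs(1)[OF refl tri(1) ops(1) f]
    D.triangle_arcs(2)[OF refl tri(1) ops(1) f, folded e_def F_def]
  note L' = E.triangle_arcs(1)[OF refl tri(2) ops(2) f]
    E.triangle_arcs(2)[OF refl tri(2) ops(2) f, folded e'_def F'_def]
  have FF: "F i j = (e j l = \<tau>) \<and> F i l = (\<not> F i j)"
    "F' i j = (e' j l = (\<not> \<tau>)) \<and> F' i l = (\<not> F' i j)" if "(i, j, l) \<in> {(0, 1, 2), (1, 2, 0), (2, 0, 1)}" for i j l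
    using D.triangle_arcs(3)[OF refl tri(1) ops(1) f that] E.triangle_arcs(3)[OF refl tri(2) ops(2) f that]
    unfolding e_def F_def e'_def F'_def by blast+
  have ee: "e' i j = e i j" if "i < 3" "j < 3" "i \<noteq> j" for i j unfolding e_def e'_def turns[OF that] ..
  have esym: "e j i = (\<not> e i j)" if "i < 3" "j < 3" "i \<noteq> j" for i j
    unfolding e_def using D.turn_pos_iff tri(1) that unfolding triangle_def by blast
  have e: "e 1 0 = (\<not> e 0 1)" "e 2 0 = (\<not> e 0 2)" "e 2 1 = (\<not> e 1 2)" by (rule esym; simp)+
  have e's: "e' 0 1 = e 0 1" "e' 0 2 = e 0 2" "e' 1 2 = e 1 2" "e' 1 0 = e 1 0" "e' 2 0 = e 2 0" "e' 2 1 = e 2 1"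
    by (rule ee; simp)+
  have F: "F 0 1 = (e 1 2 = \<tau>)" "F 0 2 = (\<not> F 0 1)" "F 1 2 = (e 2 0 = \<tau>)" "F 1 0 = (\<not> F 1 2)"
      "F 2 0 = (e 0 1 = \<tau>)" "F 2 1 = (\<not> F 2 0)"
    using FF(1)[of 0 1 2] FF(1)[of 1 2 0] FF(1)[of 2 0 1] by simp_all
  have F': "F' i j = (\<not> F i j)" if "(i, j) \<in> {(0, 1), (0, 2), (1, 2), (1, 0), (2, 0), (2, 1)}" for i j
    using that F FF(2)[of 0 1 2] FF(2)[of 1 2 0] FF(2)[of 2 0 1] e's
    by (elim insertE emptyE) (simp_all del: One_nat_def)
  have rules': "t.triangle_rules e' F' x m w = t.triangle_rules e (\<lambda>i j. \<not> F i j) x m w" for x m w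
    unfolding t.triangle_rules_unfold e's by (simp only: F' insert_iff simp_thms)
  have rules'': "t.triangle_rules e (\<lambda>i j. \<not> \<not> F i j) x m w = t.triangle_rules e F x m w" for x m w by simp
  have coh: "F 0 2 = (\<not> F 0 1)" "F 1 2 = (\<not> F 1 0)" "F 2 1 = (\<not> F 2 0)"
    "(F 0 1 = e 0 2) = (F 1 0 = e 1 2)" "(F 0 2 = e 0 1) = (F 2 0 = e 2 1)" "(F 1 2 = e 1 0) = (F 2 1 = e 2 0)"
    using F e by blast+
  show ?thesis
  proof (rule disc_change_equiv[OF S diff L(1) L'(1)])
    fix x m w
    assume "broken_arcs.local_coloring D 3 c (tri_break T) (tri_break' T) X x m w"
    then have *: "\<forall>j<3. x j \<in> carrier X \<and> m j \<in> carrier X \<and> w j \<in> carrier X" "t.triangle_rules e F x m w"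
      unfolding L(2) by blast+
    obtain m' where "\<forall>i<3. m' i \<in> carrier X" "t.triangle_rules e (\<lambda>i j. \<not> F i j) x m' w"
      using t.triangle_move[OF e coh *] by blast
    then show "\<exists>m'. broken_arcs.local_coloring D' 3 c (tri_break T') (tri_break' T') X x m' w"
      unfolding L'(2) rules' using *(1) by blast
  next
    fix x m w
    assume "broken_arcs.local_coloring D' 3 c (tri_break T') (tri_break' T') X x m w"
    then have *: "\<forall>j<3. x j \<in> carrier X \<and> m j \<in> carrier X \<and> w j \<in> carrier X"
      "t.triangle_rules e (\<lambda>i j. \<not> F i j) x m w"
      unfolding L'(2) rules' by blast+
    obtain m' where "\<forall>i<3. m' i \<in> carrier X" "t.triangle_rules e (\<lambda>i j. \<not> \<not> F i j) x m' w"
      using t.triangle_move[OF e _ _ _ _ _ _ *] coh by blast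
    then show "\<exists>m'. broken_arcs.local_coloring D 3 c (tri_break T) (tri_break' T) X x m' w"
      unfolding L(2) rules'' using *(1) by blast
  next
    fix x m m' w
    assume "broken_arcs.local_coloring D 3 c (tri_break T) (tri_break' T) X x m w"
      "broken_arcs.local_coloring D 3 c (tri_break T) (tri_break' T) X x m' w"
    then have "\<forall>i<3. x i \<in> carrier X \<and> m i \<in> carrier X \<and> w i \<in> carrier X \<and> m' i \<in> carrier X"
      and r: "t.triangle_rules e F x m w" "t.triangle_rules e F x m' w"
      unfolding L(2) by blast+
    then show "\<forall>j<3. m j = m' j" by (rule t.triangle_rules_unique)
  next
    fix x m m' w
    assume "broken_arcs.local_coloring D' 3 c (tri_break T') (tri_break' T') X x m w"
      "broken_arcs.local_coloring D' 3 c (tri_break T') (tri_break' T') X x m' w"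
    then have "\<forall>i<3. x i \<in> carrier X \<and> m i \<in> carrier X \<and> w i \<in> carrier X \<and> m' i \<in> carrier X"
      and r: "t.triangle_rules e' F' x m w" "t.triangle_rules e' F' x m' w"
      unfolding L'(2) by blast+
    then show "\<forall>j<3. m j = m' j" by (rule t.triangle_rules_unique)
  qed
qed

context
  fixes X :: "('a, 'm) psyquandle_scheme" and S :: "('a \<Rightarrow> 'a) set"
  assumes X: "psyquandle X" and fin: "finite (carrier X)" and S: "S \<subseteq> psyquandle_hom X X"
begin

interpretation psyquandle X by (rule X)

lemma six_pairs:
  assumes "i < 3" "j < 3" "i \<noteq> (j::nat)"
  shows "(i, j) \<in> {(0, 1), (0, 2), (1, 2), (1, 0), (2, 0), (2, 1)}"
  using assms unfolding less_3_iff by auto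

lemma move_III_equiv:
  assumes D: "is_singular_diagram D" and D': "is_singular_diagram D'" and mv: "move_III D D'"
  shows "coloring_equiv X S D D'"
proof -
  obtain c T T' where tm: "triangle_move D D' c T T'"
    and o: "arc_over D c T 0 1" "arc_over D c T 0 2" "arc_over D c T 1 2"
    and o': "arc_over D' c T' 0 1" "arc_over D' c T' 0 2" "arc_over D' c T' 1 2"
    using mv unfolding move_III_def by (elim exE conjE) (rule that)
  have dg: "diagram D" "diagram D'" by unfold_locales (rule D D')+
  have ops: "strand_op X D (c i, T i j) (c j, T j i) = (if i < j then tri_o X else tri_u X)"
    if "i < 3" "j < 3" "i \<noteq> j" for i j
    using six_pairs[OF that] crosses_over_ops[OF dg(1) o(1)[unfolded arc_over_def], of X]
      crosses_over_ops[OF dg(1) o(2)[unfolded arc_over_def], of X]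
      crosses_over_ops[OF dg(1) o(3)[unfolded arc_over_def], of X]
    by (elim insertE emptyE) simp_all
  have ops': "strand_op X D' (c i, T' i j) (c j, T' j i) = (if i < j then tri_o X else tri_u X)"
    if "i < 3" "j < 3" "i \<noteq> j" for i j
    using six_pairs[OF that] crosses_over_ops[OF dg(2) o'(1)[unfolded arc_over_def], of X]
      crosses_over_ops[OF dg(2) o'(2)[unfolded arc_over_def], of X]
      crosses_over_ops[OF dg(2) o'(3)[unfolded arc_over_def], of X]
    by (elim insertE emptyE) simp_all
  show ?thesis by (rule triangle_move_equiv[OF S D D' tm _ _ triangle_ops_classical]) (use ops ops' in blast)+
qed

lemma move_slide_equiv:
  assumes D: "is_singular_diagram D" and D': "is_singular_diagram D'" and mv: "move_slide D D'"
  shows "coloring_equiv X S D D'"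
proof -
  obtain c T T' where tm: "triangle_move D D' c T T'"
    and sg: "crosses_singularly D (c 0, T 0 1) (c 1, T 1 0)" "crosses_singularly D' (c 0, T' 0 1) (c 1, T' 1 0)"
    and o: "arc_over D c T 2 0 \<and> arc_over D c T 2 1 \<and> arc_over D' c T' 2 0 \<and> arc_over D' c T' 2 1 \<or>
         arc_over D c T 0 2 \<and> arc_over D c T 1 2 \<and> arc_over D' c T' 0 2 \<and> arc_over D' c T' 1 2"
    using mv unfolding move_slide_def by (elim exE conjE) (rule that)
  have dg: "diagram D" "diagram D'" by unfold_locales (rule D D')+
  define e where "e = (0 < turn D (c 0, T 0 1) (c 1, T 1 0))"
  have e': "(0 < turn D' (c 0, T' 0 1) (c 1, T' 1 0)) = e"
    using tm unfolding triangle_move_def e_def by auto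
  \<comment> \<open>The alternative, strand 2 over or under, is settled for both diagrams at once,
    so that one \<open>f\<close> serves both.\<close>
  define ov where "ov = (arc_over D c T 2 0 \<and> arc_over D c T 2 1 \<and> arc_over D' c T' 2 0 \<and> arc_over D' c T' 2 1)"
  define f where "f = (\<lambda>i j :: nat.
    if i = 2 then (if ov then tri_o X else tri_u X) else if j = 2 then (if ov then tri_u X else tri_o X)
    else if (i < j) = e then dot_u X else dot_o X)"
  \<comment> \<open>Stated for a generic diagram \<open>G\<close>, since \<open>D\<close> and
    \<open>D'\<close> share the direction \<open>e\<close> of the singular crossing.\<close>
  have ops: "strand_op X G (c i, U i j) (c j, U j i) = f i j"
    if G: "diagram G" and sG: "crosses_singularly G (c 0, U 0 1) (c 1, U 1 0)"
      and eG: "(0 < turn G (c 0, U 0 1) (c 1, U 1 0)) = e"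
      and oG: "if ov then arc_over G c U 2 0 \<and> arc_over G c U 2 1 else arc_over G c U 0 2 \<and> arc_over G c U 1 2"
      and ij: "i < 3" "j < 3" "i \<noteq> j" for G U i j
  proof (cases ov)
    case True
    then have "crosses_over G (c 2, U 2 0) (c 0, U 0 2)" "crosses_over G (c 2, U 2 1) (c 1, U 1 2)"
      using oG by (simp_all add: arc_over_def)
    from crosses_over_ops[OF G this(1), of X] crosses_over_ops[OF G this(2), of X] crosses_singularly_ops[OF G sG, of X]
    show ?thesis using six_pairs[OF ij] True unfolding f_def eG by (elim insertE emptyE) simp_all
  next
    case False
    then have "crosses_over G (c 0, U 0 2) (c 2, U 2 0)" "crosses_over G (c 1, U 1 2) (c 2, U 2 1)"
      using oG by (simp_all add: arc_over_def)
    from crosses_over_ops[OF G this(1), of X] crosses_over_ops[OF G this(2), of X] crosses_singularly_ops[OF G sG, of X]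
    show ?thesis using six_pairs[OF ij] False unfolding f_def eG by (elim insertE emptyE) simp_all
  qed
  have o': "if ov then arc_over D c T 2 0 \<and> arc_over D c T 2 1 else arc_over D c T 0 2 \<and> arc_over D c T 1 2"
    "if ov then arc_over D' c T' 2 0 \<and> arc_over D' c T' 2 1 else arc_over D' c T' 0 2 \<and> arc_over D' c T' 1 2"
    using o unfolding ov_def by argo+
  show ?thesis
    by (rule triangle_move_equiv[OF S D D' tm, of f])
      (use ops[OF dg(1) sg(1) e_def[symmetric] o'(1)] ops[OF dg(2) sg(2) e' o'(2)] triangle_ops_slide[of ov e, folded f_def] in blast)+
qed

section \<open>Single steps and sequences of steps\<close>

lemma diagram_step_equiv:
  assumes "diagram_step D D'"
  shows "coloring_equiv X S D D'"
proof -
  have D: "is_singular_diagram D" "is_singular_diagram D'"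
    and "reparametrized D D' \<or> planar_isotopic D D' \<or> move_I D D' \<or> move_II D D' \<or> move_III D D' \<or>
      move_slide D D' \<or> move_exchange D D'"
    using assms unfolding diagram_step_def by simp_all
  then show ?thesis
    by (elim disjE) (rule planar_isotopy_equiv[OF D S] reparametrized_equiv[OF D S]
        move_I_equiv[OF X fin S D] move_II_equiv[OF X fin S D] move_exchange_equiv[OF X fin S D]
        move_III_equiv[OF D] move_slide_equiv[OF D]; assumption)+
qed

lemma represent_same_link_equiv:
  assumes "represent_same_link D D'"
  shows "coloring_equiv X S D D'"
  using assms unfolding represent_same_link_def
proof (induction rule: equivclp_induct)
  case base
  show ?case by (rule coloring_equiv_refl)
next
  case (step D' D'')
  \<comment> \<open>A step taken backwards; the inversion of the bijection draws on the
    well-formedness contained in \<open>diagram_step\<close>.\<close>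
  have "coloring_equiv X S D' D''" if "diagram_step D'' D'"
    using coloring_equiv_sym[OF _ S diagram_step_equiv[OF that]] that by (simp add: diagram_step_def)
  then show ?case using step diagram_step_equiv coloring_equiv_trans by blast
qed

end

theorem theorem2:
  fixes X :: "'a psyquandle" and S :: "('a \<Rightarrow> 'a) set" and D D' :: singular_diagram
  assumes "psyquandle X" and "finite (carrier X)"
    and "S \<subseteq> psyquandle_hom X X"
    and "is_singular_diagram D" and "is_singular_diagram D'"
    and "represent_same_link D D'"
  shows "digraph_iso (coloring_quiver X S D) (coloring_quiver X S D')"
  using coloring_quiver_iso[OF assms(2-5)] represent_same_link_equiv[OF assms(1-3,6)] .

end
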